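(* There exists a probability measure $\mu$ on $[0,+\infty[$, absolutely continuous with respect to the Lebesgue measure, such that $\mu_T$ converges vaguely to $\mu$ as $T\to+\infty$. Furthermore: \begin{itemize} \item the support of $\mu$ is $\operatorname{supp}\mu=[1,+\infty[$; \item for every $\delta>0$, $$\mu([0,\delta]) = 2\int_{s=0}^{+\infty} dx\Big(\operatorname{pr}\Big(\bigcup_{\substack{p,q\in\mathbb{Z}[i]\\ p\neq 0}} A\Big(\frac{q}{p},\frac{e^{s}}{\delta},\frac{e^{s/2}}{|p|}\Big)\Big)\Big)\,e^{-2s}\,ds\,;$$ \item as $\delta\to+\infty$, $$\mu(\,]\delta,+\infty[\,)=\frac{1}{\delta^4}+\operatorname{O}\Big(\frac{1}{\delta^5}\Big).$$ \end{itemize}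
   Context: Let $\operatorname{pr}:\mathbb{C}\to\mathbb{C}/\mathbb{Z}[i]$ be the canonical projection, $dx$ the Haar probability measure on $\mathbb{C}/\mathbb{Z}[i]$, and $d$ the quotient distance on $\mathbb{C}/\mathbb{Z}[i]$ induced by the Euclidean distance on $\mathbb{C}$. For $T>0$ set $$\mathcal{G}_T=\Big\{\operatorname{pr}\Big(\frac{p}{q}\Big) : p,q\in\mathbb{Z}[i],\ 0<|q|\le T\Big\}\subset\mathbb{C}/\mathbb{Z}[i].$$ $\Delta_x$ denotes the Dirac mass at $x$. For $T$ large enough (so that $\mathcal{G}_T$ has at least two elements), define the probability measure on $[0,+\infty[$ $$\mu_T=\frac{1}{\operatorname{card}\mathcal{G}_T}\sum_{r\in\mathcal{G}_T}\Delta_{T^2 d(r,\,\mathcal{G}_T\smallsetminus\{r\})}.$$ For $z\in\mathbb{C}$ and $r,R>0$, $A(z,r,R)\subset\mathbb{C}$ denotes the closed annulus $\{w\in\mathbb{C}: r\le|w-z|\le R\}$ (empty if $R<r$). $]a,b[$ denotes the open interval, $[a,b[$ the half-open one. *)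

theory Defs
  imports "HOL-Probability.Probability" "HOL-Library.Landau_Symbols"
begin

definition gaussian_ints :: "complex set" where
  "gaussian_ints = {z. Re z \<in> \<int> \<and> Im z \<in> \<int>}"

lemma gaussian_ints_0 [simp]: "0 \<in> gaussian_ints"
  and gaussian_ints_uminus: "g \<in> gaussian_ints \<Longrightarrow> - g \<in> gaussian_ints"
  and gaussian_ints_add: "g \<in> gaussian_ints \<Longrightarrow> h \<in> gaussian_ints \<Longrightarrow> g + h \<in> gaussian_ints"
  and gaussian_ints_diff: "g \<in> gaussian_ints \<Longrightarrow> h \<in> gaussian_ints \<Longrightarrow> g - h \<in> gaussian_ints"
  and gaussian_ints_mult: "g \<in> gaussian_ints \<Longrightarrow> h \<in> gaussian_ints \<Longrightarrow> g * h \<in> gaussian_ints"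
  by (auto simp: gaussian_ints_def)

lemma closed_gaussian_ints: "closed gaussian_ints"
proof -
  have "gaussian_ints = Re -` \<int> \<inter> Im -` \<int>"
    by (auto simp: gaussian_ints_def)
  moreover have "closed (Re -` (\<int> :: real set))" "closed (Im -` (\<int> :: real set))"
    by (intro continuous_closed_vimage closed_Ints continuous_intros)+
  ultimately show ?thesis by (metis closed_Int)
qed

lemma gaussian_ints_conv_image: "gaussian_ints = (\<lambda>(a, b). Complex (of_int a) (of_int b)) ` UNIV"
proof (intro equalityI subsetI)
  fix z assume "z \<in> gaussian_ints"
  then obtain a b where "Re z = of_int a" "Im z = of_int b"
    by (auto simp: gaussian_ints_def elim!: Ints_cases)
  then have "z = (\<lambda>(a, b). Complex (of_int a) (of_int b)) (a, b)"
    by (simp add: complex_eq_iff)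
  then show "z \<in> (\<lambda>(a, b). Complex (of_int a) (of_int b)) ` UNIV"
    by (rule image_eqI) simp
qed (auto simp: gaussian_ints_def)

lemma countable_gaussian_ints: "countable gaussian_ints"
  unfolding gaussian_ints_conv_image by (intro countable_image) simp

quotient_type gtorus = complex / "\<lambda>z w. z - w \<in> gaussian_ints"
  morphisms rep_gtorus pr
proof (rule equivpI)
  show "reflp (\<lambda>z w. z - w \<in> gaussian_ints)"
    by (simp add: reflp_def)
  show "symp (\<lambda>z w. z - w \<in> gaussian_ints)"
  proof (rule sympI)
    fix x y assume "x - y \<in> gaussian_ints"
    then have "- (x - y) \<in> gaussian_ints" by (rule gaussian_ints_uminus)
    then show "y - x \<in> gaussian_ints" by simp
  qed
  show "transp (\<lambda>z w. z - w \<in> gaussian_ints)"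
  proof (rule transpI)
    fix x y z assume "x - y \<in> gaussian_ints" "y - z \<in> gaussian_ints"
    then have "(x - y) + (y - z) \<in> gaussian_ints" by (rule gaussian_ints_add)
    then show "x - z \<in> gaussian_ints" by simp
  qed
qed

lemma pr_eq_iff: "pr z = pr w \<longleftrightarrow> z - w \<in> gaussian_ints"
  by (rule gtorus.abs_eq_iff)

lemma pr_cases [cases type: gtorus]: obtains z where "x = pr z"
  by (rule that[of "rep_gtorus x"]) (simp add: Quotient3_abs_rep[OF Quotient3_gtorus])

instantiation gtorus :: ab_group_add
begin

lift_definition zero_gtorus :: gtorus is 0 .

lift_definition plus_gtorus :: "gtorus \<Rightarrow> gtorus \<Rightarrow> gtorus" is "(+)"
proof -
  fix a b c d :: complex assume "a - b \<in> gaussian_ints" "c - d \<in> gaussian_ints"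
  then have "(a - b) + (c - d) \<in> gaussian_ints" by (rule gaussian_ints_add)
  then show "a + c - (b + d) \<in> gaussian_ints" by (simp add: algebra_simps)
qed

lift_definition minus_gtorus :: "gtorus \<Rightarrow> gtorus \<Rightarrow> gtorus" is "(-)"
proof -
  fix a b c d :: complex assume "a - b \<in> gaussian_ints" "c - d \<in> gaussian_ints"
  then have "(a - b) - (c - d) \<in> gaussian_ints" by (rule gaussian_ints_diff)
  then show "a - c - (b - d) \<in> gaussian_ints" by (simp add: algebra_simps)
qed

lift_definition uminus_gtorus :: "gtorus \<Rightarrow> gtorus" is "uminus"
proof -
  fix a b :: complex assume "a - b \<in> gaussian_ints"
  then have "- (a - b) \<in> gaussian_ints" by (rule gaussian_ints_uminus)
  then show "- a - - b \<in> gaussian_ints" by (simp add: algebra_simps)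
qed

instance
  by standard (transfer; simp add: algebra_simps)+

end

lemma pr_add: "pr z + pr w = pr (z + w)"
  by (rule plus_gtorus.abs_eq)

lemma pr_diff: "pr z - pr w = pr (z - w)"
  by (rule minus_gtorus.abs_eq)

lemma pr_fibre: "{z. pr z = pr w} = (\<lambda>g. w + g) ` gaussian_ints"
proof (intro equalityI subsetI)
  fix z assume "z \<in> {z. pr z = pr w}"
  then have "z - w \<in> gaussian_ints" by (simp add: pr_eq_iff)
  then have "w + (z - w) \<in> (\<lambda>g. w + g) ` gaussian_ints" by (rule imageI)
  then show "z \<in> (\<lambda>g. w + g) ` gaussian_ints" by simp
qed (auto simp: pr_eq_iff)

text \<open>The quotient distance is the infimum of the Euclidean distances between representatives.\<close>

instantiation gtorus :: metric_space
begin

definition dist_gtorus :: "gtorus \<Rightarrow> gtorus \<Rightarrow> real" where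
  "dist_gtorus x y = setdist {z. pr z = x} {w. pr w = y}"

definition uniformity_gtorus :: "(gtorus \<times> gtorus) filter" where
  "uniformity_gtorus = (INF e\<in>{0 <..}. principal {(x, y). dist x y < e})"

definition open_gtorus :: "gtorus set \<Rightarrow> bool" where
  "open_gtorus U \<longleftrightarrow> (\<forall>x\<in>U. eventually (\<lambda>(x', y). x' = x \<longrightarrow> y \<in> U) uniformity)"

lemma dist_pr_le: "dist (pr z) (pr w) \<le> dist z w"
  unfolding dist_gtorus_def by (rule setdist_le_dist) auto

lemma dist_pr_attained: obtains w' where "pr w' = y" "dist (pr z) y = dist z w'"
proof (cases y)
  case (1 w)
  have "closed {w'. pr w' = pr w}"
    unfolding pr_fibre by (intro closed_translation closed_gaussian_ints)
  moreover have "{w'. pr w' = pr w} \<noteq> {}" by auto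
  ultimately obtain w1 where w1: "pr w1 = pr w" "infdist z {w'. pr w' = pr w} = dist z w1"
    using infdist_attains_inf[of "{w'. pr w' = pr w}" z] by auto
  have "dist z w1 \<le> setdist {z'. pr z' = pr z} {w'. pr w' = pr w}"
  proof (rule le_setdistI)
    fix a b assume a: "a \<in> {z'. pr z' = pr z}" and b: "b \<in> {w'. pr w' = pr w}"
    have az: "a - z \<in> gaussian_ints" and bw: "b - w \<in> gaussian_ints"
      using a b by (auto simp: pr_eq_iff)
    have "(b - w) - (a - z) \<in> gaussian_ints" by (rule gaussian_ints_diff[OF bw az])
    then have "pr (b - a + z) = pr w"
      unfolding pr_eq_iff by (simp add: algebra_simps)
    then have "dist z w1 \<le> dist z (b - a + z)"
      unfolding w1(2)[symmetric] by (intro infdist_le) auto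
    also have "\<dots> = dist a b" by (simp add: dist_norm norm_minus_commute)
    finally show "dist z w1 \<le> dist a b" .
  qed auto
  then have "dist (pr z) y = dist z w1"
    using dist_pr_le[of z w1] unfolding 1 w1(1) dist_gtorus_def by simp
  with w1(1) 1 that show thesis by auto
qed

instance
proof
  fix x y :: gtorus
  show "dist x y = 0 \<longleftrightarrow> x = y"
  proof (cases x)
    case (1 z)
    show ?thesis
    proof
      assume "dist x y = 0"
      moreover obtain w where "pr w = y" "dist (pr z) y = dist z w"
        by (rule dist_pr_attained)
      ultimately show "x = y" using 1 by simp
    next
      assume "x = y"
      then have "dist x y \<le> 0" using 1 dist_pr_le[of z z] by simp
      moreover have "0 \<le> dist x y" unfolding dist_gtorus_def by (rule setdist_pos_le)
      ultimately show "dist x y = 0" by simp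
    qed
  qed
next
  have sym: "dist x y = dist y x" for x y :: gtorus
    unfolding dist_gtorus_def by (rule setdist_sym)
  fix x y a :: gtorus
  show "dist x y \<le> dist x a + dist y a"
  proof (cases a)
    case (1 w)
    obtain z1 where z1: "pr z1 = x" "dist (pr w) x = dist w z1"
      by (rule dist_pr_attained)
    obtain z2 where z2: "pr z2 = y" "dist (pr w) y = dist w z2"
      by (rule dist_pr_attained)
    have "dist x y \<le> dist z1 z2" using dist_pr_le[of z1 z2] z1 z2 by simp
    also have "\<dots> \<le> dist w z1 + dist w z2" by (rule dist_triangle3)
    also have "\<dots> = dist x a + dist y a"
      unfolding 1 sym[of x] sym[of y] z1(2) z2(2) ..
    finally show ?thesis .
  qed
qed (simp_all only: uniformity_gtorus_def open_gtorus_def)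

end

lemma pr_ball: "pr ` ball z e = ball (pr z) e"
proof (intro equalityI subsetI)
  fix y assume "y \<in> ball (pr z) e"
  moreover obtain w where "pr w = y" "dist (pr z) y = dist z w"
    by (rule dist_pr_attained)
  ultimately have "pr w = y" "dist z w < e" by auto
  then show "y \<in> pr ` ball z e" by auto
qed (auto intro: le_less_trans[OF dist_pr_le])

lemma continuous_on_pr [continuous_intros]: "continuous_on S pr"
proof (rule continuous_on_subset)
  show "continuous_on UNIV pr"
    unfolding continuous_on_iff using le_less_trans[OF dist_pr_le] by blast
qed simp

lemma borel_measurable_pr [measurable]: "pr \<in> borel_measurable borel"
  by (intro borel_measurable_continuous_onI continuous_on_pr)

lemma open_pr_image: assumes "open U" shows "open (pr ` U)"
  unfolding open_contains_ball
proof
  fix x assume "x \<in> pr ` U"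
  then obtain z where z: "z \<in> U" "x = pr z" by blast
  then obtain e where "e > 0" "ball z e \<subseteq> U"
    using assms open_contains_ball by blast
  then show "\<exists>e>0. ball x e \<subseteq> pr ` U"
    using z pr_ball[of z e] image_mono[of "ball z e" U pr] by auto
qed

instance gtorus :: second_countable_topology
proof
  obtain B :: "complex set set" where B: "countable B" "topological_basis B"
    using ex_countable_basis by blast
  have "topological_basis ((`) pr ` B)"
  proof (rule topological_basisI)
    fix C assume "C \<in> (`) pr ` B"
    then show "open C"
      using B by (auto intro: open_pr_image topological_basis_open)
  next
    fix U :: "gtorus set" and x assume U: "open U" "x \<in> U"
    obtain z where z: "x = pr z" by (cases x)
    have "open (pr -` U)"
      using U continuous_on_pr by (intro open_vimage) auto
    moreover have "z \<in> pr -` U"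
      using U z by simp
    ultimately obtain C where C: "C \<in> B" "z \<in> C" "C \<subseteq> pr -` U"
      by (rule topological_basisE[OF B(2)])
    show "\<exists>C\<in>(`) pr ` B. x \<in> C \<and> C \<subseteq> U"
    proof (intro bexI conjI)
      show "x \<in> pr ` C" unfolding z using C(2) by (rule imageI)
      show "pr ` C \<subseteq> U" using C(3) by (simp add: image_subset_iff_subset_vimage)
      show "pr ` C \<in> (`) pr ` B" using C(1) by (rule imageI)
    qed
  qed
  with B(1) show "\<exists>B :: gtorus set set. countable B \<and> open = generate_topology B"
    by (intro exI[of _ "(`) pr ` B"]) (auto intro: topological_basis_imp_subbasis)
qed

lemma dist_gtorus_add: "dist (a + b) (c + d) \<le> dist a c + dist b (d :: gtorus)"
proof -
  obtain z where z: "a = pr z" by (cases a)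
  obtain w where w: "b = pr w" by (cases b)
  obtain z' where z': "pr z' = c" "dist (pr z) c = dist z z'" by (rule dist_pr_attained)
  obtain w' where w': "pr w' = d" "dist (pr w) d = dist w w'" by (rule dist_pr_attained)
  have "dist (pr (z + w)) (pr (z' + w')) \<le> dist (z + w) (z' + w')" by (rule dist_pr_le)
  also have "\<dots> \<le> dist z z' + dist w w'" by (rule dist_triangle_add)
  finally show ?thesis unfolding z w z'(2) w'(2) by (simp add: pr_add flip: z'(1) w'(1))
qed

lemma continuous_gtorus_add: "continuous_on UNIV (\<lambda>p :: gtorus \<times> gtorus. fst p + snd p)"
  unfolding continuous_on_iff
proof (intro ballI allI impI)
  fix p :: "gtorus \<times> gtorus" and e :: real assume "e > 0"
  show "\<exists>d>0. \<forall>q\<in>UNIV. dist q p < d \<longrightarrow> dist (fst q + snd q) (fst p + snd p) < e"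
  proof (intro exI[of _ "e/2"] conjI ballI impI)
    fix q assume "dist q p < e / 2"
    then have "dist (fst q) (fst p) < e / 2" "dist (snd q) (snd p) < e / 2"
      using dist_fst_le[of q p] dist_snd_le[of q p] by linarith+
    then show "dist (fst q + snd q) (fst p + snd p) < e"
      using dist_gtorus_add[of "fst q" "snd q" "fst p" "snd p"] by linarith
  qed (use \<open>e > 0\<close> in auto)
qed

lemma measurable_gtorus_add [measurable]:
  "(\<lambda>p :: gtorus \<times> gtorus. fst p + snd p) \<in> borel_measurable (borel \<Otimes>\<^sub>M borel)"
  using borel_measurable_continuous_onI[OF continuous_gtorus_add] by (simp add: borel_prod)

lemma measurable_gtorus_translation [measurable]:
  "(+) (a :: gtorus) \<in> borel_measurable borel"
proof (intro borel_measurable_continuous_onI)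
  show "continuous_on UNIV ((+) a)"
    unfolding continuous_on_iff
  proof (intro ballI allI impI)
    fix x and e :: real assume "e > 0"
    moreover have "dist (a + y) (a + x) \<le> dist y x" for y
      using dist_gtorus_add[of a y a x] by simp
    ultimately show "\<exists>d>0. \<forall>y\<in>UNIV. dist y x < d \<longrightarrow> dist (a + y) (a + x) < e"
      using le_less_trans by blast
  qed
qed

definition is_haar_prob :: "'a :: {ab_group_add, topological_space} measure \<Rightarrow> bool" where
  "is_haar_prob M \<longleftrightarrow> prob_space M \<and> sets M = sets borel \<and> (\<forall>a. distr M borel ((+) a) = M)"

definition haar_prob :: "'a :: {ab_group_add, topological_space} measure" where
  "haar_prob = (THE M. is_haar_prob M)"

text \<open>On the torus, existence and uniqueness hold: the Haar probability measure is the image of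
  Lebesgue measure on the half-open unit square.\<close>

definition unit_square :: "complex set" where
  "unit_square = {z. 0 \<le> Re z \<and> Re z < 1 \<and> 0 \<le> Im z \<and> Im z < 1}"

lemma unit_square_borel [measurable]: "unit_square \<in> sets borel"
  unfolding unit_square_def by measurable

lemma unit_square_translates: "\<exists>!g. g \<in> gaussian_ints \<and> z - g \<in> unit_square"
proof (rule ex1I)
  let ?g = "Complex (of_int \<lfloor>Re z\<rfloor>) (of_int \<lfloor>Im z\<rfloor>)"
  show "?g \<in> gaussian_ints \<and> z - ?g \<in> unit_square"
    by (auto simp: gaussian_ints_def unit_square_def) linarith+
  fix g assume g: "g \<in> gaussian_ints \<and> z - g \<in> unit_square"
  then obtain a b where ab: "Re g = of_int a" "Im g = of_int b"
    by (auto simp: gaussian_ints_def elim!: Ints_cases)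
  have "\<lfloor>Re z\<rfloor> = a" "\<lfloor>Im z\<rfloor> = b"
    using g ab by (auto simp: unit_square_def floor_eq_iff)
  then show "g = ?g" using ab by (simp add: complex_eq_iff)
qed

lemma emeasure_lborel_translate:
  fixes c :: complex
  assumes "A \<in> sets borel"
  shows "emeasure lborel ((\<lambda>z. z + c) -` A) = emeasure lborel A"
proof -
  have "emeasure lborel A = emeasure (distr lborel borel (\<lambda>z. c + z)) A"
    by (simp add: lborel_distr_plus)
  also have "\<dots> = emeasure lborel ((\<lambda>z. z + c) -` A)"
    using assms by (subst emeasure_distr) (simp_all add: vimage_def add.commute)
  finally show ?thesis by simp
qed

lemma emeasure_unit_square: "emeasure lborel unit_square = 1"
proof -
  have 1: "emeasure lborel (box 0 (Complex 1 1)) = 1"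
    and 2: "emeasure lborel (cbox 0 (Complex 1 1)) = 1"
    by (simp_all add: emeasure_lborel_box_eq emeasure_lborel_cbox_eq Basis_complex_def)
  have "box 0 (Complex 1 1) \<subseteq> unit_square" "unit_square \<subseteq> cbox 0 (Complex 1 1)"
    by (auto simp: unit_square_def in_box_complex_iff in_cbox_complex_iff)
  then have "1 \<le> emeasure lborel unit_square" "emeasure lborel unit_square \<le> 1"
    using emeasure_mono[of "box 0 (Complex 1 1)" unit_square lborel]
      emeasure_mono[of unit_square "cbox 0 (Complex 1 1)" lborel] 1 2 by auto
  then show ?thesis by (rule antisym[rotated])
qed

definition square_measure :: "gtorus measure" where
  "square_measure = distr (restrict_space lborel unit_square) borel pr"

lemma measurable_pr_square: "pr \<in> measurable (restrict_space lborel unit_square) borel"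
  by (rule measurable_restrict_space1) simp

lemma emeasure_square_measure:
  assumes [measurable]: "A \<in> sets borel"
  shows "emeasure square_measure A = emeasure lborel (pr -` A \<inter> unit_square)"
proof -
  have "emeasure square_measure A
      = emeasure (restrict_space lborel unit_square) (pr -` A \<inter> unit_square)"
    unfolding square_measure_def
    by (subst emeasure_distr[OF measurable_pr_square assms])
       (simp add: space_restrict_space)
  also have "\<dots> = emeasure lborel (pr -` A \<inter> unit_square)"
    by (rule emeasure_restrict_space) auto
  finally show ?thesis .
qed

lemma emeasure_fundamental_domains:
  fixes B :: "complex set"
  assumes B [measurable]: "B \<in> sets borel"
    and per: "\<And>z g. g \<in> gaussian_ints \<Longrightarrow> z + g \<in> B \<longleftrightarrow> z \<in> B"
  shows "emeasure lborel (B \<inter> {z. z - c \<in> unit_square}) = emeasure lborel (B \<inter> unit_square)"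
proof -
  let ?Q = unit_square
  let ?Qc = "{z. z - c \<in> ?Q}"
  have [measurable]: "{z. z - a \<in> ?Q} \<in> sets borel" for a
    by measurable
  have *: "(\<integral>\<^sup>+g. emeasure lborel (C \<inter> f g) \<partial>count_space gaussian_ints) = emeasure lborel C"
    if [measurable]: "C \<in> sets borel" and f: "\<And>g. f g \<in> sets borel"
      and part: "\<And>z. \<exists>!g. g \<in> gaussian_ints \<and> z \<in> f g"
    for C :: "complex set" and f
  proof -
    have "emeasure lborel (\<Union>g\<in>gaussian_ints. C \<inter> f g)
        = (\<integral>\<^sup>+g. emeasure lborel (C \<inter> f g) \<partial>count_space gaussian_ints)"
    proof (rule emeasure_UN_countable)
      show "disjoint_family_on (\<lambda>g. C \<inter> f g) gaussian_ints"
        unfolding disjoint_family_on_def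
      proof (intro ballI impI)
        fix g h assume "g \<in> gaussian_ints" "h \<in> gaussian_ints" "g \<noteq> h"
        then have "z \<notin> f g \<or> z \<notin> f h" for z using part[of z] by blast
        then show "C \<inter> f g \<inter> (C \<inter> f h) = {}" by blast
      qed
    qed (use f countable_gaussian_ints in auto)
    moreover have "(\<Union>g\<in>gaussian_ints. C \<inter> f g) = C"
    proof (intro equalityI subsetI)
      fix z assume "z \<in> C"
      moreover obtain g where "g \<in> gaussian_ints" "z \<in> f g" using part[of z] by blast
      ultimately show "z \<in> (\<Union>g\<in>gaussian_ints. C \<inter> f g)" by blast
    qed blast
    ultimately show ?thesis by simp
  qed
  have "emeasure lborel (B \<inter> ?Qc)
      = (\<integral>\<^sup>+g. emeasure lborel (B \<inter> ?Qc \<inter> {z. z - g \<in> ?Q}) \<partial>count_space gaussian_ints)"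
  proof (rule *[symmetric])
    show "\<exists>!g. g \<in> gaussian_ints \<and> z \<in> {z. z - g \<in> ?Q}" for z
      using unit_square_translates[of z] by simp
  qed measurable
  also have "\<dots> = (\<integral>\<^sup>+g. emeasure lborel (B \<inter> ?Q \<inter> {z. z + g - c \<in> ?Q}) \<partial>count_space gaussian_ints)"
  proof (rule nn_integral_cong)
    fix g assume "g \<in> space (count_space gaussian_ints)"
    then have g: "g \<in> gaussian_ints" by simp
    have "(\<lambda>z. z + g) -` (B \<inter> ?Qc \<inter> {z. z - g \<in> ?Q}) = B \<inter> ?Q \<inter> {z. z + g - c \<in> ?Q}"
      using per[OF g] by auto
    then show "emeasure lborel (B \<inter> ?Qc \<inter> {z. z - g \<in> ?Q})
        = emeasure lborel (B \<inter> ?Q \<inter> {z. z + g - c \<in> ?Q})"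
      using emeasure_lborel_translate[of "B \<inter> ?Qc \<inter> {z. z - g \<in> ?Q}" g] by simp
  qed
  also have "\<dots> = emeasure lborel (B \<inter> ?Q)"
  proof (rule *)
    fix z
    obtain h where h: "h \<in> gaussian_ints" "(z - c) - h \<in> ?Q"
      using unit_square_translates by blast
    show "\<exists>!g. g \<in> gaussian_ints \<and> z \<in> {z. z + g - c \<in> ?Q}"
    proof (rule ex1I)
      show "- h \<in> gaussian_ints \<and> z \<in> {z. z + - h - c \<in> ?Q}"
        using h gaussian_ints_uminus[of h] by (simp add: algebra_simps)
      fix g assume "g \<in> gaussian_ints \<and> z \<in> {z. z + g - c \<in> ?Q}"
      then have "- g \<in> gaussian_ints \<and> (z - c) - (- g) \<in> ?Q"
        using gaussian_ints_uminus[of g] by (simp add: algebra_simps)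
      then have "- g = h"
        using h unit_square_translates[of "z - c"] by blast
      then show "g = - h" by auto
    qed
  qed measurable
  finally show ?thesis .
qed

lemma is_haar_prob_square_measure: "is_haar_prob square_measure"
  unfolding is_haar_prob_def
proof (intro conjI allI)
  show sets: "sets square_measure = sets borel"
    by (simp add: square_measure_def)
  show "prob_space square_measure"
  proof
    have "emeasure square_measure (space square_measure) = emeasure square_measure UNIV"
      using sets_eq_imp_space_eq[OF sets] by simp
    then show "emeasure square_measure (space square_measure) = 1"
      by (simp add: emeasure_square_measure emeasure_unit_square)
  qed
  fix a :: gtorus
  obtain c where c: "a = pr c" by (cases a)
  show "distr square_measure borel ((+) a) = square_measure"
  proof (rule measure_eqI)
    fix A assume "A \<in> sets (distr square_measure borel ((+) a))"
    then have A [measurable]: "A \<in> sets borel" by simp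
    have B [measurable]: "pr -` A \<in> sets borel"
      using measurable_sets[OF borel_measurable_pr A] by simp
    have per: "z + g \<in> pr -` A \<longleftrightarrow> z \<in> pr -` A" if "g \<in> gaussian_ints" for z g
    proof -
      have "pr (z + g) = pr z" using that by (simp add: pr_eq_iff)
      then show ?thesis by simp
    qed
    have [measurable]: "(+) a \<in> measurable square_measure borel"
      using measurable_gtorus_translation measurable_cong_sets[OF sets] by blast
    have "emeasure (distr square_measure borel ((+) a)) A = emeasure square_measure ((+) a -` A)"
      by (subst emeasure_distr) (auto simp: sets_eq_imp_space_eq[OF sets])
    also have "\<dots> = emeasure lborel (pr -` ((+) a -` A) \<inter> unit_square)"
      using measurable_sets[OF measurable_gtorus_translation A, of a]
      by (intro emeasure_square_measure) simp
    also have "pr -` ((+) a -` A) \<inter> unit_square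
        = (\<lambda>z. z + c) -` (pr -` A \<inter> {z. z - c \<in> unit_square})"
      by (auto simp: c pr_add add.commute)
    also have "emeasure lborel \<dots> = emeasure lborel (pr -` A \<inter> {z. z - c \<in> unit_square})"
      by (rule emeasure_lborel_translate) measurable
    also have "\<dots> = emeasure lborel (pr -` A \<inter> unit_square)"
      by (rule emeasure_fundamental_domains[OF B per])
    also have "\<dots> = emeasure square_measure A"
      by (rule emeasure_square_measure[OF A, symmetric])
    finally show "emeasure (distr square_measure borel ((+) a)) A = emeasure square_measure A" .
  qed (simp add: sets)
qed

lemma is_haar_prob_unique:
  fixes M N :: "gtorus measure"
  assumes M: "is_haar_prob M" and N: "is_haar_prob N"
  shows "M = N"
proof (rule measure_eqI)
  have sM [measurable_cong]: "sets M = sets borel" and sN [measurable_cong]: "sets N = sets borel"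
    using M N by (auto simp: is_haar_prob_def)
  then show "sets M = sets N" by simp
  have spM: "space M = UNIV" and spN: "space N = UNIV"
    using sets_eq_imp_space_eq[OF sM] sets_eq_imp_space_eq[OF sN] by auto
  interpret M: prob_space M using M by (simp add: is_haar_prob_def)
  interpret N: prob_space N using N by (simp add: is_haar_prob_def)
  interpret P: pair_sigma_finite M N ..
  fix A assume "A \<in> sets M"
  then have A [measurable]: "A \<in> sets borel" using sM by simp
  have inv: "(\<integral>\<^sup>+y. indicator A (x + y) \<partial>L) = emeasure L A"
    if L: "is_haar_prob L" for L :: "gtorus measure" and x
  proof -
    have sL [measurable_cong]: "sets L = sets borel" using L by (simp add: is_haar_prob_def)
    have "emeasure L A = (\<integral>\<^sup>+y. indicator A y \<partial>distr L borel ((+) x))"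
      using L sL by (simp add: is_haar_prob_def)
    also have "\<dots> = (\<integral>\<^sup>+y. indicator A (x + y) \<partial>L)"
      by (rule nn_integral_distr) measurable
    finally show ?thesis by simp
  qed
  have [measurable]: "(\<lambda>(x, y). indicator A (x + y) :: ennreal) \<in> borel_measurable (M \<Otimes>\<^sub>M N)"
    by (simp add: split_beta) measurable
  have "emeasure N A = (\<integral>\<^sup>+x. (\<integral>\<^sup>+y. indicator A (x + y) \<partial>N) \<partial>M)"
    by (simp add: inv[OF N] M.emeasure_space_1)
  also have "\<dots> = (\<integral>\<^sup>+y. (\<integral>\<^sup>+x. indicator A (x + y) \<partial>M) \<partial>N)"
    using P.Fubini'[of "\<lambda>x y. indicator A (x + y)"] by simp
  also have "\<dots> = (\<integral>\<^sup>+y. (\<integral>\<^sup>+x. indicator A (y + x) \<partial>M) \<partial>N)"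
    by (simp add: add.commute)
  also have "\<dots> = emeasure M A"
    by (simp add: inv[OF M] N.emeasure_space_1)
  finally show "emeasure M A = emeasure N A" by simp
qed

lemma haar_prob_gtorus_eq: "(haar_prob :: gtorus measure) = square_measure"
  unfolding haar_prob_def
  by (rule the_equality) (auto intro: is_haar_prob_unique is_haar_prob_square_measure)

lemma is_haar_prob_haar_prob: "is_haar_prob (haar_prob :: gtorus measure)"
  by (simp add: haar_prob_gtorus_eq is_haar_prob_square_measure)

definition farey :: "real \<Rightarrow> gtorus set" where
  "farey T = {pr (p / q) | p q. p \<in> gaussian_ints \<and> q \<in> gaussian_ints \<and> 0 < cmod q \<and> cmod q \<le> T}"

text \<open>The measure lives on the half-line \<open>[0, \<infinity>)\<close>. The library function \<open>infdist\<close> is the distance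
  of a point to a nonempty set (its value for an empty set is \<open>0\<close>, which only matters for those
  small \<open>T\<close> for which there are fewer than two fractions).\<close>

definition gap_measure :: "real \<Rightarrow> real measure" where
  "gap_measure T = distr (uniform_count_measure (farey T)) (restrict_space borel {0..})
     (\<lambda>r. T\<^sup>2 * infdist r (farey T - {r}))"

lemma finite_gaussian_ints_cball: "finite {g \<in> gaussian_ints. cmod g \<le> R}"
proof (rule finite_subset)
  let ?I = "{-\<lceil>R\<rceil>..\<lceil>R\<rceil>}"
  show "{g \<in> gaussian_ints. cmod g \<le> R} \<subseteq> (\<lambda>(a, b). Complex (of_int a) (of_int b)) ` (?I \<times> ?I)"
  proof
    fix g assume g: "g \<in> {g \<in> gaussian_ints. cmod g \<le> R}"
    then obtain a b where ab: "g = Complex (of_int a) (of_int b)"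
      unfolding gaussian_ints_conv_image by auto
    then have "\<bar>of_int a\<bar> \<le> R" "\<bar>of_int b\<bar> \<le> R"
      using g abs_Re_le_cmod[of g] abs_Im_le_cmod[of g] by auto
    then have "a \<in> ?I" "b \<in> ?I" by (simp_all, linarith+)
    with ab show "g \<in> (\<lambda>(a, b). Complex (of_int a) (of_int b)) ` (?I \<times> ?I)" by auto
  qed
qed simp

lemma finite_farey: "finite (farey T)"
proof (rule finite_subset)
  let ?F = "\<lambda>R. {g \<in> gaussian_ints. cmod g \<le> R}"
  show "farey T \<subseteq> (\<lambda>(p, q). pr (p / q)) ` (?F (2 * T) \<times> ?F T)"
  proof
    fix x assume "x \<in> farey T"
    then obtain p q where pq: "x = pr (p / q)" "p \<in> gaussian_ints" "q \<in> gaussian_ints"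
      "0 < cmod q" "cmod q \<le> T"
      by (auto simp: farey_def)
    obtain g where g: "g \<in> gaussian_ints" "p / q - g \<in> unit_square"
      using unit_square_translates by blast
    have "pr (p / q) = pr (p / q - g)" using g by (simp add: pr_eq_iff)
    also have "p / q - g = (p - g * q) / q" using pq(4) by (simp add: field_simps)
    finally have x: "x = pr ((p - g * q) / q)" using pq(1) by simp
    have "cmod (p / q - g) \<le> 2"
      using g(2) cmod_le[of "p / q - g"] by (simp add: unit_square_def)
    moreover have "p - g * q = (p / q - g) * q" using pq(4) by (simp add: field_simps)
    ultimately have "cmod (p - g * q) \<le> 2 * T"
      using pq(4,5) by (simp only: norm_mult) (intro mult_mono, auto)
    then have "(p - g * q, q) \<in> ?F (2 * T) \<times> ?F T"
      using pq g by (simp add: gaussian_ints_diff gaussian_ints_mult)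
    with x show "x \<in> (\<lambda>(p, q). pr (p / q)) ` (?F (2 * T) \<times> ?F T)" by (intro image_eqI) auto
  qed
qed (simp add: finite_gaussian_ints_cball)

lemma emeasure_gap_measure:
  assumes "A \<in> sets (restrict_space borel {0..})"
  shows "emeasure (gap_measure T) A =
    (\<Sum>r\<in>farey T. indicator A (T\<^sup>2 * infdist r (farey T - {r}))) / of_nat (card (farey T))"
proof -
  let ?f = "\<lambda>r. T\<^sup>2 * infdist r (farey T - {r})"
  let ?A = "?f -` A \<inter> farey T"
  have "emeasure (gap_measure T) A = emeasure (uniform_count_measure (farey T)) ?A"
    unfolding gap_measure_def using assms
    by (subst emeasure_distr)
       (auto simp: space_uniform_count_measure measurable_def sets_uniform_count_measure
          space_restrict_space infdist_nonneg)
  also have "\<dots> = ennreal (card ?A / card (farey T))"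
    by (rule emeasure_uniform_count_measure) (auto simp: finite_farey)
  also have "\<dots> = of_nat (card ?A) / of_nat (card (farey T))"
  proof (cases "card (farey T) = 0")
    case True
    then have "?A = {}" using finite_farey by auto
    then show ?thesis by simp
  next
    case False
    then show ?thesis by (simp add: ennreal_of_nat_eq_real_of_nat divide_ennreal)
  qed
  also have "of_nat (card ?A) = (\<Sum>r\<in>farey T. indicator A (?f r) :: ennreal)"
    using finite_farey by (simp add: indicator_def sum.If_cases Int_def vimage_def conj_commute)
  finally show ?thesis .
qed

definition measure_support :: "'a :: topological_space measure \<Rightarrow> 'a set" where
  "measure_support M = {x \<in> space M. \<forall>U. open U \<longrightarrow> x \<in> U \<longrightarrow> 0 < emeasure M (U \<inter> space M)}"

text \<open>Vague convergence on the topological space \<open>X\<close>: test functions are continuous with compact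
  support in \<open>X\<close>.\<close>

definition vague_conv_on ::
  "'a :: topological_space set \<Rightarrow> ('b \<Rightarrow> 'a measure) \<Rightarrow> 'a measure \<Rightarrow> 'b filter \<Rightarrow> bool" where
  "vague_conv_on X M N F \<longleftrightarrow>
     (\<forall>f :: 'a \<Rightarrow> real. continuous_on X f \<and> (\<exists>K. compact K \<and> K \<subseteq> X \<and> (\<forall>x\<in>X - K. f x = 0)) \<longrightarrow>
        ((\<lambda>t. integral\<^sup>L (M t) f) \<longlongrightarrow> integral\<^sup>L N f) F)"

definition annulus :: "complex \<Rightarrow> real \<Rightarrow> real \<Rightarrow> complex set" where
  "annulus z r R = {w. r \<le> cmod (w - z) \<and> cmod (w - z) \<le> R}"

end

theory Submission
  imports Defs
begin

text \<open>
  The scaled gap at a fraction depends on its denominator and on the inverse of its numerator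
  through one explicit function. Let \<open>p / q\<close> be in lowest terms and let \<open>a * p + k * q = 1\<close> with
  Gaussian integers \<open>a\<close>, \<open>k\<close>. A second fraction \<open>p' / q'\<close> is determined by the determinant
  \<open>D = p * q' - p' * q\<close> and by \<open>g = k * q' + a * p'\<close>: indeed \<open>q' = D * a + g * q\<close>, and the distance
  between the two fractions is \<open>\<bar>D\<bar> / (\<bar>q\<bar> * \<bar>q'\<bar>)\<close>. With \<open>(z, w) = (a, q) / T\<close> the constraint
  \<open>0 < \<bar>q'\<bar> \<le> T\<close> reads \<open>0 < \<bar>D * z + g * w\<bar> \<le> 1\<close>, so \<open>T\<^sup>2\<close> times the gap is the least value of
  \<open>\<bar>D\<bar> / (\<bar>w\<bar> * \<bar>D * z + g * w\<bar>)\<close> over \<open>D \<noteq> 0\<close> and \<open>g\<close> subject to that constraint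
  (\<open>scaled_gap_eq_gap_fun\<close>). As \<open>p\<close> runs over the reduced residues modulo \<open>q\<close>, so does \<open>a\<close>.
  Hence \<open>gap_measure T\<close> is the empirical law of \<open>gap_fun\<close> over the primitive vectors of \<open>\<int>[\<i>]\<^sup>2\<close>
  in the dilate by \<open>T\<close> of the set \<open>farey_cone\<close>, given by \<open>0 < \<bar>w\<bar> \<le> 1\<close> and \<open>z / w\<close> in the unit
  square (\<open>farey_gap_sum\<close>); the limit is the law of \<open>gap_fun\<close> under normalised Lebesgue measure
  on that set.

  Primitive vectors are equidistributed (\<open>primitive_lattice_riemann_sum\<close>) because all lattice
  vectors are: sums over the latter are Riemann sums, which converge for almost everywhere
  continuous functions. Each nonzero lattice vector is \<open>d\<close> times a primitive one in exactly four
  ways. For a test function invariant under multiplication by complex numbers of modulus \<open>1\<close>, the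
  normalised sum over all vectors at scale \<open>T\<close> is therefore the primitive one at scale \<open>T\<close> plus
  the primitive ones at the scales \<open>T / \<bar>d\<bar>\<close> with \<open>\<bar>d\<bar> > 1\<close>, weighted by
  \<open>1 / (4 * \<bar>d\<bar> ^ 4)\<close>. These weights sum to less than \<open>1\<close>, so the relation can be solved as
  a contraction.

  The remaining claims are read off from \<open>gap_fun\<close>. Absolute continuity holds because \<open>gap_fun\<close> takes
  at each point a value of one of countably many functions, each homogeneous of degree \<open>-2\<close>, and such
  functions pull null sets back to null sets (\<open>null_sets_homogeneous_vimage\<close>). Always
  \<open>gap_fun (z, w) \<ge> 1 / \<bar>w\<bar> \<ge> 1\<close>, and every value from \<open>1\<close> on is approached. The law of \<open>\<bar>w\<bar>\<close> on
  \<open>farey_cone\<close> follows from scaling: \<open>\<bar>w\<bar> < r\<close> has probability \<open>r ^ 4\<close>, so \<open>s = -2 * ln \<bar>w\<bar>\<close> is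
  exponential with rate \<open>2\<close>. Slicing by \<open>w\<close> then gives the formula with annuli, because
  \<open>gap_fun (z, w) \<le> \<delta>\<close> says that \<open>z / w\<close> lies in an annulus around some Gaussian fraction. Finally
  \<open>1 / \<bar>w\<bar> \<le> gap_fun (z, w) \<le> 1 / (\<bar>w\<bar> * (1 - 2 * \<bar>w\<bar>))\<close> for small \<open>w\<close>, and the tail of \<open>gap_fun\<close>
  is the tail of \<open>1 / \<bar>w\<bar>\<close> up to a relative error of order \<open>1 / \<delta>\<close>.
\<close>

section \<open>Gaussian integers\<close>

lemma gaussian_ints_1 [simp]: "1 \<in> gaussian_ints"
  by (simp add: gaussian_ints_def)

lemma gaussian_ints_norm_ge_1:
  assumes "g \<in> gaussian_ints" "g \<noteq> 0"
  shows "1 \<le> cmod g"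
proof -
  obtain a b :: int where ab: "Re g = of_int a" "Im g = of_int b"
    using assms(1) by (auto simp: gaussian_ints_def elim!: Ints_cases)
  have "a \<noteq> 0 \<or> b \<noteq> 0"
    using assms(2) ab by (auto simp: complex_eq_iff)
  then have "1 \<le> \<bar>Re g\<bar> \<or> 1 \<le> \<bar>Im g\<bar>"
    unfolding ab by (simp add: int_one_le_iff_zero_less flip: of_int_abs)
  then show ?thesis
    using abs_Re_le_cmod[of g] abs_Im_le_cmod[of g] by linarith
qed

text \<open>The bound is below \<open>1\<close>, which makes the Gaussian integers Euclidean for the modulus.\<close>

lemma nearest_gaussian_int:
  obtains g where "g \<in> gaussian_ints" "(cmod (z - g))\<^sup>2 \<le> 1 / 2"
proof
  let ?g = "Complex (of_int (round (Re z))) (of_int (round (Im z)))"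
  show "?g \<in> gaussian_ints" by (simp add: gaussian_ints_def)
  have "(Re z - of_int (round (Re z)))\<^sup>2 \<le> (1 / 2)\<^sup>2" "(Im z - of_int (round (Im z)))\<^sup>2 \<le> (1 / 2)\<^sup>2"
    using of_int_round_abs_le[of "Re z"] of_int_round_abs_le[of "Im z"]
    by (simp_all only: flip: abs_le_square_iff)
  then show "(cmod (z - ?g))\<^sup>2 \<le> 1 / 2"
    by (simp add: cmod_power2 power_divide)
qed

definition gaussian_units :: "complex set" where
  "gaussian_units = {u \<in> gaussian_ints. cmod u = 1}"

lemma gaussian_units_eq: "gaussian_units = {1, -1, \<i>, -\<i>}"
proof (intro equalityI subsetI)
  fix u assume "u \<in> gaussian_units"
  then obtain a b :: int where ab: "Re u = of_int a" "Im u = of_int b" and "(cmod u)\<^sup>2 = 1"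
    by (auto simp: gaussian_units_def gaussian_ints_def elim!: Ints_cases)
  then have "of_int (a\<^sup>2 + b\<^sup>2) = (1 :: real)"
    by (simp add: cmod_power2)
  then have 1: "a\<^sup>2 + b\<^sup>2 = 1" by linarith
  have "\<bar>a\<bar> \<le> 1" "\<bar>b\<bar> \<le> 1"
    unfolding abs_square_le_1[symmetric]
    using 1 zero_le_power2[of a] zero_le_power2[of b] by linarith+
  then have "a \<in> {-1, 0, 1}" "b \<in> {-1, 0, 1}" by auto
  with 1 ab show "u \<in> {1, -1, \<i>, -\<i>}" by (auto simp: complex_eq_iff)
qed (auto simp: gaussian_units_def gaussian_ints_def)

lemma card_gaussian_units: "card gaussian_units = 4"
proof -
  have "distinct [1, -1, \<i>, -\<i>]" by (simp add: complex_eq_iff)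
  from distinct_card[OF this] show ?thesis by (simp add: gaussian_units_eq)
qed

lemma gaussian_units_mult_eq_1:
  assumes "u \<in> gaussian_ints" "v \<in> gaussian_ints" "u * v = 1"
  shows "u \<in> gaussian_units"
proof -
  have "u \<noteq> 0" "v \<noteq> 0" using assms(3) by auto
  then have "1 \<le> cmod u" "1 \<le> cmod v" using assms gaussian_ints_norm_ge_1 by auto
  moreover have "cmod u * cmod v = 1" using assms(3) by (metis norm_mult norm_one)
  ultimately have "cmod u = 1"
    using mult_left_mono[of 1 "cmod v" "cmod u"] by simp
  with assms(1) show ?thesis by (simp add: gaussian_units_def)
qed

definition lattice :: "(complex \<times> complex) set" where
  "lattice = gaussian_ints \<times> gaussian_ints"

definition primitive :: "(complex \<times> complex) set" where
  "primitive = {(a, q) \<in> lattice. \<exists>x\<in>gaussian_ints. \<exists>y\<in>gaussian_ints. a * x + q * y = 1}"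

lemma primitiveI:
  assumes "a \<in> gaussian_ints" "q \<in> gaussian_ints" "x \<in> gaussian_ints" "y \<in> gaussian_ints"
    and "a * x + q * y = 1"
  shows "(a, q) \<in> primitive"
  using assms unfolding primitive_def lattice_def by blast

lemma primitiveE:
  assumes "v \<in> primitive"
  obtains a q x y where "v = (a, q)" "a \<in> gaussian_ints" "q \<in> gaussian_ints"
    "x \<in> gaussian_ints" "y \<in> gaussian_ints" "a * x + q * y = 1"
  using assms unfolding primitive_def lattice_def by blast

definition cscale :: "complex \<Rightarrow> complex \<times> complex \<Rightarrow> complex \<times> complex" where
  "cscale c v = (c * fst v, c * snd v)"

text \<open>The coordinates generate an ideal; by division with remainder, an element of least
  modulus among its nonzero elements divides all of them. The Bezout identity for the quotients
  comes from writing this element as a combination of the coordinates.\<close>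

lemma content_exists:
  assumes v: "v \<in> lattice" "v \<noteq> 0"
  obtains d w where "d \<in> gaussian_ints" "d \<noteq> 0" "w \<in> primitive" "v = cscale d w"
proof -
  obtain a q where aq: "v = (a, q)" "a \<in> gaussian_ints" "q \<in> gaussian_ints" "a \<noteq> 0 \<or> q \<noteq> 0"
    using v by (cases v) (auto simp: lattice_def zero_prod_def)
  define I where "I = {a * x + q * y | x y. x \<in> gaussian_ints \<and> y \<in> gaussian_ints}"
  have sub: "b - g * c \<in> I" if "b \<in> I" "c \<in> I" "g \<in> gaussian_ints" for b c g
  proof -
    obtain x y x' y' where "b = a * x + q * y" "c = a * x' + q * y'"
      and "x \<in> gaussian_ints" "y \<in> gaussian_ints" "x' \<in> gaussian_ints" "y' \<in> gaussian_ints"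
      using \<open>b \<in> I\<close> \<open>c \<in> I\<close> by (auto simp: I_def)
    then have "b - g * c = a * (x - g * x') + q * (y - g * y')"
      "x - g * x' \<in> gaussian_ints" "y - g * y' \<in> gaussian_ints"
      using that(3) by (auto simp: algebra_simps intro!: gaussian_ints_diff gaussian_ints_mult)
    then show ?thesis unfolding I_def by blast
  qed
  have I_sub: "I \<subseteq> gaussian_ints"
    using aq by (auto simp: I_def intro!: gaussian_ints_add gaussian_ints_mult)
  have "a = a * 1 + q * 0" "q = a * 0 + q * 1" by auto
  then have aI: "a \<in> I" and qI: "q \<in> I"
    unfolding I_def by (metis (mono_tags, lifting) gaussian_ints_0 gaussian_ints_1 mem_Collect_eq)+
  then obtain e where e: "e \<in> I" "e \<noteq> 0" using aq(4) by blast
  let ?J = "{b \<in> I. b \<noteq> 0 \<and> cmod b \<le> cmod e}"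
  have "finite ?J"
    by (rule finite_subset[OF _ finite_gaussian_ints_cball[of "cmod e"]]) (use I_sub in auto)
  moreover have "?J \<noteq> {}" using e by auto
  ultimately obtain d where d: "d \<in> ?J" "\<And>b. b \<in> ?J \<Longrightarrow> cmod d \<le> cmod b"
    using ex_is_arg_min_if_finite[of ?J cmod] by (auto simp: is_arg_min_linorder)
  have dvd: "\<exists>g\<in>gaussian_ints. b = d * g" if "b \<in> I" for b
  proof -
    obtain g where g: "g \<in> gaussian_ints" "(cmod (b / d - g))\<^sup>2 \<le> 1 / 2"
      by (rule nearest_gaussian_int)
    have "cmod (b / d - g) < 1"
      using g(2) abs_square_less_1[of "cmod (b / d - g)"] by simp
    moreover have "b - g * d = (b / d - g) * d" using d(1) by (simp add: field_simps)
    ultimately have "cmod (b - g * d) < cmod d"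
      using d(1) by (simp add: norm_mult)
    moreover have "b - g * d \<in> I" using sub that d(1) g(1) by blast
    ultimately have "b - g * d = 0"
      using d by force
    then show ?thesis using g(1) by (auto simp: mult.commute)
  qed
  obtain a' where a': "a' \<in> gaussian_ints" "a = d * a'" using dvd[OF aI] by blast
  obtain q' where q': "q' \<in> gaussian_ints" "q = d * q'" using dvd[OF qI] by blast
  obtain x y where xy: "x \<in> gaussian_ints" "y \<in> gaussian_ints" "d = a * x + q * y"
    using d(1) by (auto simp: I_def)
  have "d * (a' * x + q' * y) = d * 1"
    using xy(3) unfolding a' q' by (simp add: algebra_simps)
  then have "a' * x + q' * y = 1" using d(1) by simp
  then have "(a', q') \<in> primitive"
    using primitiveI[OF a'(1) q'(1) xy(1,2)] by blast
  moreover have "d \<in> gaussian_ints" "d \<noteq> 0" using d(1) I_sub by auto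
  ultimately show thesis
    using that[of d "(a', q')"] aq(1) a' q' by (simp add: cscale_def)
qed

text \<open>A primitive vector is sent to \<open>1\<close> by a linear form with Gaussian coefficients. Applying
  such a form for either vector to the equation shows that \<open>d\<close> and \<open>d'\<close> divide each other.\<close>

lemma content_unique:
  assumes "w \<in> primitive" "w' \<in> primitive" "d \<in> gaussian_ints" "d' \<in> gaussian_ints"
    and "d \<noteq> 0" "cscale d w = cscale d' w'"
  shows "\<exists>u\<in>gaussian_units. d' = d * u \<and> w = cscale u w'"
proof -
  obtain a q x y where w: "w = (a, q)" "a \<in> gaussian_ints" "q \<in> gaussian_ints"
    "x \<in> gaussian_ints" "y \<in> gaussian_ints" "a * x + q * y = 1"
    using assms(1) by (rule primitiveE)
  obtain a' q' x' y' where w': "w' = (a', q')" "a' \<in> gaussian_ints" "q' \<in> gaussian_ints"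
    "x' \<in> gaussian_ints" "y' \<in> gaussian_ints" "a' * x' + q' * y' = 1"
    using assms(2) by (rule primitiveE)
  have eq: "d * a = d' * a'" "d * q = d' * q'"
    using assms(6) w(1) w'(1) by (auto simp: cscale_def)
  define u where "u = a * x' + q * y'"
  define v where "v = a' * x + q' * y"
  have u: "u \<in> gaussian_ints" "v \<in> gaussian_ints"
    unfolding u_def v_def using w w' by (auto intro!: gaussian_ints_add gaussian_ints_mult)
  have "d' = d' * (a' * x' + q' * y')" using w' by simp
  also have "\<dots> = (d' * a') * x' + (d' * q') * y'" by (simp add: algebra_simps)
  also have "\<dots> = d * u" unfolding eq[symmetric] u_def by (simp add: algebra_simps)
  finally have d': "d' = d * u" .
  have "d = d * (a * x + q * y)" using w by simp
  also have "\<dots> = (d * a) * x + (d * q) * y" by (simp add: algebra_simps)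
  also have "\<dots> = d' * v" unfolding eq v_def by (simp add: algebra_simps)
  finally have "d * (u * v) = d * 1" using d' by simp
  then have "u * v = 1" using assms(5) by simp
  then have "u \<in> gaussian_units" using u gaussian_units_mult_eq_1 by blast
  moreover have "a = u * a'" "q = u * q'"
    using eq assms(5) unfolding d' mult.assoc by (metis mult_left_cancel)+
  ultimately have "u \<in> gaussian_units \<and> d' = d * u \<and> w = cscale u w'"
    using d' w(1) w'(1) by (simp add: cscale_def)
  then show ?thesis by blast
qed

lemma gaussian_units_primitive:
  assumes "u \<in> gaussian_units" "w \<in> primitive"
  shows "cscale u w \<in> primitive"
proof -
  obtain a q x y where w: "w = (a, q)" "a \<in> gaussian_ints" "q \<in> gaussian_ints"
    "x \<in> gaussian_ints" "y \<in> gaussian_ints" "a * x + q * y = 1"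
    using assms(2) by (rule primitiveE)
  have u: "u \<in> gaussian_ints" "cnj u \<in> gaussian_ints" "u * cnj u = 1"
    using assms(1) complex_norm_square[of u] by (simp_all add: gaussian_units_def gaussian_ints_def)
  have "(u * a) * (cnj u * x) + (u * q) * (cnj u * y) = (u * cnj u) * (a * x + q * y)"
    by (simp add: algebra_simps)
  also have "\<dots> = 1" using u w by simp
  finally have *: "(u * a) * (cnj u * x) + (u * q) * (cnj u * y) = 1" .
  have "u * a \<in> gaussian_ints" "u * q \<in> gaussian_ints" "cnj u * x \<in> gaussian_ints"
    "cnj u * y \<in> gaussian_ints"
    using u w by (auto intro!: gaussian_ints_mult)
  then show ?thesis
    using primitiveI[OF _ _ _ _ *] by (simp add: cscale_def w(1))
qed

section \<open>Null sets and scaling for Lebesgue measure\<close>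

lemma lborel_scale_vimage:
  fixes A :: "'a :: euclidean_space set"
  assumes [measurable]: "A \<in> sets borel" and "c > 0"
  shows "emeasure lborel A = ennreal (c ^ DIM('a)) * emeasure lborel ((\<lambda>x. c *\<^sub>R x) -` A)"
proof -
  have "emeasure lborel A = emeasure (density (distr lborel borel (\<lambda>x. 0 + c *\<^sub>R x)) (\<lambda>_. \<bar>c\<bar> ^ DIM('a))) A"
    using assms(2) by (subst lborel_affine[of c 0]) auto
  also have "\<dots> = ennreal (c ^ DIM('a)) * emeasure lborel ((\<lambda>x. c *\<^sub>R x) -` A)"
    using assms by (simp add: emeasure_density nn_integral_cmult_indicator emeasure_distr)
  finally show ?thesis .
qed

text \<open>On each half-line the map inverts to a differentiable one, and differentiable maps
  preserve null sets.\<close>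

lemma null_sets_powr_vimage:
  fixes N :: "real set"
  assumes N: "N \<in> null_sets lborel" and k: "k \<noteq> 0" and y: "y \<noteq> 0"
  shows "{t. 0 < t \<and> t powr k * y \<in> N} \<in> null_sets lborel"
proof -
  let ?S = "{t. 0 < t \<and> t powr k * y \<in> N}"
  let ?N = "{r \<in> N. 0 < r / y}"
  let ?g = "\<lambda>r. (r / y) powr (1 / k)"
  have [measurable]: "N \<in> sets borel" using N by auto
  have "negligible N" using N by (simp add: negligible_iff_null_sets null_sets_completionI)
  then have "negligible ?N" by (rule negligible_subset) auto
  moreover have "?g differentiable_on ?N"
  proof (intro differentiable_at_imp_differentiable_on)
    fix r assume "r \<in> ?N"
    then have "((\<lambda>r. (r / y) powr (1 / k)) has_real_derivative
       (1 / k) * (r / y) powr (1 / k - 1) * (1 / y)) (at r)"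
      using y by (auto intro!: derivative_eq_intros)
    then show "?g differentiable at r"
      unfolding real_differentiable_def by blast
  qed
  ultimately have "negligible (?g ` ?N)"
    by (intro negligible_differentiable_image_negligible) auto
  moreover have "?S \<subseteq> ?g ` ?N"
  proof
    fix t assume t: "t \<in> ?S"
    then have "t powr k * y / y = t powr k" using y by simp
    moreover have "(t powr k) powr (1 / k) = t" using t k by (simp add: powr_powr)
    ultimately show "t \<in> ?g ` ?N" using t by (intro image_eqI[of _ _ "t powr k * y"]) auto
  qed
  ultimately have "negligible ?S" by (rule negligible_subset)
  moreover have "?S \<in> sets lborel" by measurable
  ultimately show ?thesis
    by (simp add: negligible_iff_null_sets null_sets_completion_iff)
qed

text \<open>Along each ray the parameters \<open>t\<close> with \<open>f (t *\<^sub>R x)\<close> in \<open>N\<close> form a null set. By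
  Fubini, for almost every \<open>t\<close> the set of \<open>x\<close> with this property is null; but for every single
  \<open>t\<close> it is a dilate of the preimage in question.\<close>

lemma null_sets_homogeneous_vimage:
  fixes f :: "'a :: euclidean_space \<Rightarrow> real"
  assumes f [measurable]: "f \<in> borel_measurable borel"
    and hom: "\<And>t x. 0 < t \<Longrightarrow> f (t *\<^sub>R x) = t powr k * f x" and k: "k \<noteq> 0"
    and N: "N \<in> null_sets lborel"
  shows "{x. f x \<in> N \<and> f x \<noteq> 0} \<in> null_sets lborel"
proof -
  have [measurable]: "N \<in> sets borel" using N by auto
  define S where "S = {x. f x \<in> N \<and> f x \<noteq> 0}"
  have S [measurable]: "S \<in> sets borel" unfolding S_def by measurable
  have M: "{p \<in> space (lborel \<Otimes>\<^sub>M lborel). \<not> (1 < snd p \<and> snd p < 2 \<and> snd p *\<^sub>R fst p \<in> S)}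
      \<in> sets (lborel \<Otimes>\<^sub>M lborel)"
    by measurable
  have "AE x in lborel. AE t in lborel. \<not> (1 < t \<and> t < (2 :: real) \<and> t *\<^sub>R x \<in> S)"
  proof (rule AE_I2)
    fix x
    show "AE t in lborel. \<not> (1 < t \<and> t < (2 :: real) \<and> t *\<^sub>R x \<in> S)"
    proof (cases "f x = 0")
      case True
      then have "\<not> (1 < t \<and> t < 2 \<and> t *\<^sub>R x \<in> S)" for t using hom[of t x] by (auto simp: S_def)
      then show ?thesis by simp
    next
      case False
      show ?thesis
        by (rule AE_I'[OF null_sets_powr_vimage[OF N k False]]) (auto simp: hom S_def)
    qed
  qed
  then have "AE t in lborel. AE x in lborel. \<not> (1 < t \<and> t < (2 :: real) \<and> t *\<^sub>R x \<in> S)"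
    by (rule lborel_pair.AE_commute[OF M, THEN iffD1])
  then have "AE t in lborel. 1 < t \<longrightarrow> t < (2 :: real) \<longrightarrow> emeasure lborel S = 0"
  proof eventually_elim
    case (elim t)
    show ?case
    proof (intro impI)
      assume t: "1 < t" "t < 2"
      then have "AE x in lborel. t *\<^sub>R x \<notin> S" using elim by simp
      then have "emeasure lborel ((\<lambda>x. t *\<^sub>R x) -` S) = 0"
        by (subst (asm) AE_iff_measurable[OF _ refl]) (simp_all add: vimage_def)
      then show "emeasure lborel S = 0"
        using lborel_scale_vimage[OF S, of t] t by simp
    qed
  qed
  then have "emeasure lborel S = 0"
  proof (rule contrapos_pp)
    assume ne: "emeasure lborel S \<noteq> 0"
    show "\<not> (AE t in lborel. 1 < t \<longrightarrow> t < (2 :: real) \<longrightarrow> emeasure lborel S = 0)"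
    proof
      assume "AE t in lborel. 1 < t \<longrightarrow> t < (2 :: real) \<longrightarrow> emeasure lborel S = 0"
      then have "AE t in lborel. \<not> (t \<in> {1<..<2 :: real})" using ne by simp
      then have "emeasure lborel {1<..<2 :: real} = 0"
        by (subst (asm) AE_iff_measurable[OF _ refl])
           (simp_all add: greaterThanLessThan_def greaterThan_def lessThan_def Int_def)
      then show False by simp
    qed
  qed
  then show ?thesis using S by (simp add: null_sets_def S_def)
qed

text \<open>The left-hand side is a translation-invariant measure in \<open>A\<close>, hence proportional to
  Lebesgue measure by integrating the indicator of \<open>x + y \<in> A \<and> y \<in> B\<close> against both
  measures in either order. Taking the unit disc for \<open>B\<close> identifies the factor, since its
  preimage is the disc of radius \<open>\<bar>w\<bar>\<close>.\<close>

lemma emeasure_lborel_complex_mult: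
  fixes A :: "complex set"
  assumes [measurable]: "A \<in> sets borel" and w: "w \<noteq> 0"
  shows "emeasure lborel {z. z / w \<in> A} = ennreal ((cmod w)\<^sup>2) * emeasure lborel A"
proof -
  define \<nu> where "\<nu> = distr lborel borel (\<lambda>z :: complex. z / w)"
  have sets [measurable_cong]: "sets \<nu> = sets borel" by (simp add: \<nu>_def)
  have nu: "emeasure \<nu> B = emeasure lborel {z. z / w \<in> B}" if "B \<in> sets borel" for B
    unfolding \<nu>_def using that by (subst emeasure_distr) (auto simp: vimage_def)
  have inv: "emeasure \<nu> {x. c + x \<in> B} = emeasure \<nu> B" if [measurable]: "B \<in> sets borel" for B c
  proof -
    have "emeasure \<nu> {x. c + x \<in> B} = emeasure lborel {z. c + z / w \<in> B}"
      by (subst nu) auto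
    also have "\<dots> = emeasure lborel ((\<lambda>z. z + c * w) -` {z. z / w \<in> B})"
      using w by (simp add: vimage_def add_divide_distrib add.commute)
    also have "\<dots> = emeasure lborel {z. z / w \<in> B}"
      by (rule emeasure_lborel_translate) measurable
    finally show ?thesis using nu by simp
  qed
  have ball: "emeasure \<nu> (ball 0 1) = ennreal ((cmod w)\<^sup>2) * emeasure lborel (ball 0 1 :: complex set)"
  proof -
    have "emeasure \<nu> (ball 0 1) = emeasure lborel (ball 0 (cmod w) :: complex set)"
      using w by (subst nu) (auto simp: norm_divide divide_less_eq_1 intro!: arg_cong[where f = "emeasure lborel"])
    also have "\<dots> = ennreal ((cmod w)\<^sup>2) * emeasure lborel ((\<lambda>x :: complex. cmod w *\<^sub>R x) -` ball 0 (cmod w))"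
      using lborel_scale_vimage[of "ball 0 (cmod w) :: complex set" "cmod w"] w by simp
    also have "(\<lambda>x :: complex. cmod w *\<^sub>R x) -` ball 0 (cmod w) = ball 0 1"
      using w by auto
    finally show ?thesis .
  qed
  have fin: "emeasure lborel (ball 0 1 :: complex set) < \<infinity>"
    by (rule emeasure_bounded_finite) simp
  have pos: "emeasure lborel (ball 0 1 :: complex set) \<noteq> 0"
  proof
    assume "emeasure lborel (ball 0 1 :: complex set) = 0"
    then have "negligible (ball 0 1 :: complex set)"
      by (simp add: negligible_iff_null_sets null_sets_completion_iff null_sets_def)
    then show False using open_not_negligible[of "ball 0 1 :: complex set"] by simp
  qed
  have "sigma_finite_measure \<nu>"
  proof (rule sigma_finite_measure.intro, intro exI conjI)
    let ?C = "range (\<lambda>n :: nat. ball 0 (real n) :: complex set)"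
    show "countable ?C" "?C \<subseteq> sets \<nu>" by (auto simp: sets)
    show "\<Union> ?C = space \<nu>"
      using reals_Archimedean2 by (auto simp: \<nu>_def)
    show "\<forall>a\<in>?C. emeasure \<nu> a \<noteq> \<infinity>"
    proof
      fix a :: "complex set" assume "a \<in> ?C"
      then obtain n where a: "a = ball 0 (real n)" by auto
      have "{z. z / w \<in> ball 0 (real n)} \<subseteq> ball 0 (real n * cmod w)"
        using w by (auto simp: norm_divide field_simps)
      then have "bounded {z. z / w \<in> ball 0 (real n)}" by (rule bounded_subset[rotated]) simp
      from emeasure_bounded_finite[OF this] show "emeasure \<nu> a \<noteq> \<infinity>"
        unfolding a by (subst nu) auto
    qed
  qed
  then interpret P: pair_sigma_finite \<nu> "lborel :: complex measure"
    by (intro pair_sigma_finite.intro) (auto intro: sigma_finite_lborel)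
  let ?B = "ball 0 1 :: complex set"
  have B [measurable]: "?B \<in> sets borel" by simp
  (* Integrate the indicator of {(x, y). x + y : A, y : B} in both orders. *)
  have "emeasure \<nu> A * emeasure lborel ?B
      = (\<integral>\<^sup>+y. (\<integral>\<^sup>+x. indicator A (x + y) * indicator ?B y \<partial>\<nu>) \<partial>lborel)"
  proof -
    have "(\<integral>\<^sup>+x. indicator A (x + y) * indicator ?B y \<partial>\<nu>) = emeasure \<nu> A * indicator ?B y" for y
    proof -
      have "(\<integral>\<^sup>+x. indicator A (x + y) * indicator ?B y \<partial>\<nu>)
          = (\<integral>\<^sup>+x. indicator {x. y + x \<in> A} x * indicator ?B y \<partial>\<nu>)"
        by (intro nn_integral_cong) (simp add: add.commute indicator_def)
      also have "\<dots> = (\<integral>\<^sup>+x. indicator {x. y + x \<in> A} x \<partial>\<nu>) * indicator ?B y"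
        by (rule nn_integral_multc) measurable
      also have "\<dots> = emeasure \<nu> A * indicator ?B y"
        by (subst nn_integral_indicator) (measurable, simp add: inv)
      finally show ?thesis .
    qed
    then show ?thesis by (simp add: nn_integral_cmult_indicator)
  qed
  also have "\<dots> = (\<integral>\<^sup>+x. (\<integral>\<^sup>+y. indicator A (x + y) * indicator ?B y \<partial>lborel) \<partial>\<nu>)"
    by (rule P.Fubini') measurable
  also have "\<dots> = (\<integral>\<^sup>+x. (\<integral>\<^sup>+y. indicator A y * indicator ?B (y - x) \<partial>lborel) \<partial>\<nu>)"
  proof (rule nn_integral_cong)
    fix x
    have "(\<integral>\<^sup>+y. indicator A y * indicator ?B (y - x) \<partial>lborel)
        = (\<integral>\<^sup>+y. indicator A y * indicator ?B (y - x) \<partial>distr lborel borel ((+) x))"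
      by (simp add: lborel_distr_plus)
    also have "\<dots> = (\<integral>\<^sup>+y. indicator A (x + y) * indicator ?B y \<partial>lborel)"
      by (subst nn_integral_distr) simp_all
    finally show "(\<integral>\<^sup>+y. indicator A (x + y) * indicator ?B y \<partial>lborel) =
      (\<integral>\<^sup>+y. indicator A y * indicator ?B (y - x) \<partial>lborel)" by simp
  qed
  also have "\<dots> = (\<integral>\<^sup>+y. (\<integral>\<^sup>+x. indicator A y * indicator ?B (y - x) \<partial>\<nu>) \<partial>lborel)"
    by (rule P.Fubini'[symmetric]) measurable
  also have "\<dots> = (\<integral>\<^sup>+y. indicator A y * emeasure \<nu> ?B \<partial>lborel)"
  proof (rule nn_integral_cong)
    fix y
    have "(\<integral>\<^sup>+x. indicator A y * indicator ?B (y - x) \<partial>\<nu>)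
        = (\<integral>\<^sup>+x. indicator A y * indicator {x. - y + x \<in> ?B} x \<partial>\<nu>)"
      by (intro nn_integral_cong) (simp add: indicator_def norm_minus_commute)
    also have "\<dots> = indicator A y * (\<integral>\<^sup>+x. indicator {x. - y + x \<in> ?B} x \<partial>\<nu>)"
      by (rule nn_integral_cmult) measurable
    also have "\<dots> = indicator A y * emeasure \<nu> ?B"
      by (subst nn_integral_indicator) (measurable, simp only: inv[OF B])
    finally show "(\<integral>\<^sup>+x. indicator A y * indicator ?B (y - x) \<partial>\<nu>) = indicator A y * emeasure \<nu> ?B" .
  qed
  also have "\<dots> = emeasure lborel A * emeasure \<nu> ?B"
    by (simp add: nn_integral_multc)
  also have "\<dots> = (ennreal ((cmod w)\<^sup>2) * emeasure lborel A) * emeasure lborel ?B"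
    unfolding ball by (simp add: mult_ac)
  finally have "emeasure \<nu> A = ennreal ((cmod w)\<^sup>2) * emeasure lborel A"
    using fin pos by (auto simp: mult.commute[of _ "emeasure lborel ?B"] ennreal_mult_cancel_left)
  then show ?thesis by (simp add: nu)
qed

lemma gaussian_grid_null: "{z. Re z \<in> \<int> \<or> Im z \<in> \<int>} \<in> null_sets lborel"
proof -
  have "negligible {z. Re z = of_int n}" "negligible {z. Im z = of_int n}" for n
    using negligible_hyperplane[of "1 :: complex" "of_int n"] negligible_hyperplane[of \<i> "of_int n"]
    by (simp_all add: inner_complex_def)
  then have "negligible (\<Union>n. {z. Re z = of_int n} \<union> {z. Im z = of_int n})"
    by (intro negligible_countable_Union) (auto intro: negligible_Un)
  moreover have "{z. Re z \<in> \<int> \<or> Im z \<in> \<int>} = (\<Union>n. {z. Re z = of_int n} \<union> {z. Im z = of_int n})"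
    by (auto simp: Ints_def)
  moreover have "(\<Union>n. {z. Re z = of_int n} \<union> {z. Im z = of_int n}) \<in> sets lborel" by measurable
  ultimately show ?thesis
    by (simp add: negligible_iff_null_sets null_sets_completion_iff)
qed

lemma AE_ratio_notin:
  assumes "G \<in> null_sets (lborel :: complex measure)"
  shows "AE v in lborel. fst v / snd v \<notin> G \<or> snd v = (0 :: complex)"
proof -
  have [measurable]: "G \<in> sets borel" using assms by auto
  have w: "AE z in lborel. z / w \<notin> G \<or> w = 0" for w
  proof (cases "w = 0")
    case False
    have "emeasure lborel {z. z / w \<in> G} = 0"
      using emeasure_lborel_complex_mult[of G w] assms False by auto
    then have "AE z in lborel. z / w \<notin> G"
      by (subst AE_iff_measurable[OF _ refl]) auto
    then show ?thesis by eventually_elim simp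
  qed simp
  have M: "{v \<in> space (lborel \<Otimes>\<^sub>M lborel). fst v / snd v \<notin> G \<or> snd v = (0 :: complex)}
      \<in> sets (lborel \<Otimes>\<^sub>M lborel)"
    by measurable
  have "AE w in lborel. AE z in lborel. z / w \<notin> G \<or> w = 0"
    by (rule AE_I2) (rule w)
  then have "AE z in lborel. AE w in lborel. z / w \<notin> G \<or> w = 0"
    by (rule lborel_pair.AE_commute[OF M, THEN iffD2])
  then show ?thesis
    unfolding lborel_prod[symmetric] by (rule lborel_pair.AE_pair_iff[OF M, THEN iffD1])
qed

lemma AE_snd_nonzero: "AE v :: complex \<times> complex in lborel. snd v \<noteq> 0"
proof -
  have M: "{v \<in> space (lborel \<Otimes>\<^sub>M lborel). snd v \<noteq> (0 :: complex)}
      \<in> sets ((lborel :: complex measure) \<Otimes>\<^sub>M lborel)"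
    by measurable
  have "AE w in lborel. w \<noteq> (0 :: complex)" by (rule AE_lborel_singleton)
  then have "AE z :: complex in lborel. AE w in lborel. w \<noteq> (0 :: complex)" by simp
  then show ?thesis
    unfolding lborel_prod[symmetric] by (rule lborel_pair.AE_pair_iff[OF M, THEN iffD1])
qed

section \<open>Riemann sums over Gaussian lattice points\<close>

definition gfloor :: "complex \<Rightarrow> complex" where
  "gfloor z = Complex (of_int \<lfloor>Re z\<rfloor>) (of_int \<lfloor>Im z\<rfloor>)"

lemma gfloor_in [simp]: "gfloor z \<in> gaussian_ints"
  by (simp add: gfloor_def gaussian_ints_def)

lemma gfloor_eq_iff: "gfloor z = g \<longleftrightarrow> g \<in> gaussian_ints \<and> z - g \<in> unit_square"
proof -
  have "z - gfloor z \<in> unit_square"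
    by (simp add: gfloor_def unit_square_def) linarith
  then show ?thesis using unit_square_translates[of z] gfloor_in by blast
qed

lemma norm_unit_square: "z \<in> unit_square \<Longrightarrow> cmod z \<le> 2"
  using cmod_le[of z] by (simp add: unit_square_def)

definition lattice_floor :: "real \<Rightarrow> complex \<times> complex \<Rightarrow> complex \<times> complex" where
  "lattice_floor T x = (gfloor (T *\<^sub>R fst x), gfloor (T *\<^sub>R snd x))"

lemma lattice_floor_in: "lattice_floor T x \<in> lattice"
  by (simp add: lattice_floor_def lattice_def)

lemma lattice_floor_dist:
  assumes "T > 0"
  shows "norm ((1 / T) *\<^sub>R lattice_floor T x - x) \<le> 4 / T"
proof -
  have 1: "cmod (gfloor z - z) \<le> 2" for z
    using norm_unit_square[of "z - gfloor z"] gfloor_eq_iff[of z "gfloor z"]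
    by (simp add: norm_minus_commute)
  have "norm (lattice_floor T x - T *\<^sub>R x) \<le> 4"
    using norm_Pair_le[of "gfloor (T *\<^sub>R fst x) - T *\<^sub>R fst x" "gfloor (T *\<^sub>R snd x) - T *\<^sub>R snd x"]
      1[of "T *\<^sub>R fst x"] 1[of "T *\<^sub>R snd x"]
    by (simp add: lattice_floor_def minus_prod_def)
  moreover have "(1 / T) *\<^sub>R lattice_floor T x - x = (1 / T) *\<^sub>R (lattice_floor T x - T *\<^sub>R x)"
    using assms by (simp add: scaleR_diff_right)
  ultimately show ?thesis using assms by (simp add: divide_right_mono)
qed

lemma lattice_cell_measure:
  assumes T: "T > 0" and v: "v \<in> lattice"
  shows "{x. lattice_floor T x = v} \<in> sets borel"
    and "measure lborel {x. lattice_floor T x = v} = 1 / T ^ 4"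
proof -
  let ?Q = "unit_square \<times> unit_square"
  have Q: "?Q \<in> sets borel" by (simp add: borel_prod[symmetric])
  have "emeasure lborel ?Q = 1"
    unfolding lborel_prod[symmetric]
    by (simp add: lborel.emeasure_pair_measure_Times emeasure_unit_square)
  define A where "A = (\<lambda>x. x - v) -` ?Q"
  have A: "A \<in> sets borel"
    unfolding A_def by (rule measurable_sets_borel[OF _ Q]) measurable
  have "emeasure lborel A = emeasure (distr lborel borel ((+) (- v))) ?Q"
    using Q by (subst emeasure_distr) (auto simp: A_def vimage_def)
  also have "\<dots> = 1" using \<open>emeasure lborel ?Q = 1\<close> by (simp add: lborel_distr_plus)
  finally have A1: "emeasure lborel A = 1" .
  have eq: "{x. lattice_floor T x = v} = (\<lambda>x. T *\<^sub>R x) -` A"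
    using v gfloor_eq_iff by (fastforce simp: A_def lattice_floor_def lattice_def)
  show "{x. lattice_floor T x = v} \<in> sets borel"
    unfolding eq by (rule measurable_sets_borel[OF _ A]) measurable
  have "1 = ennreal (T ^ 4) * emeasure lborel {x. lattice_floor T x = v}"
    using lborel_scale_vimage[OF A T] A1 unfolding eq by simp
  then have "1 = T ^ 4 * measure lborel {x. lattice_floor T x = v}"
    using T by (metis enn2real_1 enn2real_ennreal enn2real_mult measure_def zero_le_power less_imp_le)
  then show "measure lborel {x. lattice_floor T x = v} = 1 / T ^ 4"
    using T by (simp add: field_simps)
qed

lemma finite_lattice_ball: "finite {v \<in> lattice. norm v \<le> r}"
proof (rule finite_subset)
  let ?F = "{g \<in> gaussian_ints. cmod g \<le> r}"
  show "{v \<in> lattice. norm v \<le> r} \<subseteq> ?F \<times> ?F"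
  proof
    fix v assume "v \<in> {v \<in> lattice. norm v \<le> r}"
    then show "v \<in> ?F \<times> ?F"
      using norm_fst_le[of "fst v" "snd v"] norm_snd_le[of "snd v" "fst v"]
      by (cases v) (auto simp: lattice_def)
  qed
qed (simp add: finite_gaussian_ints_cball)

text \<open>Only the nonzero terms are summed: this makes the range finite for \<open>h\<close> of bounded
  support, without mentioning a bound.\<close>

definition lattice_sum :: "(complex \<times> complex \<Rightarrow> real) \<Rightarrow> (complex \<times> complex) set \<Rightarrow> real \<Rightarrow> real" where
  "lattice_sum h L T = (\<Sum>v | v \<in> L \<and> h ((1 / T) *\<^sub>R v) \<noteq> 0. h ((1 / T) *\<^sub>R v))"

text \<open>The range of summation in the definition depends on \<open>h\<close>; regrouping and estimates need
  one that does not.\<close>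

lemma lattice_sum_eq:
  assumes h: "\<And>x. norm x > R \<Longrightarrow> h x = 0" and L: "L \<subseteq> lattice" and T: "T > 0"
    and S: "finite S" "{v \<in> L. norm v \<le> R * T} \<subseteq> S" "S \<subseteq> L"
  shows "lattice_sum h L T = (\<Sum>v\<in>S. h ((1 / T) *\<^sub>R v))"
  unfolding lattice_sum_def
proof (rule sum.mono_neutral_left)
  show "{v \<in> L. h ((1 / T) *\<^sub>R v) \<noteq> 0} \<subseteq> S"
  proof
    fix v assume v: "v \<in> {v \<in> L. h ((1 / T) *\<^sub>R v) \<noteq> 0}"
    then have "norm ((1 / T) *\<^sub>R v) \<le> R" using h[of "(1 / T) *\<^sub>R v"] by (auto simp: not_less[symmetric])
    then have "norm v \<le> R * T" using T by (simp add: field_simps)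
    then show "v \<in> S" using v S by auto
  qed
qed (use S in auto)

text \<open>The sum divided by \<open>T ^ 4\<close> is the integral of \<open>h\<close> composed with rounding to
  \<open>(1 / T) * \<int>[\<i>]\<^sup>2\<close>, which tends to the identity; dominated convergence then asks for
  continuity of \<open>h\<close> almost everywhere only.\<close>

lemma lattice_riemann_sum:
  fixes h :: "complex \<times> complex \<Rightarrow> real"
  assumes h [measurable]: "h \<in> borel_measurable borel"
    and bdd: "\<And>x. \<bar>h x\<bar> \<le> C" and supp: "\<And>x. norm x > R \<Longrightarrow> h x = 0"
    and cont: "AE x in lborel. isCont h x"
  shows "((\<lambda>T. lattice_sum h lattice T / T ^ 4) \<longlongrightarrow> integral\<^sup>L lborel h) at_top"
proof -
  have meas: "(\<lambda>x. h ((1 / T) *\<^sub>R lattice_floor T x)) \<in> borel_measurable borel" for T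
  proof -
    have [measurable]: "gfloor \<in> borel_measurable borel"
      unfolding gfloor_def complex_eq_iff Complex_eq by measurable
    have "(\<lambda>x. (1 / T) *\<^sub>R lattice_floor T x) \<in> borel_measurable (borel \<Otimes>\<^sub>M borel)"
      unfolding lattice_floor_def scaleR_Pair borel_prod[symmetric] by measurable
    then show ?thesis unfolding borel_prod by (rule measurable_compose[OF _ h])
  qed
  have step: "lattice_sum h lattice T / T ^ 4 = integral\<^sup>L lborel (\<lambda>x. h ((1 / T) *\<^sub>R lattice_floor T x))"
    if T: "T > 0" for T
  proof -
    let ?L = "{v \<in> lattice. norm v \<le> R * T}"
    have eq: "h ((1 / T) *\<^sub>R lattice_floor T x)
        = (\<Sum>v\<in>?L. h ((1 / T) *\<^sub>R v) * indicator {x. lattice_floor T x = v} x)" for x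
    proof -
      have "(\<Sum>v\<in>?L. h ((1 / T) *\<^sub>R v) * indicator {x. lattice_floor T x = v} x)
          = (\<Sum>v\<in>?L. if v = lattice_floor T x then h ((1 / T) *\<^sub>R v) else 0)"
        by (intro sum.cong) (auto simp: indicator_def)
      also have "\<dots> = (if lattice_floor T x \<in> ?L then h ((1 / T) *\<^sub>R lattice_floor T x) else 0)"
        by (subst sum.delta) (auto simp: finite_lattice_ball)
      also have "\<dots> = h ((1 / T) *\<^sub>R lattice_floor T x)"
      proof (cases "lattice_floor T x \<in> ?L")
        case False
        then have "norm ((1 / T) *\<^sub>R lattice_floor T x) > R"
          using lattice_floor_in[of T x] T by (simp add: field_simps)
        then show ?thesis using supp False by simp
      qed simp
      finally show ?thesis ..
    qed
    have int: "integrable lborel (indicator {x. lattice_floor T x = v} :: _ \<Rightarrow> real)" if "v \<in> lattice" for v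
    proof (rule integrable_real_indicator)
      show "{x. lattice_floor T x = v} \<in> sets lborel" using lattice_cell_measure(1)[OF T that] by simp
      show "emeasure lborel {x. lattice_floor T x = v} < \<infinity>"
        using lattice_cell_measure(2)[OF T that] T
        by (metis divide_eq_0_iff emeasure_eq_ennreal_measure ennreal_less_top infinity_ennreal_def
            less_irrefl measure_def enn2real_top top.not_eq_extremum zero_less_power zero_neq_one)
    qed
    have "integral\<^sup>L lborel (\<lambda>x. h ((1 / T) *\<^sub>R lattice_floor T x))
        = (\<Sum>v\<in>?L. h ((1 / T) *\<^sub>R v) * measure lborel {x. lattice_floor T x = v})"
      unfolding eq by (subst Bochner_Integration.integral_sum) (auto intro!: int)
    also have "\<dots> = (\<Sum>v\<in>?L. h ((1 / T) *\<^sub>R v)) / T ^ 4"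
      by (simp add: lattice_cell_measure(2)[OF T] sum_divide_distrib)
    also have "(\<Sum>v\<in>?L. h ((1 / T) *\<^sub>R v)) = lattice_sum h lattice T"
      by (rule lattice_sum_eq[symmetric, OF supp _ T]) (auto simp: finite_lattice_ball)
    finally show ?thesis ..
  qed
  (* For T >= 1 rounding moves points by at most 4, so all integrands live on the ball of radius R + 4. *)
  have "((\<lambda>T. integral\<^sup>L lborel (\<lambda>x. h ((1 / T) *\<^sub>R lattice_floor T x))) \<longlongrightarrow> integral\<^sup>L lborel h) at_top"
  proof (rule integral_dominated_convergence_at_top[where w = "\<lambda>x. \<bar>C\<bar> * indicator (cball 0 (R + 4)) x"])
    show "AE x in lborel. ((\<lambda>T. h ((1 / T) *\<^sub>R lattice_floor T x)) \<longlongrightarrow> h x) at_top"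
      using cont
    proof eventually_elim
      case (elim x)
      have "((\<lambda>T. (1 / T) *\<^sub>R lattice_floor T x - x) \<longlongrightarrow> 0) at_top"
      proof (rule Lim_null_comparison)
        show "\<forall>\<^sub>F T in at_top. norm ((1 / T) *\<^sub>R lattice_floor T x - x) \<le> 4 / T"
          using eventually_gt_at_top[of 0] by eventually_elim (rule lattice_floor_dist)
        show "((\<lambda>T :: real. 4 / T) \<longlongrightarrow> 0) at_top" by real_asymp
      qed
      then have "((\<lambda>T. (1 / T) *\<^sub>R lattice_floor T x) \<longlongrightarrow> x) at_top"
        by (simp add: LIM_zero_iff)
      with elim show ?case by (rule isCont_tendsto_compose)
    qed
    have "bounded (cball (0 :: complex \<times> complex) (R + 4))" by simp
    from emeasure_bounded_finite[OF this]
    show "integrable lborel (\<lambda>x :: complex \<times> complex. \<bar>C\<bar> * indicator (cball 0 (R + 4)) x)"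
      by (intro integrable_mult_right integrable_real_indicator) auto
    show "\<forall>\<^sub>F T in at_top. AE x in lborel.
        norm (h ((1 / T) *\<^sub>R lattice_floor T x)) \<le> \<bar>C\<bar> * indicator (cball 0 (R + 4)) x"
      using eventually_ge_at_top[of 1]
    proof eventually_elim
      case (elim T)
      show ?case
      proof (intro AE_I2)
        fix x
        have "4 / T \<le> 4" using elim by (simp add: divide_le_eq)
        then have "norm ((1 / T) *\<^sub>R lattice_floor T x - x) \<le> 4"
          using lattice_floor_dist[of T x] elim by linarith
        then have "norm x \<le> norm ((1 / T) *\<^sub>R lattice_floor T x) + 4"
          using norm_triangle_ineq4[of "(1 / T) *\<^sub>R lattice_floor T x" "(1 / T) *\<^sub>R lattice_floor T x - x"]
          by simp
        then show "norm (h ((1 / T) *\<^sub>R lattice_floor T x)) \<le> \<bar>C\<bar> * indicator (cball 0 (R + 4)) x"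
          using supp[of "(1 / T) *\<^sub>R lattice_floor T x"] bdd[of "(1 / T) *\<^sub>R lattice_floor T x"]
          by (cases "norm ((1 / T) *\<^sub>R lattice_floor T x) > R") (auto simp: indicator_def)
      qed
    qed
  qed (use meas in auto)
  then show ?thesis
    by (rule Lim_transform_eventually)
       (use eventually_gt_at_top[of 0] in eventually_elim, simp add: step)
qed

section \<open>Primitive lattice points\<close>

lemma norm_cscale: "norm (cscale d w) = cmod d * norm w"
  by (cases w) (simp add: cscale_def norm_Pair norm_mult power_mult_distrib real_sqrt_mult
      flip: distrib_left)

lemma cscale_cscale: "cscale a (cscale b v) = cscale (a * b) v"
  by (simp add: cscale_def mult.assoc)

lemma cscale_1 [simp]: "cscale 1 v = v"
  by (simp add: cscale_def)

lemma primitive_subset: "primitive \<subseteq> lattice"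
  by (auto simp: primitive_def)

lemma lattice_norm_ge_1:
  assumes "v \<in> lattice" "v \<noteq> 0" shows "1 \<le> norm v"
proof (cases "fst v = 0")
  case True
  then have "1 \<le> cmod (snd v)"
    using assms by (cases v) (auto simp: lattice_def zero_prod_def intro!: gaussian_ints_norm_ge_1)
  then show ?thesis using norm_snd_le[of "snd v" "fst v"] by simp
next
  case False
  then have "1 \<le> cmod (fst v)"
    using assms by (cases v) (auto simp: lattice_def intro!: gaussian_ints_norm_ge_1)
  then show ?thesis using norm_fst_le[of "fst v" "snd v"] by simp
qed

lemma primitive_nonzero: "w \<in> primitive \<Longrightarrow> w \<noteq> 0"
  by (erule primitiveE) (auto simp: zero_prod_def)

text \<open>The four factorisations differ by the four units.\<close>

lemma card_content_fibre:
  assumes v: "v \<in> lattice" "v \<noteq> 0"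
  shows "card {(d, w). d \<in> gaussian_ints \<and> w \<in> primitive \<and> cscale d w = v} = 4"
proof -
  let ?X = "{(d, w). d \<in> gaussian_ints \<and> w \<in> primitive \<and> cscale d w = v}"
  obtain d0 w0 where c: "d0 \<in> gaussian_ints" "d0 \<noteq> 0" "w0 \<in> primitive" "v = cscale d0 w0"
    using content_exists[OF v] .
  let ?f = "\<lambda>u. (d0 * u, cscale (cnj u) w0)"
  have unit: "u \<in> gaussian_ints" "cnj u \<in> gaussian_units" "u * cnj u = 1" if "u \<in> gaussian_units" for u
    using that complex_norm_square[of u] by (simp_all add: gaussian_units_def gaussian_ints_def)
  have "?X = ?f ` gaussian_units"
  proof (intro equalityI subsetI)
    fix x assume "x \<in> ?X"
    then obtain d w where x: "x = (d, w)" "d \<in> gaussian_ints" "w \<in> primitive" "cscale d w = v"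
      by blast
    then obtain u where u: "u \<in> gaussian_units" "d = d0 * u" "w0 = cscale u w"
      using content_unique[OF c(3) x(3) c(1) x(2) c(2)] c(4) by auto
    have "cscale (cnj u) w0 = w"
      unfolding u(3) cscale_cscale using unit[OF u(1)] by (simp add: mult.commute)
    then show "x \<in> ?f ` gaussian_units" using x u by (intro image_eqI[of _ _ u]) auto
  next
    fix x assume "x \<in> ?f ` gaussian_units"
    then obtain u where u: "u \<in> gaussian_units" "x = ?f u" by blast
    have "cscale (d0 * u) (cscale (cnj u) w0) = cscale (d0 * (u * cnj u)) w0"
      by (simp only: cscale_cscale mult.assoc)
    also have "\<dots> = v" using unit[OF u(1)] c(4) by simp
    finally show "x \<in> ?X"
      using u c unit[OF u(1)] gaussian_units_primitive gaussian_ints_mult by auto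
  qed
  moreover have "inj_on ?f gaussian_units" using c(2) by (auto simp: inj_on_def)
  ultimately show ?thesis by (simp add: card_image card_gaussian_units)
qed

text \<open>Summing over pairs \<open>(d, w)\<close> with \<open>w\<close> primitive counts every nonzero vector \<open>d * w\<close>
  four times. Circle invariance allows replacing \<open>d\<close> by \<open>\<bar>d\<bar>\<close>, so that only the scale changes.\<close>

lemma lattice_sum_primitive_decomp:
  assumes supp: "\<And>x. norm x > R \<Longrightarrow> h x = 0" and h0: "h 0 = 0"
    and circ: "\<And>u x. cmod u = 1 \<Longrightarrow> h (cscale u x) = h x" and T: "T > 0"
  shows "4 * lattice_sum h lattice T
    = (\<Sum>d | d \<in> gaussian_ints \<and> d \<noteq> 0 \<and> cmod d \<le> R * T. lattice_sum h primitive (T / cmod d))"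
proof -
  let ?D = "{d. d \<in> gaussian_ints \<and> d \<noteq> 0 \<and> cmod d \<le> R * T}"
  let ?P = "{w \<in> primitive. norm w \<le> R * T}"
  let ?L = "{v \<in> lattice. v \<noteq> 0 \<and> norm v \<le> R * T}"
  let ?S = "{p \<in> ?D \<times> ?P. norm (cscale (fst p) (snd p)) \<le> R * T}"
  let ?f = "\<lambda>v. h ((1 / T) *\<^sub>R v)"
  have finD: "finite ?D"
    by (rule finite_subset[OF _ finite_gaussian_ints_cball[of "R * T"]]) auto
  have finP: "finite ?P"
    by (rule finite_subset[OF _ finite_lattice_ball[of "R * T"]]) (use primitive_subset in auto)
  have finL: "finite ?L"
    by (rule finite_subset[OF _ finite_lattice_ball[of "R * T"]]) auto
  have finS: "finite ?S" using finD finP by auto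
  have "(\<Sum>d\<in>?D. lattice_sum h primitive (T / cmod d)) = (\<Sum>d\<in>?D. \<Sum>w\<in>?P. ?f (cscale d w))"
  proof (rule sum.cong[OF refl])
    fix d assume d: "d \<in> ?D"
    then have d1: "1 \<le> cmod d" using gaussian_ints_norm_ge_1 by auto
    have "lattice_sum h primitive (T / cmod d) = (\<Sum>w\<in>?P. h ((1 / (T / cmod d)) *\<^sub>R w))"
    proof (rule lattice_sum_eq[OF supp primitive_subset])
      show "T / cmod d > 0" using T d1 by (intro divide_pos_pos) auto
      show "{v \<in> primitive. norm v \<le> R * (T / cmod d)} \<subseteq> ?P"
      proof
        fix w assume w: "w \<in> {v \<in> primitive. norm v \<le> R * (T / cmod d)}"
        then have "norm w \<le> R * T / cmod d" by simp
        then have "norm w * cmod d \<le> R * T" using d1 by (subst (asm) pos_le_divide_eq) auto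
        moreover have "norm w * 1 \<le> norm w * cmod d" using d1 by (intro mult_left_mono) auto
        ultimately show "w \<in> ?P" using w by auto
      qed
    qed (use finP in auto)
    also have "\<dots> = (\<Sum>w\<in>?P. ?f (cscale d w))"
    proof (rule sum.cong[OF refl])
      fix w
      have "(1 / T) *\<^sub>R cscale d w = cscale (d / cmod d) ((1 / (T / cmod d)) *\<^sub>R w)"
        using d by (cases w) (auto simp: cscale_def scaleR_conv_of_real)
      moreover have "cmod (d / cmod d) = 1" using d by (simp add: norm_divide)
      ultimately show "h ((1 / (T / cmod d)) *\<^sub>R w) = ?f (cscale d w)"
        using circ by simp
    qed
    finally show "lattice_sum h primitive (T / cmod d) = (\<Sum>w\<in>?P. ?f (cscale d w))" .
  qed
  also have "\<dots> = (\<Sum>p\<in>?D \<times> ?P. ?f (cscale (fst p) (snd p)))"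
    by (simp add: sum.cartesian_product split_def)
  also have "\<dots> = (\<Sum>p\<in>?S. ?f (cscale (fst p) (snd p)))"
  proof (rule sum.mono_neutral_right)
    show "\<forall>p\<in>?D \<times> ?P - ?S. ?f (cscale (fst p) (snd p)) = 0"
    proof
      fix p assume "p \<in> ?D \<times> ?P - ?S"
      then have "norm ((1 / T) *\<^sub>R cscale (fst p) (snd p)) > R"
        using T by (auto simp: field_simps)
      then show "?f (cscale (fst p) (snd p)) = 0" by (rule supp)
    qed
  qed (use finD finP in auto)
  also have "\<dots> = (\<Sum>v\<in>?L. \<Sum>p | p \<in> ?S \<and> cscale (fst p) (snd p) = v. ?f (cscale (fst p) (snd p)))"
  proof (rule sum.group[symmetric, OF finS finL])
    show "(\<lambda>p. cscale (fst p) (snd p)) ` ?S \<subseteq> ?L"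
    proof (rule image_subsetI)
      fix p assume p: "p \<in> ?S"
      then have w: "snd p \<in> primitive" and d: "fst p \<in> gaussian_ints" "fst p \<noteq> 0" by auto
      have "norm (cscale (fst p) (snd p)) \<noteq> 0"
        using primitive_nonzero[OF w] d by (simp add: norm_cscale)
      moreover have "cscale (fst p) (snd p) \<in> lattice"
        using w d primitive_subset by (auto simp: cscale_def lattice_def intro!: gaussian_ints_mult)
      ultimately show "cscale (fst p) (snd p) \<in> ?L" using p by auto
    qed
  qed
  also have "\<dots> = (\<Sum>v\<in>?L. 4 * ?f v)"
  proof (rule sum.cong[OF refl])
    fix v assume v: "v \<in> ?L"
    have "{p. p \<in> ?S \<and> cscale (fst p) (snd p) = v}
        = {(d, w). d \<in> gaussian_ints \<and> w \<in> primitive \<and> cscale d w = v}" (is "?X = ?Y")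
    proof (intro equalityI subsetI)
      fix p assume "p \<in> ?Y"
      then obtain d w where p: "p = (d, w)" "d \<in> gaussian_ints" "w \<in> primitive" "cscale d w = v" by blast
      have "norm v = cmod d * norm w" using p(4) norm_cscale by metis
      moreover have w1: "1 \<le> norm w"
        using p(3) primitive_subset primitive_nonzero lattice_norm_ge_1 by blast
      moreover have d0: "d \<noteq> 0" using p v by (auto simp: cscale_def zero_prod_def)
      then have d1: "1 \<le> cmod d" using p gaussian_ints_norm_ge_1 by blast
      ultimately have "cmod d \<le> norm v" "norm w \<le> norm v"
        using mult_left_mono[of 1 "norm w" "cmod d"] mult_right_mono[of 1 "cmod d" "norm w"] by auto
      then show "p \<in> ?X" using p v d0 by auto
    qed auto
    then have "card ?X = 4" using card_content_fibre v by simp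
    then show "(\<Sum>p\<in>?X. ?f (cscale (fst p) (snd p))) = 4 * ?f v" by simp
  qed
  also have "\<dots> = 4 * (\<Sum>v\<in>{v \<in> lattice. norm v \<le> R * T}. ?f v)"
    unfolding sum_distrib_left
    by (rule sum.mono_neutral_left) (use h0 finite_lattice_ball in auto)
  also have "(\<Sum>v\<in>{v \<in> lattice. norm v \<le> R * T}. ?f v) = lattice_sum h lattice T"
    by (rule lattice_sum_eq[symmetric, OF supp _ T]) (auto simp: finite_lattice_ball)
  finally show ?thesis ..
qed

lemma card_gaussian_ints_cball:
  assumes "1 \<le> r" shows "real (card {g \<in> gaussian_ints. cmod g \<le> r}) \<le> 9 * r\<^sup>2"
proof -
  let ?I = "{- \<lfloor>r\<rfloor>..\<lfloor>r\<rfloor>}"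
  have "{g \<in> gaussian_ints. cmod g \<le> r} \<subseteq> (\<lambda>(a, b). Complex (of_int a) (of_int b)) ` (?I \<times> ?I)"
  proof
    fix g assume g: "g \<in> {g \<in> gaussian_ints. cmod g \<le> r}"
    then obtain a b where ab: "g = Complex (of_int a) (of_int b)"
      unfolding gaussian_ints_conv_image by auto
    then have "\<bar>of_int a\<bar> \<le> r" "\<bar>of_int b\<bar> \<le> r"
      using g abs_Re_le_cmod[of g] abs_Im_le_cmod[of g] by auto
    then have "a \<in> ?I" "b \<in> ?I" by (simp_all, linarith+)
    with ab show "g \<in> (\<lambda>(a, b). Complex (of_int a) (of_int b)) ` (?I \<times> ?I)" by auto
  qed
  then have "card {g \<in> gaussian_ints. cmod g \<le> r} \<le> card ((\<lambda>(a, b). Complex (of_int a) (of_int b)) ` (?I \<times> ?I))"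
    by (rule card_mono[rotated]) simp
  also have "\<dots> \<le> card (?I \<times> ?I)" by (rule card_image_le) simp
  finally have "real (card {g \<in> gaussian_ints. cmod g \<le> r}) \<le> (real (card ?I))\<^sup>2"
    by (simp add: card_cartesian_product power2_eq_square flip: of_nat_mult)
  also have "real (card ?I) \<le> 3 * r"
    using assms by simp linarith
  then have "(real (card ?I))\<^sup>2 \<le> (3 * r)\<^sup>2" by (rule power_mono) simp
  finally show ?thesis by (simp add: power_mult_distrib)
qed

text \<open>A bound that is uniform in \<open>T\<close>: for \<open>R * T < 1\<close> the sum is empty, and otherwise the
  number of lattice points is of the order of the volume.\<close>

lemma primitive_sum_bounded:
  assumes supp: "\<And>x. norm x > R \<Longrightarrow> h x = 0" and bdd: "\<And>x. \<bar>h x\<bar> \<le> C" and T: "T > 0"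
  shows "\<bar>lattice_sum h primitive T / T ^ 4\<bar> \<le> C * (81 * R ^ 4)"
proof -
  let ?P = "{w \<in> primitive. norm w \<le> R * T}"
  let ?F = "{g \<in> gaussian_ints. cmod g \<le> R * T}"
  have C: "0 \<le> C" using bdd[of 0] by linarith
  have finP: "finite ?P"
    by (rule finite_subset[OF _ finite_lattice_ball[of "R * T"]]) (use primitive_subset in auto)
  have eq: "lattice_sum h primitive T = (\<Sum>v\<in>?P. h ((1 / T) *\<^sub>R v))"
    by (rule lattice_sum_eq[OF supp primitive_subset T]) (use finP in auto)
  have "\<bar>lattice_sum h primitive T\<bar> \<le> C * (81 * (R * T) ^ 4)"
  proof (cases "1 \<le> R * T")
    case True
    have "\<bar>lattice_sum h primitive T\<bar> \<le> (\<Sum>v\<in>?P. \<bar>h ((1 / T) *\<^sub>R v)\<bar>)"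
      unfolding eq by (rule sum_abs)
    also have "\<dots> \<le> (\<Sum>v\<in>?P. C)" by (intro sum_mono bdd)
    also have "\<dots> = C * real (card ?P)" by simp
    also have "card ?P \<le> card (?F \<times> ?F)"
    proof (rule card_mono)
      show "?P \<subseteq> ?F \<times> ?F"
      proof
        fix v assume "v \<in> ?P"
        then show "v \<in> ?F \<times> ?F"
          using norm_fst_le[of "fst v" "snd v"] norm_snd_le[of "snd v" "fst v"] primitive_subset
          by (cases v) (auto simp: lattice_def)
      qed
    qed (simp add: finite_gaussian_ints_cball)
    then have "real (card ?P) \<le> (real (card ?F))\<^sup>2"
      by (simp add: card_cartesian_product power2_eq_square flip: of_nat_mult)
    also have "\<dots> \<le> (9 * (R * T)\<^sup>2)\<^sup>2"
      by (intro power_mono card_gaussian_ints_cball True) simp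
    also have "\<dots> = 81 * (R * T) ^ 4" by (simp add: power_mult_distrib flip: power_mult)
    finally show ?thesis using C by (simp add: mult_left_mono)
  next
    case False
    have "w \<notin> ?P" for w
    proof
      assume w: "w \<in> ?P"
      then have "1 \<le> norm w" using primitive_subset primitive_nonzero lattice_norm_ge_1 by blast
      with w False show False by simp
    qed
    then have "?P = {}" by blast
    then have "lattice_sum h primitive T = 0" unfolding eq by (simp only: sum.empty)
    then show ?thesis using C by simp
  qed
  then show ?thesis using T by (simp add: abs_divide field_simps power_mult_distrib)
qed

text \<open>The subtracted term makes the bound telescope.\<close>

lemma sum_inverse_squares_int:
  "(\<Sum>a\<in>{- int (K + 2)..int (K + 2)}. 1 / (of_int a)\<^sup>2) \<le> 7 / 2 - 2 / real (K + 2)"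
proof (induction K)
  case 0
  have "{- int (0 + 2)..int (0 + 2)} = {-2, -1, 0, 1, 2}" by auto
  then show ?case by simp
next
  case (Suc K)
  have eq: "{- int (Suc K + 2)..int (Suc K + 2)}
      = insert (- int (K + 3)) (insert (int (K + 3)) {- int (K + 2)..int (K + 2)})" by auto
  have "(\<Sum>a\<in>{- int (Suc K + 2)..int (Suc K + 2)}. 1 / (of_int a)\<^sup>2)
      = 2 / (real (K + 3))\<^sup>2 + (\<Sum>a\<in>{- int (K + 2)..int (K + 2)}. 1 / (of_int a :: real)\<^sup>2)"
    unfolding eq by (subst sum.insert, simp, simp, subst sum.insert, simp, simp)
      (simp add: power2_eq_square algebra_simps)
  also have "\<dots> \<le> 2 / (real (K + 3))\<^sup>2 + (7 / 2 - 2 / real (K + 2))" using Suc by simp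
  also have "2 / (real (K + 3))\<^sup>2 \<le> 2 / (real (K + 2) * real (K + 3))"
    by (intro divide_left_mono) (auto simp: power2_eq_square)
  also have "2 / (real (K + 2) * real (K + 3)) = 2 / real (K + 2) - 2 / real (K + 3)"
    by (simp add: field_simps)
  finally show ?case by (simp add: eval_nat_numeral)
qed

definition gaussian_nonunits :: "complex set" where
  "gaussian_nonunits = {d \<in> gaussian_ints. 1 < cmod d}"

text \<open>What matters is that the bound is less than \<open>4\<close>. For \<open>d = a + b * \<i>\<close> off the axes,
  \<open>(a\<^sup>2 + b\<^sup>2)\<^sup>2 \<ge> 4 * a\<^sup>2 * b\<^sup>2\<close>; on the axes \<open>\<bar>d\<bar> \<ge> 2\<close>. With \<open>S\<close> the sum of
  \<open>1 / a\<^sup>2\<close> over nonzero integers, this gives at most \<open>(S\<^sup>2 + 2 * (S - 2)) / 4\<close>, and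
  \<open>S \<le> 7 / 2\<close>.\<close>

lemma sum_nonunits_le:
  assumes F: "finite F" "F \<subseteq> gaussian_nonunits"
  shows "(\<Sum>d\<in>F. 1 / cmod d ^ 4) \<le> 61 / 16"
proof -
  define C where "C = (\<lambda>(a, b). Complex (of_int a) (of_int b))"
  define f where "f a = 1 / (of_int a :: real)\<^sup>2" for a :: int
  (* On an axis the units are missing from F, so e keeps only |a| >= 2; z singles out the axis. *)
  define e where "e a = (if \<bar>a\<bar> \<le> 1 then 0 else f a)" for a :: int
  define z where "z a = (if a = 0 then 1 else 0 :: real)" for a :: int
  obtain r where r: "\<And>d. d \<in> F \<Longrightarrow> cmod d \<le> r"
    using finite_imp_bounded[OF F(1)] by (auto simp: bounded_iff)
  define K where "K = nat \<lceil>r\<rceil>"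
  let ?I = "{- int (K + 2)..int (K + 2)}"
  let ?G = "{p \<in> ?I \<times> ?I. 1 < cmod (C p)}"
  have sub: "F \<subseteq> C ` ?G"
  proof
    fix d assume d: "d \<in> F"
    then obtain a b where ab: "d = C (a, b)"
      using F(2) unfolding gaussian_nonunits_def gaussian_ints_conv_image C_def by auto
    then have "\<bar>of_int a\<bar> \<le> r" "\<bar>of_int b\<bar> \<le> r"
      using r[OF d] abs_Re_le_cmod[of d] abs_Im_le_cmod[of d] by (auto simp: C_def)
    then have "(a, b) \<in> ?I \<times> ?I" unfolding K_def by auto linarith+
    then show "d \<in> C ` ?G" using ab d F(2) by (auto simp: gaussian_nonunits_def)
  qed
  have inj: "inj_on C ?G" by (auto simp: inj_on_def C_def)
  have finG: "finite ?G" by simp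
  have "(\<Sum>d\<in>F. 1 / cmod d ^ 4) \<le> (\<Sum>d\<in>C ` ?G. 1 / cmod d ^ 4)"
    by (rule sum_mono2[OF _ sub]) auto
  also have "\<dots> = (\<Sum>p\<in>?G. 1 / cmod (C p) ^ 4)"
    by (subst sum.reindex[OF inj]) simp
  also have "\<dots> \<le> (\<Sum>p\<in>?G. (f (fst p) * f (snd p) + z (fst p) * e (snd p) + e (fst p) * z (snd p)) / 4)"
  proof (rule sum_mono)
    fix p assume p: "p \<in> ?G"
    obtain a b where ab: "p = (a, b)" by (cases p)
    define x y where "x = (of_int a :: real)" and "y = (of_int b :: real)"
    have c2: "(cmod (C p))\<^sup>2 = x\<^sup>2 + y\<^sup>2" by (simp add: ab C_def cmod_power2 x_def y_def)
    have c4: "cmod (C p) ^ 4 = (x\<^sup>2 + y\<^sup>2)\<^sup>2"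
      unfolding c2[symmetric] by (simp flip: power_mult)
    have ge: "1 < x\<^sup>2 + y\<^sup>2" using p c2 by (simp flip: c2 add: one_less_power)
    consider "a = 0" | "b = 0" "a \<noteq> 0" | "a \<noteq> 0" "b \<noteq> 0" by blast
    then show "1 / cmod (C p) ^ 4 \<le> (f (fst p) * f (snd p) + z (fst p) * e (snd p) + e (fst p) * z (snd p)) / 4"
    proof cases
      case 1
      then have "1 < \<bar>y\<bar>" using ge by (simp add: x_def abs_square_less_1 not_less abs_square_le_1 flip: not_le)
      then have b: "1 < \<bar>b\<bar>" unfolding y_def by linarith
      then have "2 \<le> \<bar>y\<bar>" unfolding y_def by linarith
      then have "4 \<le> y\<^sup>2" using power_mono[of 2 "\<bar>y\<bar>" 2] by simp
      then have "4 * y\<^sup>2 \<le> y\<^sup>2 * y\<^sup>2" by (intro mult_right_mono) auto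
      moreover have "0 < y\<^sup>2" using \<open>4 \<le> y\<^sup>2\<close> by linarith
      ultimately have "1 / (y\<^sup>2)\<^sup>2 \<le> 1 / (4 * y\<^sup>2)"
        unfolding power2_eq_square[of "y\<^sup>2"] by (intro frac_le) auto
      then show ?thesis using 1 b unfolding c4 by (simp add: ab f_def z_def e_def x_def y_def)
    next
      case 2
      then have "1 < \<bar>x\<bar>" using ge by (simp add: y_def abs_square_less_1 not_less abs_square_le_1 flip: not_le)
      then have b: "1 < \<bar>a\<bar>" unfolding x_def by linarith
      then have "2 \<le> \<bar>x\<bar>" unfolding x_def by linarith
      then have "4 \<le> x\<^sup>2" using power_mono[of 2 "\<bar>x\<bar>" 2] by simp
      then have "4 * x\<^sup>2 \<le> x\<^sup>2 * x\<^sup>2" by (intro mult_right_mono) auto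
      moreover have "0 < x\<^sup>2" using \<open>4 \<le> x\<^sup>2\<close> by linarith
      ultimately have "1 / (x\<^sup>2)\<^sup>2 \<le> 1 / (4 * x\<^sup>2)"
        unfolding power2_eq_square[of "x\<^sup>2"] by (intro frac_le) auto
      then show ?thesis using 2 b unfolding c4 by (simp add: ab f_def z_def e_def x_def y_def)
    next
      case 3
      then have "0 < x\<^sup>2 * y\<^sup>2" by (simp add: x_def y_def)
      moreover have "4 * (x\<^sup>2 * y\<^sup>2) \<le> (x\<^sup>2 + y\<^sup>2)\<^sup>2"
        using zero_le_power2[of "x\<^sup>2 - y\<^sup>2"] by (simp add: power2_eq_square algebra_simps)
      ultimately have "1 / (x\<^sup>2 + y\<^sup>2)\<^sup>2 \<le> 1 / (4 * (x\<^sup>2 * y\<^sup>2))"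
        by (intro frac_le) auto
      then show ?thesis using 3 unfolding c4 by (simp add: ab f_def z_def e_def x_def y_def)
    qed
  qed
  also have "\<dots> \<le> (\<Sum>p\<in>?I \<times> ?I. (f (fst p) * f (snd p) + z (fst p) * e (snd p) + e (fst p) * z (snd p)) / 4)"
    by (rule sum_mono2) (auto simp: f_def z_def e_def)
  also have "\<dots> = ((\<Sum>a\<in>?I. f a) * (\<Sum>b\<in>?I. f b) + (\<Sum>a\<in>?I. z a) * (\<Sum>b\<in>?I. e b) + (\<Sum>a\<in>?I. e a) * (\<Sum>b\<in>?I. z b)) / 4"
    by (simp only: sum_divide_distrib[symmetric] sum.distrib sum_product sum.cartesian_product split_def)
  also have "(\<Sum>a\<in>?I. z a) = 1" unfolding z_def by (subst sum.delta) auto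
  also have "(\<Sum>a\<in>?I. e a) = (\<Sum>a\<in>?I. f a) - 2"
  proof -
    have "(\<Sum>a\<in>?I. f a) = (\<Sum>a\<in>?I. e a) + (\<Sum>a\<in>?I. if \<bar>a\<bar> \<le> 1 then f a else 0)"
      by (subst sum.distrib[symmetric]) (auto intro!: sum.cong simp: e_def)
    also have "(\<Sum>a\<in>?I. if \<bar>a\<bar> \<le> 1 then f a else 0) = (\<Sum>a\<in>{-1, 0, 1}. f a)"
      by (rule sum.mono_neutral_cong_right) auto
    also have "\<dots> = 2" by (simp add: f_def)
    finally show ?thesis by simp
  qed
  finally have *: "(\<Sum>d\<in>F. 1 / cmod d ^ 4) \<le> ((\<Sum>a\<in>?I. f a)\<^sup>2 + 2 * ((\<Sum>a\<in>?I. f a) - 2)) / 4"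
    by (simp add: power2_eq_square)
  have s: "(\<Sum>a\<in>?I. f a) \<le> 7 / 2"
    using sum_inverse_squares_int[of K] unfolding f_def
    by (rule order_trans) simp
  moreover have "0 \<le> (\<Sum>a\<in>?I. f a)" by (intro sum_nonneg) (simp add: f_def)
  ultimately have "(\<Sum>a\<in>?I. f a)\<^sup>2 \<le> (7 / 2)\<^sup>2" by (intro power_mono)
  then show ?thesis using * s by (simp add: power2_eq_square)
qed

section \<open>Density of primitive points by a contraction\<close>

lemma summable_nonunits: "(\<lambda>d. 1 / (4 * cmod d ^ 4)) summable_on gaussian_nonunits"
  and infsum_nonunits: "infsum (\<lambda>d. 1 / (4 * cmod d ^ 4)) gaussian_nonunits < 1"
proof -
  have bd: "(\<Sum>d\<in>F. 1 / (4 * cmod d ^ 4)) \<le> 61 / 64" if "finite F" "F \<subseteq> gaussian_nonunits" for F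
  proof -
    have "(\<Sum>d\<in>F. 1 / (4 * cmod d ^ 4)) = (\<Sum>d\<in>F. 1 / cmod d ^ 4) / 4"
      by (simp add: sum_divide_distrib mult.commute)
    then show ?thesis using sum_nonunits_le[OF that] by simp
  qed
  show s: "(\<lambda>d. 1 / (4 * cmod d ^ 4)) summable_on gaussian_nonunits"
    by (rule nonneg_bdd_above_summable_on) (use bd in \<open>auto intro!: bdd_aboveI2[of _ _ "61 / 64"]\<close>)
  have "infsum (\<lambda>d. 1 / (4 * cmod d ^ 4)) gaussian_nonunits \<le> 61 / 64"
    by (rule infsum_le_finite_sums[OF s]) (rule bd)
  then show "infsum (\<lambda>d. 1 / (4 * cmod d ^ 4)) gaussian_nonunits < 1" by simp
qed

lemma summable_small_tail:
  fixes c :: "'a \<Rightarrow> real"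
  assumes s: "c summable_on N" and pos: "\<And>d. d \<in> N \<Longrightarrow> 0 \<le> c d" and e: "e > 0"
  obtains F where "finite F" "F \<subseteq> N" "infsum c N - e < sum c F"
    "\<And>S. finite S \<Longrightarrow> S \<subseteq> N - F \<Longrightarrow> sum c S \<le> e"
proof -
  have "((sum c) \<longlongrightarrow> infsum c N) (finite_subsets_at_top N)"
    using has_sum_infsum[OF s] by (simp add: has_sum_def)
  then have "\<forall>\<^sub>F F in finite_subsets_at_top N. infsum c N - e < sum c F"
    using e by (intro order_tendstoD(1)) auto
  then obtain F where F: "finite F" "F \<subseteq> N" "infsum c N - e < sum c F"
    by (auto simp: eventually_finite_subsets_at_top)
  have "sum c S \<le> e" if S: "finite S" "S \<subseteq> N - F" for S
  proof -
    have "sum c F + sum c S = sum c (F \<union> S)"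
      using F S by (subst sum.union_disjoint) auto
    also have "\<dots> \<le> infsum c N"
      using F S pos by (intro finite_sum_le_infsum[OF s]) auto
    finally show ?thesis using F(3) by linarith
  qed
  with F that show thesis by blast
qed

text \<open>If \<open>\<bar>g\<bar>\<close> is eventually at most \<open>m\<close>, up to an arbitrarily small error, then the equation
  bounds it eventually by \<open>m * infsum c N\<close>, up to such an error: finitely many indices carry
  almost all of the weight, and for them \<open>T / n d\<close> is large together with \<open>T\<close>. Iteration
  starts at \<open>G\<close>.\<close>

lemma contraction_tendsto_0:
  fixes g \<epsilon> :: "real \<Rightarrow> real" and c :: "'a \<Rightarrow> real"
  assumes c: "c summable_on N" "\<And>d. d \<in> N \<Longrightarrow> 0 \<le> c d" "infsum c N < 1"
    and n: "\<And>d. d \<in> N \<Longrightarrow> 0 < n d"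
    and M: "\<And>T. finite (M T)" "\<And>T. M T \<subseteq> N"
    and eq: "\<And>T. T > 0 \<Longrightarrow> g T = \<epsilon> T - (\<Sum>d\<in>M T. c d * g (T / n d))"
    and bdd: "\<And>T. T > 0 \<Longrightarrow> \<bar>g T\<bar> \<le> G"
    and eps: "(\<epsilon> \<longlongrightarrow> 0) at_top"
  shows "(g \<longlongrightarrow> 0) at_top"
proof -
  define \<kappa> where "\<kappa> = infsum c N"
  have k: "0 \<le> \<kappa>" "\<kappa> < 1" using c by (auto simp: \<kappa>_def intro!: infsum_nonneg)
  have G: "0 \<le> G" using bdd[of 1] by linarith
  have *: "\<forall>\<^sub>F T in at_top. \<bar>g T\<bar> \<le> \<kappa> ^ k * G + \<eta>" if "\<eta> > 0" for k \<eta>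
    using that
  proof (induction k arbitrary: \<eta>)
    case 0
    show ?case
      using eventually_gt_at_top[of 0] by eventually_elim (use bdd 0 in force)
  next
    case (Suc k)
    have "\<eta> / 3 > 0" using Suc by simp
    from Suc.IH[OF this] obtain T0 where T0: "\<And>T. T \<ge> T0 \<Longrightarrow> \<bar>g T\<bar> \<le> \<kappa> ^ k * G + \<eta> / 3"
      by (auto simp: eventually_at_top_linorder)
    have "\<eta> / (3 * (G + 1)) > 0" using Suc G by simp
    then obtain F where F: "finite F" "F \<subseteq> N"
      "\<And>S. finite S \<Longrightarrow> S \<subseteq> N - F \<Longrightarrow> sum c S \<le> \<eta> / (3 * (G + 1))"
      using summable_small_tail[OF c(1,2)] by metis
    have "\<forall>\<^sub>F T in at_top. \<forall>d\<in>F. T0 \<le> T / n d"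
    proof (intro eventually_ball_finite[OF F(1)] ballI)
      fix d assume "d \<in> F"
      then have "0 < n d" using F n by auto
      then show "\<forall>\<^sub>F T in at_top. T0 \<le> T / n d"
        using eventually_ge_at_top[of "T0 * n d"] by (simp add: pos_le_divide_eq)
    qed
    moreover have "\<forall>\<^sub>F T in at_top. \<bar>\<epsilon> T\<bar> < \<eta> / 3"
      using tendstoD[OF eps \<open>\<eta> / 3 > 0\<close>] by (simp add: dist_real_def)
    ultimately show ?case using eventually_gt_at_top[of 0]
    proof eventually_elim
      case (elim T)
      let ?b = "\<kappa> ^ k * G + \<eta> / 3"
      have b: "0 \<le> ?b" using k G Suc.prems by simp
      have "\<bar>\<Sum>d\<in>M T. c d * g (T / n d)\<bar> \<le> (\<Sum>d\<in>M T. c d * \<bar>g (T / n d)\<bar>)"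
        using c(2) M(2)[of T] by (intro order_trans[OF sum_abs] sum_mono) (auto simp: abs_mult)
      also have "\<dots> = (\<Sum>d\<in>M T \<inter> F. c d * \<bar>g (T / n d)\<bar>) + (\<Sum>d\<in>M T - F. c d * \<bar>g (T / n d)\<bar>)"
        using sum.Int_Diff[OF M(1)] .
      also have "\<dots> \<le> (\<Sum>d\<in>M T \<inter> F. c d * ?b) + (\<Sum>d\<in>M T - F. c d * G)"
        using elim c(2) M(2)[of T] T0 bdd n
        by (intro add_mono sum_mono mult_left_mono) (auto intro!: divide_pos_pos)
      also have "\<dots> = (\<Sum>d\<in>M T \<inter> F. c d) * ?b + (\<Sum>d\<in>M T - F. c d) * G"
        by (simp add: sum_distrib_right)
      also have "\<dots> \<le> \<kappa> * ?b + \<eta> / (3 * (G + 1)) * G"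
      proof (intro add_mono mult_right_mono b G)
        show "sum c (M T \<inter> F) \<le> \<kappa>"
          unfolding \<kappa>_def using M c F by (intro finite_sum_le_infsum[OF c(1)]) auto
        show "sum c (M T - F) \<le> \<eta> / (3 * (G + 1))"
          using M by (intro F(3)) auto
      qed
      also have "\<eta> / (3 * (G + 1)) * G \<le> \<eta> / 3"
        using G Suc.prems by (simp add: field_simps)
      also have "\<kappa> * ?b \<le> \<kappa> ^ Suc k * G + \<eta> / 3"
        using k Suc.prems mult_right_mono[of \<kappa> 1 "\<eta> / 3"] by (simp add: algebra_simps)
      finally have "\<bar>\<Sum>d\<in>M T. c d * g (T / n d)\<bar> \<le> \<kappa> ^ Suc k * G + \<eta> / 3 + \<eta> / 3" by simp
      then show ?case using eq[of T] elim by linarith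
    qed
  qed
  show ?thesis
  proof (rule tendstoI)
    fix e :: real assume e: "e > 0"
    have "(\<lambda>k. \<kappa> ^ k * G) \<longlonglongrightarrow> 0 * G"
      using k by (intro tendsto_mult LIMSEQ_power_zero tendsto_const) auto
    then have "\<forall>\<^sub>F k in sequentially. \<kappa> ^ k * G < e / 2"
      using e by (intro order_tendstoD(2)) auto
    then obtain k where "\<kappa> ^ k * G < e / 2"
      by (meson eventually_happens trivial_limit_sequentially)
    moreover have "e / 3 > 0" using e by simp
    note *[OF this, of k]
    ultimately show "\<forall>\<^sub>F T in at_top. dist (g T) 0 < e"
      using e by (auto elim!: eventually_mono simp: dist_real_def)
  qed
qed

text \<open>This is \<open>\<Sum> 1 / (4 * \<bar>d\<bar> ^ 4)\<close> over all nonzero Gaussian integers, that is,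
  the Dedekind zeta function of \<open>\<rat>(\<i>)\<close> at \<open>2\<close>.\<close>

definition primitive_constant :: real where
  "primitive_constant = 1 + infsum (\<lambda>d. 1 / (4 * cmod d ^ 4)) gaussian_nonunits"

lemma primitive_constant_pos: "primitive_constant > 0"
proof -
  have "0 \<le> infsum (\<lambda>d. 1 / (4 * cmod d ^ 4)) gaussian_nonunits"
    by (rule infsum_nonneg) simp
  then show ?thesis by (simp add: primitive_constant_def)
qed

text \<open>Let \<open>\<alpha>\<close> and \<open>\<beta>\<close> be the normalised sums over all and over primitive vectors. Separating
  the units in the decomposition over \<open>d\<close> gives
  \<open>\<beta> T = \<alpha> T - (\<Sum>d. \<beta> (T / \<bar>d\<bar>) / (4 * \<bar>d\<bar> ^ 4))\<close>, summed over \<open>\<bar>d\<bar> > 1\<close>.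
  The only possible limit is \<open>lim\<close> below, and \<open>\<beta> - lim\<close> satisfies the hypotheses of the
  contraction lemma.\<close>

theorem primitive_lattice_riemann_sum:
  fixes h :: "complex \<times> complex \<Rightarrow> real"
  assumes h: "h \<in> borel_measurable borel"
    and bdd: "\<And>x. \<bar>h x\<bar> \<le> C" and supp: "\<And>x. norm x > R \<Longrightarrow> h x = 0"
    and cont: "AE x in lborel. isCont h x" and h0: "h 0 = 0"
    and circ: "\<And>u x. cmod u = 1 \<Longrightarrow> h (cscale u x) = h x"
  shows "((\<lambda>T. lattice_sum h primitive T / T ^ 4) \<longlongrightarrow> integral\<^sup>L lborel h / primitive_constant) at_top"
proof -
  define V where "V = integral\<^sup>L lborel h"
  define lim where "lim = V / primitive_constant"
  define \<alpha> where "\<alpha> = (\<lambda>T. lattice_sum h lattice T / T ^ 4)"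
  define \<beta> where "\<beta> = (\<lambda>T. lattice_sum h primitive T / T ^ 4)"
  define c :: "complex \<Rightarrow> real" where "c = (\<lambda>d. 1 / (4 * cmod d ^ 4))"
  define N where "N = gaussian_nonunits"
  (* The support radius is made positive, so that S * T tends to infinity. *)
  define S where "S = max R 1"
  define M where "M = (\<lambda>T. {d \<in> N. cmod d \<le> S * T})"
  define \<kappa> where "\<kappa> = infsum c N"
  have suppS: "\<And>x. norm x > S \<Longrightarrow> h x = 0" using supp by (auto simp: S_def)
  have finM: "finite (M T)" for T
    by (rule finite_subset[OF _ finite_gaussian_ints_cball[of "S * T"]])
       (auto simp: M_def N_def gaussian_nonunits_def)
  have V: "V - lim = \<kappa> * lim"
    using primitive_constant_pos unfolding lim_def \<kappa>_def primitive_constant_def c_def N_def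
    by (simp add: field_simps)
  have \<alpha>: "(\<alpha> \<longlongrightarrow> V) at_top"
    unfolding \<alpha>_def V_def by (rule lattice_riemann_sum[OF h bdd supp cont])
  have b_bd: "\<bar>\<beta> T\<bar> \<le> C * (81 * S ^ 4)" if "T > 0" for T
    unfolding \<beta>_def by (rule primitive_sum_bounded[OF suppS bdd that])
  have step: "\<beta> T = \<alpha> T - (\<Sum>d\<in>M T. c d * \<beta> (T / cmod d))" if T: "T > 0" for T
  proof -
    let ?D = "{d. d \<in> gaussian_ints \<and> d \<noteq> 0 \<and> cmod d \<le> S * T}"
    let ?p = "\<lambda>d. lattice_sum h primitive (T / cmod d)"
    have p: "?p d = 4 * T ^ 4 * (c d * \<beta> (T / cmod d))" if "d \<noteq> 0" for d
      using T that by (simp add: \<beta>_def c_def field_simps power_divide)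
    have eq: "4 * lattice_sum h lattice T = (\<Sum>d\<in>?D. ?p d)"
      by (rule lattice_sum_primitive_decomp[OF suppS h0 circ T])
    (* When S * T < 1 the units exceed the range of d; their contribution vanishes then anyway. *)
    have zero: "lattice_sum h primitive T = 0" if "S * T < 1"
    proof -
      have "h ((1 / T) *\<^sub>R v) = 0" if "v \<in> primitive" for v
      proof (rule suppS)
        have "1 \<le> norm v" using that primitive_subset primitive_nonzero lattice_norm_ge_1 by blast
        then show "S < norm ((1 / T) *\<^sub>R v)" using \<open>S * T < 1\<close> T by (simp add: field_simps)
      qed
      then have "{v \<in> primitive. h ((1 / T) *\<^sub>R v) \<noteq> 0} = {}" by blast
      then show ?thesis unfolding lattice_sum_def by (simp only: sum.empty)
    qed
    have "(\<Sum>d\<in>?D. ?p d) = (\<Sum>d\<in>M T. ?p d) + (if 1 \<le> S * T then (\<Sum>d\<in>gaussian_units. ?p d) else 0)"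
    proof (cases "1 \<le> S * T")
      case True
      have "?D = M T \<union> gaussian_units"
        using True gaussian_ints_norm_ge_1
        by (fastforce simp: M_def N_def gaussian_nonunits_def gaussian_units_def)
      moreover have "M T \<inter> gaussian_units = {}"
        by (auto simp: M_def N_def gaussian_nonunits_def gaussian_units_def)
      moreover have "finite gaussian_units" by (simp add: gaussian_units_eq)
      ultimately show ?thesis
        using True finM by (simp add: sum.union_disjoint)
    next
      case False
      have "?D = M T"
        using False gaussian_ints_norm_ge_1
        by (fastforce simp: M_def N_def gaussian_nonunits_def)
      then show ?thesis using False by simp
    qed
    also have "(\<Sum>d\<in>gaussian_units. ?p d) = (\<Sum>d\<in>gaussian_units. lattice_sum h primitive T)"
      by (rule sum.cong) (auto simp: gaussian_units_def)
    also have "\<dots> = 4 * lattice_sum h primitive T"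
      by (simp add: card_gaussian_units)
    also have "(if 1 \<le> S * T then 4 * lattice_sum h primitive T else 0) = 4 * lattice_sum h primitive T"
      using zero by auto
    also have "(\<Sum>d\<in>M T. ?p d) = 4 * T ^ 4 * (\<Sum>d\<in>M T. c d * \<beta> (T / cmod d))"
      unfolding sum_distrib_left
      by (rule sum.cong[OF refl], rule p) (auto simp: M_def N_def gaussian_nonunits_def)
    finally have "4 * lattice_sum h lattice T
        = 4 * T ^ 4 * (\<Sum>d\<in>M T. c d * \<beta> (T / cmod d)) + 4 * lattice_sum h primitive T"
      using eq by simp
    then show ?thesis unfolding \<alpha>_def using T by (simp add: \<beta>_def field_simps)
  qed
  have sumM: "((\<lambda>T. sum c (M T)) \<longlongrightarrow> \<kappa>) at_top"
  proof (rule tendstoI)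
    fix e :: real assume "e > 0"
    have "c summable_on N" "\<And>d. d \<in> N \<Longrightarrow> 0 \<le> c d"
      using summable_nonunits by (simp_all add: c_def N_def)
    from summable_small_tail[OF this \<open>e > 0\<close>]
    obtain F where F: "finite F" "F \<subseteq> N" "\<kappa> - e < sum c F"
      unfolding \<kappa>_def by metis
    have "\<forall>\<^sub>F T in at_top. \<forall>d\<in>F. cmod d \<le> S * T"
    proof (intro eventually_ball_finite[OF F(1)] ballI)
      fix d
      show "\<forall>\<^sub>F T in at_top. cmod d \<le> S * T"
        using eventually_ge_at_top[of "cmod d / S"]
        by eventually_elim (auto simp: S_def field_simps)
    qed
    then show "\<forall>\<^sub>F T in at_top. dist (sum c (M T)) \<kappa> < e"
    proof eventually_elim
      case (elim T)
      have "sum c F \<le> sum c (M T)"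
        using elim F finM by (intro sum_mono2) (auto simp: M_def c_def)
      moreover have "sum c (M T) \<le> \<kappa>"
        unfolding \<kappa>_def using summable_nonunits finM
        by (intro finite_sum_le_infsum) (auto simp: c_def N_def M_def)
      ultimately show ?case using F(3) \<open>e > 0\<close> by (simp add: dist_real_def)
    qed
  qed
  have "((\<lambda>T. \<beta> T - lim) \<longlongrightarrow> 0) at_top"
  proof (rule contraction_tendsto_0[where N = N and c = c and n = cmod and M = M
        and \<epsilon> = "\<lambda>T. \<alpha> T - lim - sum c (M T) * lim" and G = "C * (81 * S ^ 4) + \<bar>lim\<bar>"])
    show "c summable_on N" "infsum c N < 1"
      using summable_nonunits infsum_nonunits by (simp_all add: c_def N_def)
    show "\<beta> T - lim = \<alpha> T - lim - sum c (M T) * lim - (\<Sum>d\<in>M T. c d * (\<beta> (T / cmod d) - lim))"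
      if "T > 0" for T
      unfolding step[OF that] by (simp add: algebra_simps sum_subtractf sum_distrib_left)
    show "\<bar>\<beta> T - lim\<bar> \<le> C * (81 * S ^ 4) + \<bar>lim\<bar>" if "T > 0" for T
      using b_bd[OF that] by linarith
    have "((\<lambda>T. \<alpha> T - lim - sum c (M T) * lim) \<longlongrightarrow> V - lim - \<kappa> * lim) at_top"
      by (intro tendsto_intros \<alpha> sumM)
    then show "((\<lambda>T. \<alpha> T - lim - sum c (M T) * lim) \<longlongrightarrow> 0) at_top" using V by simp
  qed (use finM in \<open>auto simp: M_def c_def N_def gaussian_nonunits_def\<close>)
  then have "(\<beta> \<longlongrightarrow> lim) at_top" by (simp add: LIM_zero_iff)
  then show ?thesis by (simp add: \<beta>_def lim_def V_def)
qed

section \<open>The gap function on pairs of complex numbers\<close>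

definition lform :: "complex \<Rightarrow> complex \<Rightarrow> complex \<times> complex \<Rightarrow> complex" where
  "lform D g v = D * fst v + g * snd v"

definition gap_value :: "complex \<Rightarrow> complex \<Rightarrow> complex \<times> complex \<Rightarrow> real" where
  "gap_value D g v = cmod D / (cmod (snd v) * cmod (lform D g v))"

definition gap_fun :: "complex \<times> complex \<Rightarrow> real" where
  "gap_fun v = Inf {gap_value D g v | D g. D \<in> gaussian_ints - {0} \<and> g \<in> gaussian_ints
     \<and> lform D g v \<noteq> 0 \<and> cmod (lform D g v) \<le> 1}"

text \<open>Where \<open>disc_denom v\<close> holds, this is the relation \<open>gap_fun v \<le> c\<close>, put as a countable
  union of closed conditions.\<close>

definition gap_reach :: "real \<Rightarrow> complex \<times> complex \<Rightarrow> bool" where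
  "gap_reach c v \<longleftrightarrow> (\<exists>D\<in>gaussian_ints - {0}. \<exists>g\<in>gaussian_ints.
     cmod (lform D g v) \<le> 1 \<and> cmod D \<le> c * (cmod (snd v) * cmod (lform D g v)))"

definition disc_denom :: "complex \<times> complex \<Rightarrow> bool" where
  "disc_denom v \<longleftrightarrow> snd v \<noteq> 0 \<and> cmod (snd v) \<le> 1"

lemma gap_value_circle:
  assumes u: "cmod u = 1"
  shows "cmod (lform D g (cscale u v)) = cmod (lform D g v)"
    "gap_value D g (cscale u v) = gap_value D g v"
proof -
  have "lform D g (cscale u v) = u * lform D g v"
    by (simp add: lform_def cscale_def algebra_simps)
  then show 1: "cmod (lform D g (cscale u v)) = cmod (lform D g v)" using u by (simp add: norm_mult)
  then show "gap_value D g (cscale u v) = gap_value D g v"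
    using u by (simp add: gap_value_def norm_mult cscale_def)
qed

lemma gap_fun_circle:
  assumes "cmod u = 1" shows "gap_fun (cscale u v) = gap_fun v"
proof -
  have "lform D g (cscale u v) = 0 \<longleftrightarrow> lform D g v = 0" for D g
    using gap_value_circle(1)[OF assms, of D g v] norm_eq_zero by metis
  then show ?thesis unfolding gap_fun_def by (simp add: gap_value_circle[OF assms])
qed

lemma relevant_pairs_finite:
  assumes "r > 0"
  shows "finite {(D, g). D \<in> gaussian_ints \<and> g \<in> gaussian_ints \<and> cmod D \<le> c \<and> cmod g \<le> (1 + c * Z) / r}"
  by (rule finite_subset[of _ "{g \<in> gaussian_ints. cmod g \<le> c} \<times> {g \<in> gaussian_ints. cmod g \<le> (1 + c * Z) / r}"])
     (auto simp: finite_gaussian_ints_cball)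

text \<open>Locally uniform in \<open>v\<close>: near a point with nonzero second coordinate, only finitely many
  pairs \<open>(D, g)\<close> can produce a value at most \<open>c\<close>.\<close>

lemma relevant_pairs_bound:
  assumes v: "disc_denom v" and r: "0 < r" "r \<le> cmod (snd v)" "cmod (fst v) \<le> Z"
    and L: "cmod (lform D g v) \<le> 1" and D: "cmod D \<le> c * (cmod (snd v) * cmod (lform D g v))"
    and c: "0 \<le> c"
  shows "cmod D \<le> c" "cmod g \<le> (1 + c * Z) / r"
proof -
  have "cmod (snd v) * cmod (lform D g v) \<le> 1 * 1"
    using v L by (intro mult_mono) (auto simp: disc_denom_def)
  then have "c * (cmod (snd v) * cmod (lform D g v)) \<le> c * 1"
    using c by (intro mult_left_mono) auto
  then show Dc: "cmod D \<le> c" using D by simp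
  have "g * snd v = lform D g v - D * fst v" by (simp add: lform_def)
  then have "cmod g * cmod (snd v) \<le> cmod (lform D g v) + cmod D * cmod (fst v)"
    by (metis norm_mult norm_triangle_ineq4)
  also have "\<dots> \<le> 1 + c * Z"
    using L Dc r c by (intro add_mono mult_mono) auto
  finally have "cmod g * cmod (snd v) \<le> 1 + c * Z" .
  moreover have "cmod g * r \<le> cmod g * cmod (snd v)" using r by (intro mult_left_mono) auto
  ultimately show "cmod g \<le> (1 + c * Z) / r" using r by (simp add: pos_le_divide_eq)
qed

lemma gap_value_le_iff:
  assumes "disc_denom v" "lform D g v \<noteq> 0"
  shows "gap_value D g v \<le> c \<longleftrightarrow> cmod D \<le> c * (cmod (snd v) * cmod (lform D g v))"
  using assms by (simp add: gap_value_def disc_denom_def pos_divide_le_eq)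

text \<open>Write \<open>lform 1 g v = snd v * t\<close> with \<open>t\<close> in \<open>fst v / snd v + \<int>[\<i>]\<close>. The
  representative \<open>t\<close> nearest to \<open>0\<close> has modulus at most \<open>1\<close>. If its modulus is below \<open>1 / 2\<close>,
  adding the unit that points most nearly in the opposite direction gives one of modulus between
  \<open>1 / 2\<close> and \<open>1\<close>.\<close>

lemma half_denom_lform_exists:
  assumes v: "disc_denom v"
  obtains g where "g \<in> gaussian_ints" "cmod (lform 1 g v) \<le> 1" "cmod (snd v) / 2 \<le> cmod (lform 1 g v)"
proof -
  define w where "w = snd v"
  have w: "w \<noteq> 0" "cmod w \<le> 1" using v by (auto simp: disc_denom_def w_def)
  obtain g0 where g0: "g0 \<in> gaussian_ints" "(cmod (- (fst v / w) - g0))\<^sup>2 \<le> 1 / 2"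
    by (rule nearest_gaussian_int)
  define t where "t = fst v / w + g0"
  have "cmod t = cmod (- (fst v / w) - g0)"
    unfolding t_def by (metis minus_diff_eq minus_minus norm_minus_cancel diff_minus_eq_add minus_add_distrib uminus_add_conv_diff)
  then have t2: "(cmod t)\<^sup>2 \<le> 1 / 2" using g0 by simp
  then have t1: "cmod t \<le> 1" using abs_square_le_1[of "cmod t"] by simp
  have lf: "lform 1 (g0 + u) v = w * (t + u)" for u
    using w(1) by (simp add: lform_def t_def w_def field_simps)
  show thesis
  proof (cases "1 / 2 \<le> cmod t")
    case True
    show thesis
    proof (rule that[of g0])
      have "cmod w * cmod t \<le> 1 * 1" using w t1 by (intro mult_mono) auto
      then show "cmod (lform 1 g0 v) \<le> 1" using lf[of 0] by (simp add: norm_mult)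
      have "cmod w * (1 / 2) \<le> cmod w * cmod t" using True by (intro mult_left_mono) auto
      then show "cmod (snd v) / 2 \<le> cmod (lform 1 g0 v)"
        using lf[of 0] by (simp add: norm_mult w_def)
    qed (rule g0)
  next
    case False
    define x y where "x = Re t" and "y = Im t"
    have "\<exists>u\<in>gaussian_units. (cmod (t + u))\<^sup>2 \<le> 1"
    proof -
      (* |t + u|^2 <= 1 says x^2 + y^2 <= -2 Re (t * cnj u), which some unit u achieves. *)
      have key: "x\<^sup>2 + y\<^sup>2 \<le> 2 * max \<bar>x\<bar> \<bar>y\<bar>"
      proof -
        have "\<bar>x\<bar> \<le> 1" "\<bar>y\<bar> \<le> 1" using t1 abs_Re_le_cmod[of t] abs_Im_le_cmod[of t] by (auto simp: x_def y_def)
        then have "\<bar>x\<bar> * \<bar>x\<bar> \<le> \<bar>x\<bar> * 1" "\<bar>y\<bar> * \<bar>y\<bar> \<le> \<bar>y\<bar> * 1" by (intro mult_left_mono; simp)+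
        then have "x\<^sup>2 \<le> \<bar>x\<bar>" "y\<^sup>2 \<le> \<bar>y\<bar>" by (simp_all add: power2_eq_square)
        then show ?thesis by linarith
      qed
      have n: "(cmod (t + 1))\<^sup>2 = x\<^sup>2 + y\<^sup>2 + 2 * x + 1" "(cmod (t - 1))\<^sup>2 = x\<^sup>2 + y\<^sup>2 - 2 * x + 1"
        "(cmod (t + \<i>))\<^sup>2 = x\<^sup>2 + y\<^sup>2 + 2 * y + 1" "(cmod (t - \<i>))\<^sup>2 = x\<^sup>2 + y\<^sup>2 - 2 * y + 1"
        unfolding cmod_power2 x_def y_def by (simp_all add: power2_eq_square algebra_simps)
      consider "x\<^sup>2 + y\<^sup>2 \<le> 2 * x" | "x\<^sup>2 + y\<^sup>2 \<le> - 2 * x" | "x\<^sup>2 + y\<^sup>2 \<le> 2 * y" | "x\<^sup>2 + y\<^sup>2 \<le> - 2 * y"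
        using key by linarith
      then show ?thesis
        using n by cases (auto simp: gaussian_units_eq)
    qed
    then obtain u where u: "u \<in> gaussian_units" "(cmod (t + u))\<^sup>2 \<le> 1" by blast
    have tu: "cmod (t + u) \<le> 1" using u(2) abs_square_le_1[of "cmod (t + u)"] by simp
    have "cmod u = 1" using u by (simp add: gaussian_units_def)
    then have tu2: "1 / 2 \<le> cmod (t + u)"
      using norm_triangle_ineq4[of "t + u" t] False by simp
    show thesis
    proof (rule that[of "g0 + u"])
      show "g0 + u \<in> gaussian_ints" using g0 u by (simp add: gaussian_units_def gaussian_ints_add)
      have "cmod w * cmod (t + u) \<le> 1 * 1" using w tu by (intro mult_mono) auto
      then show "cmod (lform 1 (g0 + u) v) \<le> 1" unfolding lf by (simp add: norm_mult)
      have "cmod w * (1 / 2) \<le> cmod w * cmod (t + u)" using tu2 by (intro mult_left_mono) auto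
      then show "cmod (snd v) / 2 \<le> cmod (lform 1 (g0 + u) v)"
        unfolding lf by (simp add: norm_mult w_def)
    qed
  qed
qed

text \<open>There is some admissible value, and only finitely many admissible values lie below it.\<close>

lemma gap_fun_attained:
  assumes v: "disc_denom v"
  obtains D g where "D \<in> gaussian_ints - {0}" "g \<in> gaussian_ints" "lform D g v \<noteq> 0"
    "cmod (lform D g v) \<le> 1" "gap_fun v = gap_value D g v"
proof -
  define A where "A = {gap_value D g v | D g. D \<in> gaussian_ints - {0} \<and> g \<in> gaussian_ints
     \<and> lform D g v \<noteq> 0 \<and> cmod (lform D g v) \<le> 1}"
  obtain g0 where g0: "g0 \<in> gaussian_ints" "cmod (lform 1 g0 v) \<le> 1" "cmod (snd v) / 2 \<le> cmod (lform 1 g0 v)"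
    using half_denom_lform_exists[OF v] .
  define c where "c = gap_value 1 g0 v"
  have c0: "0 \<le> c" by (simp add: c_def gap_value_def)
  have cA: "c \<in> A"
    using g0 v unfolding A_def c_def disc_denom_def
    by (intro CollectI exI[of _ 1] exI[of _ g0]) auto
  let ?P = "{(D, g). D \<in> gaussian_ints \<and> g \<in> gaussian_ints \<and> cmod D \<le> c \<and> cmod g \<le> (1 + c * cmod (fst v)) / cmod (snd v)}"
  have "{x \<in> A. x \<le> c} \<subseteq> (\<lambda>(D, g). gap_value D g v) ` ?P"
  proof
    fix x assume "x \<in> {x \<in> A. x \<le> c}"
    then obtain D g where x: "x = gap_value D g v" "D \<in> gaussian_ints" "g \<in> gaussian_ints"
      "lform D g v \<noteq> 0" "cmod (lform D g v) \<le> 1" "gap_value D g v \<le> c"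
      unfolding A_def by blast
    then have "cmod D \<le> c * (cmod (snd v) * cmod (lform D g v))"
      using gap_value_le_iff[OF v] by blast
    from relevant_pairs_bound[OF v _ _ _ x(5) this c0, of "cmod (snd v)" "cmod (fst v)"]
    have "cmod D \<le> c" "cmod g \<le> (1 + c * cmod (fst v)) / cmod (snd v)"
      using v by (auto simp: disc_denom_def)
    then show "x \<in> (\<lambda>(D, g). gap_value D g v) ` ?P"
      using x by (intro image_eqI[of _ _ "(D, g)"]) auto
  qed
  moreover have "finite ?P" using v by (intro relevant_pairs_finite) (auto simp: disc_denom_def)
  ultimately have fin: "finite {x \<in> A. x \<le> c}" by (rule finite_surj[rotated])
  have ne: "{x \<in> A. x \<le> c} \<noteq> {}" using cA by auto
  define m where "m = Min {x \<in> A. x \<le> c}"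
  have m: "m \<in> A" using Min_in[OF fin ne] by (simp add: m_def)
  have mle: "m \<le> x" if "x \<in> A" for x
  proof (cases "x \<le> c")
    case True
    then show ?thesis using that fin by (simp add: m_def)
  next
    case False
    have "m \<le> c" using Min_in[OF fin ne] by (simp add: m_def)
    then show ?thesis using False by simp
  qed
  have "Inf A = m" using m mle by (intro cInf_eq_minimum) auto
  then have "gap_fun v = m" by (simp add: gap_fun_def A_def)
  with m that show thesis unfolding A_def by blast
qed

lemma gap_fun_le:
  assumes "D \<in> gaussian_ints - {0}" "g \<in> gaussian_ints" "lform D g v \<noteq> 0" "cmod (lform D g v) \<le> 1"
  shows "gap_fun v \<le> gap_value D g v"
  unfolding gap_fun_def
proof (rule cInf_lower)
  show "bdd_below {gap_value D g v | D g. D \<in> gaussian_ints - {0} \<and> g \<in> gaussian_ints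
     \<and> lform D g v \<noteq> 0 \<and> cmod (lform D g v) \<le> 1}"
    by (rule bdd_belowI[of _ 0]) (auto simp: gap_value_def)
qed (use assms in blast)

lemma gap_fun_le_iff:
  assumes v: "disc_denom v"
  shows "gap_fun v \<le> c \<longleftrightarrow> gap_reach c v"
proof
  assume c: "gap_fun v \<le> c"
  obtain D g where Dg: "D \<in> gaussian_ints - {0}" "g \<in> gaussian_ints" "lform D g v \<noteq> 0"
    "cmod (lform D g v) \<le> 1" "gap_fun v = gap_value D g v"
    using gap_fun_attained[OF v] .
  then have "cmod D \<le> c * (cmod (snd v) * cmod (lform D g v))"
    using gap_value_le_iff[OF v Dg(3)] c by simp
  then show "gap_reach c v" unfolding gap_reach_def using Dg by blast
next
  assume "gap_reach c v"
  then obtain D g where Dg: "D \<in> gaussian_ints - {0}" "g \<in> gaussian_ints"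
    "cmod (lform D g v) \<le> 1" "cmod D \<le> c * (cmod (snd v) * cmod (lform D g v))"
    unfolding gap_reach_def by blast
  have "0 < cmod D" using Dg(1) by auto
  then have "lform D g v \<noteq> 0" using Dg(4) by auto
  then show "gap_fun v \<le> c"
    using gap_fun_le[of D g v] gap_value_le_iff[OF v, of D g c] Dg by simp
qed

text \<open>Here \<open>\<bar>D\<bar> \<ge> 1\<close> and the linear form has modulus at most \<open>1\<close>.\<close>

lemma gap_fun_lower:
  assumes v: "disc_denom v" shows "1 / cmod (snd v) \<le> gap_fun v"
proof -
  obtain D g where Dg: "D \<in> gaussian_ints - {0}" "g \<in> gaussian_ints" "lform D g v \<noteq> 0"
    "cmod (lform D g v) \<le> 1" "gap_fun v = gap_value D g v"
    using gap_fun_attained[OF v] .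
  have "1 \<le> cmod D" using Dg(1) gaussian_ints_norm_ge_1 by blast
  moreover have "cmod (snd v) * cmod (lform D g v) \<le> cmod (snd v) * 1"
    using Dg by (intro mult_left_mono) auto
  ultimately show ?thesis unfolding Dg(5) gap_value_def
    using v Dg(3) by (intro frac_le) (auto simp: disc_denom_def)
qed

lemma gap_fun_ge_1:
  assumes v: "disc_denom v" shows "1 \<le> gap_fun v"
proof -
  have "1 \<le> 1 / cmod (snd v)" using v by (simp add: disc_denom_def)
  then show ?thesis using gap_fun_lower[OF v] by linarith
qed

lemma gap_fun_upper:
  assumes v: "disc_denom v" shows "gap_fun v \<le> 2 / (cmod (snd v))\<^sup>2"
proof -
  obtain g where g: "g \<in> gaussian_ints" "cmod (lform 1 g v) \<le> 1" "cmod (snd v) / 2 \<le> cmod (lform 1 g v)"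
    using half_denom_lform_exists[OF v] .
  have w: "0 < cmod (snd v)" using v by (simp add: disc_denom_def)
  have "gap_fun v \<le> gap_value 1 g v" using g w by (intro gap_fun_le) auto
  also have "\<dots> \<le> 1 / (cmod (snd v) * (cmod (snd v) / 2))"
    unfolding gap_value_def using g w by (intro frac_le mult_left_mono) auto
  finally show ?thesis by (simp add: power2_eq_square)
qed

text \<open>The points \<open>fst v + g * snd v\<close> form a translated square lattice of mesh \<open>\<bar>snd v\<bar>\<close>.
  One of them is within \<open>\<bar>snd v\<bar>\<close> of the real point \<open>1 - \<bar>snd v\<bar>\<close>, and so lies in the unit
  disc close to its boundary.\<close>

lemma gap_fun_upper_small:
  assumes v: "disc_denom v" and small: "cmod (snd v) < 1 / 2"
  shows "gap_fun v \<le> 1 / (cmod (snd v) * (1 - 2 * cmod (snd v)))"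
proof -
  define w where "w = snd v"
  have w: "w \<noteq> 0" "cmod w < 1 / 2" using v small by (auto simp: disc_denom_def w_def)
  (* A target point whose |w|-neighbourhood lies in the closed unit disc and outside radius 1 - 2 |w|. *)
  define p where "p = complex_of_real (1 - cmod w)"
  have p: "cmod p = 1 - cmod w" unfolding p_def norm_of_real using w by simp
  obtain g where g: "g \<in> gaussian_ints" "(cmod ((p - fst v) / w - g))\<^sup>2 \<le> 1 / 2"
    by (rule nearest_gaussian_int)
  then have "cmod ((p - fst v) / w - g) \<le> 1"
    using abs_square_le_1[of "cmod ((p - fst v) / w - g)"] by simp
  then have "cmod w * cmod ((p - fst v) / w - g) \<le> cmod w * 1" by (intro mult_left_mono) auto
  moreover have "w * ((p - fst v) / w - g) = p - lform 1 g v"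
    using w by (simp add: lform_def w_def field_simps)
  ultimately have "cmod (p - lform 1 g v) \<le> cmod w" by (metis norm_mult mult.right_neutral)
  then have L: "cmod (lform 1 g v) \<le> 1" "1 - 2 * cmod w \<le> cmod (lform 1 g v)"
    using norm_triangle_ineq2[of "lform 1 g v" p] norm_triangle_ineq2[of p "lform 1 g v"] p
    by (auto simp: norm_minus_commute)
  then have "lform 1 g v \<noteq> 0" using w by auto
  then have "gap_fun v \<le> gap_value 1 g v" using g L by (intro gap_fun_le) auto
  also have "\<dots> \<le> 1 / (cmod w * (1 - 2 * cmod w))"
    unfolding gap_value_def w_def[symmetric] using L w
    by (simp only: norm_one) (intro frac_le mult_left_mono mult_pos_pos, auto)
  finally show ?thesis by (simp add: w_def)
qed

section \<open>Regularity of the gap function\<close>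

definition farey_cone :: "(complex \<times> complex) set" where
  "farey_cone = {v. disc_denom v \<and> fst v / snd v \<in> unit_square}"

lemma farey_cone_denom: "v \<in> farey_cone \<Longrightarrow> disc_denom v"
  by (simp add: farey_cone_def)

text \<open>Almost every point is regular. The excluded points are those on the boundary of an image
  of the cone under a shear \<open>(z, w) \<mapsto> (z + g * w, w)\<close>, and those where a pair \<open>(D, g)\<close>
  may enter or leave the constraint that defines \<open>gap_fun\<close>.\<close>

definition regular_points :: "(complex \<times> complex) set" where
  "regular_points = {v. snd v \<noteq> 0 \<and> cmod (snd v) \<noteq> 1
     \<and> Re (fst v / snd v) \<notin> \<int> \<and> Im (fst v / snd v) \<notin> \<int>
     \<and> (\<forall>D\<in>gaussian_ints - {0}. \<forall>g\<in>gaussian_ints. cmod (lform D g v) \<noteq> 1)}"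

lemma pair_borel_measurable [measurable]:
  "(fst :: complex \<times> complex \<Rightarrow> complex) \<in> borel_measurable borel"
  "(snd :: complex \<times> complex \<Rightarrow> complex) \<in> borel_measurable borel"
  by (auto intro!: borel_measurable_continuous_onI continuous_intros)

lemma lform_measurable [measurable]: "lform D g \<in> borel_measurable borel"
  unfolding lform_def by measurable

lemma gap_value_measurable [measurable]: "gap_value D g \<in> borel_measurable borel"
  unfolding gap_value_def by measurable

lemma farey_cone_borel [measurable]: "farey_cone \<in> sets borel"
proof -
  have "(\<lambda>v. fst v / snd v) -` unit_square \<in> sets (borel :: (complex \<times> complex) measure)"
    by (rule measurable_sets_borel[OF _ unit_square_borel]) measurable
  moreover have "{v. disc_denom v} \<in> sets borel" unfolding disc_denom_def by measurable
  ultimately have "{v. disc_denom v} \<inter> (\<lambda>v. fst v / snd v) -` unit_square \<in> sets borel"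
    by (rule sets.Int[rotated])
  moreover have "farey_cone = {v. disc_denom v} \<inter> (\<lambda>v. fst v / snd v) -` unit_square"
    by (auto simp: farey_cone_def)
  ultimately show ?thesis by metis
qed

lemma gap_reach_borel [measurable]: "{v. gap_reach c v} \<in> sets borel"
proof -
  have "{v. gap_reach c v} = (\<Union>D\<in>gaussian_ints - {0}. \<Union>g\<in>gaussian_ints.
     {v. cmod (lform D g v) \<le> 1 \<and> cmod D \<le> c * (cmod (snd v) * cmod (lform D g v))})"
    by (auto simp: gap_reach_def)
  also have "\<dots> \<in> sets borel"
    using countable_gaussian_ints
    by (intro sets.countable_UN' countable_Diff image_subsetI) measurable
  finally show ?thesis .
qed

text \<open>Extension by \<open>0\<close> outside the cone, to have a function that is Borel and nonnegative
  everywhere.\<close>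

definition cone_gap :: "complex \<times> complex \<Rightarrow> real" where
  "cone_gap v = (if v \<in> farey_cone then gap_fun v else 0)"

lemma cone_gap_measurable [measurable]: "cone_gap \<in> borel_measurable borel"
proof (rule borel_measurableI_le)
  fix c
  have "{v. cone_gap v \<le> c} = (farey_cone \<inter> {v. gap_reach c v}) \<union> (if 0 \<le> c then - farey_cone else {})"
    using gap_fun_le_iff[OF farey_cone_denom] by (auto simp: cone_gap_def)
  also have "\<dots> \<in> sets borel"
    using farey_cone_borel gap_reach_borel[of c] by (auto intro: borel_comp)
  finally show "{v \<in> space borel. cone_gap v \<le> c} \<in> sets borel" by simp
qed

lemma gap_value_scale:
  assumes "0 < t" shows "gap_value D g (t *\<^sub>R v) = t powr (-2) * gap_value D g v"
proof -
  have "lform D g (t *\<^sub>R v) = t *\<^sub>R lform D g v"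
    by (simp add: lform_def algebra_simps)
  then show ?thesis using assms
    by (simp add: gap_value_def powr_minus powr_numeral power2_eq_square field_simps)
qed

lemma gap_value_null:
  assumes "N \<in> null_sets lborel"
  shows "{v. gap_value D g v \<in> N \<and> gap_value D g v \<noteq> 0} \<in> null_sets lborel"
  by (rule null_sets_homogeneous_vimage[of _ "-2"]) (auto simp: gap_value_scale assms)

text \<open>At each point of the cone, \<open>gap_fun\<close> agrees with one of countably many homogeneous
  functions.\<close>

lemma cone_gap_null:
  assumes N: "N \<in> null_sets lborel"
  shows "AE v in lborel. \<not> (v \<in> farey_cone \<and> cone_gap v \<in> N)"
proof -
  have "(\<Union>D\<in>gaussian_ints. \<Union>g\<in>gaussian_ints. {v. gap_value D g v \<in> N \<and> gap_value D g v \<noteq> 0})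
      \<in> null_sets lborel"
    by (intro null_sets_UN' countable_gaussian_ints gap_value_null N)
  then show ?thesis
  proof (rule AE_I', intro subsetI)
    fix v assume "v \<in> {v \<in> space lborel. \<not> \<not> (v \<in> farey_cone \<and> cone_gap v \<in> N)}"
    then have v: "v \<in> farey_cone" "gap_fun v \<in> N" by (auto simp: cone_gap_def)
    obtain D g where Dg: "D \<in> gaussian_ints - {0}" "g \<in> gaussian_ints" "gap_fun v = gap_value D g v"
      using gap_fun_attained[OF farey_cone_denom[OF v(1)]] .
    moreover have "gap_fun v \<noteq> 0" using gap_fun_ge_1[OF farey_cone_denom[OF v(1)]] by simp
    ultimately show "v \<in> (\<Union>D\<in>gaussian_ints. \<Union>g\<in>gaussian_ints.
        {v. gap_value D g v \<in> N \<and> gap_value D g v \<noteq> 0})"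
      using v by auto
  qed
qed

lemma AE_regular: "AE v in lborel. v \<in> regular_points"
proof -
  have sing: "{1 :: real} \<in> null_sets lborel" by (simp add: null_sets_def)
  have norm1: "AE v :: complex \<times> complex in lborel. cmod (snd v) \<noteq> 1"
  proof -
    have "{v :: complex \<times> complex. cmod (snd v) \<in> {1} \<and> cmod (snd v) \<noteq> 0} \<in> null_sets lborel"
      by (rule null_sets_homogeneous_vimage[of _ 1]) (auto simp: sing)
    then show ?thesis by (rule AE_I') auto
  qed
  have lf: "AE v in lborel. cmod (lform D g v) \<noteq> 1" for D g
  proof -
    have "lform D g (t *\<^sub>R v) = t *\<^sub>R lform D g v" for t v
      by (simp add: lform_def algebra_simps)
    then have "{v. cmod (lform D g v) \<in> {1} \<and> cmod (lform D g v) \<noteq> 0} \<in> null_sets lborel"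
      by (intro null_sets_homogeneous_vimage[of _ 1]) (auto simp: sing)
    then show ?thesis by (rule AE_I') auto
  qed
  have "AE v in lborel. \<forall>D\<in>gaussian_ints - {0}. \<forall>g\<in>gaussian_ints. cmod (lform D g v) \<noteq> 1"
    using lf countable_gaussian_ints by (simp add: AE_ball_countable)
  then show ?thesis
    using norm1 AE_snd_nonzero AE_ratio_notin[OF gaussian_grid_null]
    by eventually_elim (auto simp: regular_points_def)
qed

text \<open>Regular points avoid the boundary of the cone.\<close>

lemma eventually_cone_iff:
  assumes v: "v \<in> regular_points"
  shows "\<forall>\<^sub>F x in nhds v. x \<in> farey_cone \<longleftrightarrow> v \<in> farey_cone"
proof -
  let ?t = "\<lambda>x :: complex \<times> complex. fst x / snd x"
  let ?n = "\<lambda>x :: complex \<times> complex. cmod (snd x)"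
  have w: "snd v \<noteq> 0" "?n v \<noteq> 1" "Re (?t v) \<notin> \<int>" "Im (?t v) \<notin> \<int>"
    using v by (auto simp: regular_points_def)
  have lim [tendsto_intros]: "(?t \<longlongrightarrow> ?t v) (nhds v)" "(snd \<longlongrightarrow> snd v) (nhds v)"
    using w(1) by (auto intro!: tendsto_intros tendsto_fst tendsto_snd filterlim_ident)
  have re: "\<forall>\<^sub>F x in nhds v. \<lfloor>Re (?t x)\<rfloor> = \<lfloor>Re (?t v)\<rfloor>"
    by (rule eventually_floor_eq[OF tendsto_Re[OF lim(1)] w(3)])
  have im: "\<forall>\<^sub>F x in nhds v. \<lfloor>Im (?t x)\<rfloor> = \<lfloor>Im (?t v)\<rfloor>"
    by (rule eventually_floor_eq[OF tendsto_Im[OF lim(1)] w(4)])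
  have nlim: "(?n \<longlongrightarrow> ?n v) (nhds v)" by (intro tendsto_intros)
  have nz: "\<forall>\<^sub>F x in nhds v. 0 < ?n x" using w(1) by (intro order_tendstoD(1)[OF nlim]) simp
  have n1: "\<forall>\<^sub>F x in nhds v. ?n x \<le> 1 \<longleftrightarrow> ?n v \<le> 1"
  proof (cases "?n v \<le> 1")
    case True
    then have "\<forall>\<^sub>F x in nhds v. ?n x < 1" using w(2) by (intro order_tendstoD(2)[OF nlim]) simp
    then show ?thesis by eventually_elim (use True in simp)
  next
    case False
    then have "\<forall>\<^sub>F x in nhds v. 1 < ?n x" by (intro order_tendstoD(1)[OF nlim]) simp
    then show ?thesis by eventually_elim (use False in simp)
  qed
  have usq: "z \<in> unit_square \<longleftrightarrow> \<lfloor>Re z\<rfloor> = 0 \<and> \<lfloor>Im z\<rfloor> = 0" for z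
    by (auto simp: unit_square_def floor_eq_iff)
  show ?thesis
    using re im nz n1 by eventually_elim (use w(1) in \<open>auto simp: farey_cone_def disc_denom_def usq\<close>)
qed

text \<open>Being at most \<open>c\<close> is a closed condition for each pair \<open>(D, g)\<close>, and only finitely many
  pairs matter near \<open>v\<close>.\<close>

lemma gap_fun_lower_semicont:
  assumes v: "disc_denom v" and v1: "cmod (snd v) < 1" and c: "c < gap_fun v"
  shows "\<forall>\<^sub>F x in nhds v. c < gap_fun x"
proof -
  have lim [tendsto_intros]: "(fst \<longlongrightarrow> fst v) (nhds v)" "(snd \<longlongrightarrow> snd v) (nhds v)"
    by (auto intro!: tendsto_fst tendsto_snd filterlim_ident)
  define c' where "c' = max c 0"
  have c': "0 \<le> c'" "c' < gap_fun v" "c \<le> c'" using c gap_fun_ge_1[OF v] by (auto simp: c'_def)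
  define r where "r = cmod (snd v) / 2"
  define Z where "Z = cmod (fst v) + 1"
  have r: "0 < r" "r < cmod (snd v)" using v by (auto simp: r_def disc_denom_def)
  let ?P = "{(D, g). D \<in> gaussian_ints \<and> g \<in> gaussian_ints \<and> cmod D \<le> c' \<and> cmod g \<le> (1 + c' * Z) / r}"
  let ?bad = "\<lambda>D g x. cmod (lform D g x) \<le> 1 \<and> cmod D \<le> c' * (cmod (snd x) * cmod (lform D g x))"
  have llim [tendsto_intros]: "(lform D g \<longlongrightarrow> lform D g v) (nhds v)" for D g
    unfolding lform_def by (intro tendsto_intros)
  have "\<forall>\<^sub>F x in nhds v. \<forall>p\<in>?P. fst p \<noteq> 0 \<longrightarrow> \<not> ?bad (fst p) (snd p) x"
  proof (intro eventually_ball_finite relevant_pairs_finite r ballI)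
    fix p assume p: "p \<in> ?P"
    obtain D g where Dg: "p = (D, g)" "D \<in> gaussian_ints" "g \<in> gaussian_ints" using p by blast
    show "\<forall>\<^sub>F x in nhds v. fst p \<noteq> 0 \<longrightarrow> \<not> ?bad (fst p) (snd p) x"
    proof (cases "D = 0")
      case False
      have "\<not> gap_reach c' v" using gap_fun_le_iff[OF v, of c'] c' by simp
      then consider "1 < cmod (lform D g v)" | "c' * (cmod (snd v) * cmod (lform D g v)) < cmod D"
        using Dg False unfolding gap_reach_def by force
      then show ?thesis
      proof cases
        case 1
        have "((\<lambda>x. cmod (lform D g x)) \<longlongrightarrow> cmod (lform D g v)) (nhds v)" by (intro tendsto_intros)
        from order_tendstoD(1)[OF this 1] show ?thesis by eventually_elim (simp add: Dg)
      next
        case 2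
        have "((\<lambda>x. c' * (cmod (snd x) * cmod (lform D g x))) \<longlongrightarrow> c' * (cmod (snd v) * cmod (lform D g v))) (nhds v)"
          by (intro tendsto_intros)
        from order_tendstoD(2)[OF this 2] show ?thesis by eventually_elim (simp add: Dg)
      qed
    qed (simp add: Dg)
  qed
  moreover have "\<forall>\<^sub>F x in nhds v. r < cmod (snd x)"
    by (rule order_tendstoD(1)[OF _ r(2)]) (intro tendsto_intros)
  moreover have "\<forall>\<^sub>F x in nhds v. cmod (snd x) < 1"
    by (rule order_tendstoD(2)[OF _ v1]) (intro tendsto_intros)
  moreover have "\<forall>\<^sub>F x in nhds v. cmod (fst x) < Z"
    by (rule order_tendstoD(2)[of _ "cmod (fst v)"]) (auto intro!: tendsto_intros simp: Z_def)
  ultimately show ?thesis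
  proof eventually_elim
    case (elim x)
    have x: "disc_denom x" using elim r by (auto simp: disc_denom_def)
    have "\<not> gap_reach c' x"
    proof
      assume "gap_reach c' x"
      then obtain D g where Dg: "D \<in> gaussian_ints - {0}" "g \<in> gaussian_ints"
        "cmod (lform D g x) \<le> 1" "cmod D \<le> c' * (cmod (snd x) * cmod (lform D g x))"
        unfolding gap_reach_def by blast
      then have "(D, g) \<in> ?P"
        using relevant_pairs_bound[OF x r(1) _ _ Dg(3,4) c'(1), of Z] elim by auto
      then show False using elim(1) Dg by force
    qed
    then have "c' < gap_fun x" using gap_fun_le_iff[OF x, of c'] by simp
    then show ?case using c' by simp
  qed
qed

text \<open>A minimising pair stays admissible near \<open>v\<close>, because its linear form has modulus
  strictly below \<open>1\<close> at a regular point.\<close>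

lemma gap_fun_upper_semicont:
  assumes v: "v \<in> regular_points" "disc_denom v" and c: "gap_fun v < c"
  shows "\<forall>\<^sub>F x in nhds v. gap_fun x < c"
proof -
  have lim [tendsto_intros]: "(fst \<longlongrightarrow> fst v) (nhds v)" "(snd \<longlongrightarrow> snd v) (nhds v)"
    by (auto intro!: tendsto_fst tendsto_snd filterlim_ident)
  obtain D g where Dg: "D \<in> gaussian_ints - {0}" "g \<in> gaussian_ints" "lform D g v \<noteq> 0"
    "cmod (lform D g v) \<le> 1" "gap_fun v = gap_value D g v"
    using gap_fun_attained[OF v(2)] .
  have llim [tendsto_intros]: "(lform D g \<longlongrightarrow> lform D g v) (nhds v)"
    unfolding lform_def by (intro tendsto_intros)
  have nlim: "((\<lambda>x. cmod (lform D g x)) \<longlongrightarrow> cmod (lform D g v)) (nhds v)" by (intro tendsto_intros)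
  have "cmod (lform D g v) < 1" using Dg v by (force simp: regular_points_def)
  note order_tendstoD(2)[OF nlim this]
  moreover have "\<forall>\<^sub>F x in nhds v. 0 < cmod (lform D g x)"
    by (rule order_tendstoD(1)[OF nlim]) (use Dg in simp)
  moreover have "(gap_value D g \<longlongrightarrow> gap_value D g v) (nhds v)"
    unfolding gap_value_def using v Dg by (intro tendsto_intros) (auto simp: disc_denom_def)
  then have "\<forall>\<^sub>F x in nhds v. gap_value D g x < c"
    by (rule order_tendstoD(2)) (use c Dg in simp)
  ultimately show ?thesis
  proof eventually_elim
    case (elim x)
    then show ?case using gap_fun_le[of D g x] Dg by force
  qed
qed

lemma gap_fun_continuous:
  assumes v: "v \<in> regular_points" "v \<in> farey_cone"
  shows "(gap_fun \<longlongrightarrow> gap_fun v) (nhds v)"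
proof (rule order_tendstoI)
  have "cmod (snd v) < 1" using v by (auto simp: regular_points_def farey_cone_def disc_denom_def)
  then show "\<forall>\<^sub>F x in nhds v. c < gap_fun x" if "c < gap_fun v" for c
    using gap_fun_lower_semicont farey_cone_denom v that by blast
  show "\<forall>\<^sub>F x in nhds v. gap_fun x < c" if "gap_fun v < c" for c
    using gap_fun_upper_semicont farey_cone_denom v that by blast
qed

lemma isCont_cone_gap:
  fixes f :: "real \<Rightarrow> real"
  assumes v: "v \<in> regular_points" and f: "continuous_on {0..} f"
  shows "isCont (\<lambda>x. if x \<in> farey_cone then f (gap_fun x) else 0) v"
proof (cases "v \<in> farey_cone")
  case True
  have "gap_fun v > 0" using gap_fun_ge_1[OF farey_cone_denom[OF True]] by simp
  then have "isCont f (gap_fun v)"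
    using f by (intro continuous_on_interior[of "{0..}"]) auto
  then have "((\<lambda>x. f (gap_fun x)) \<longlongrightarrow> f (gap_fun v)) (nhds v)"
    by (rule isCont_tendsto_compose) (rule gap_fun_continuous[OF v True])
  then have "((\<lambda>x. if x \<in> farey_cone then f (gap_fun x) else 0) \<longlongrightarrow> f (gap_fun v)) (nhds v)"
    by (rule Lim_transform_eventually)
       (use eventually_cone_iff[OF v] True in \<open>auto elim: eventually_mono\<close>)
  then show ?thesis using True by (simp add: isCont_def tendsto_nhds_iff)
next
  case False
  have "((\<lambda>x. if x \<in> farey_cone then f (gap_fun x) else 0) \<longlongrightarrow> 0) (nhds v)"
    by (rule Lim_transform_eventually[OF tendsto_const])
       (use eventually_cone_iff[OF v] False in \<open>auto elim: eventually_mono\<close>)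
  then show ?thesis using False by (simp add: isCont_def tendsto_nhds_iff)
qed

lemma farey_cone_bounded: "v \<in> farey_cone \<Longrightarrow> norm v \<le> 3"
proof -
  assume v: "v \<in> farey_cone"
  then have w: "snd v \<noteq> 0" "cmod (snd v) \<le> 1" "cmod (fst v / snd v) \<le> 2"
    using norm_unit_square by (auto simp: farey_cone_def disc_denom_def)
  then have "cmod (fst v) \<le> 2 * cmod (snd v)" by (simp add: norm_divide pos_divide_le_eq)
  then show "norm v \<le> 3" using w norm_Pair_le[of "fst v" "snd v"] by simp
qed

lemma farey_cone_circle: "cmod u = 1 \<Longrightarrow> cscale u v \<in> farey_cone \<longleftrightarrow> v \<in> farey_cone"
proof -
  assume u: "cmod u = 1"
  then have "u \<noteq> 0" by auto
  then show ?thesis using u by (simp add: farey_cone_def disc_denom_def cscale_def norm_mult)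
qed

section \<open>Gaps of Farey fractions as values at primitive points\<close>

text \<open>Used to discard the pairs \<open>(D, g)\<close> for which the second fraction is congruent to the
  first one: their distance in the plane is at least \<open>1\<close>.\<close>

lemma dist_gtorus_le_1: "dist x y \<le> (1 :: real)" for x y :: gtorus
proof (cases x, cases y)
  fix z w assume xy: "x = pr z" "y = pr w"
  obtain g where g: "g \<in> gaussian_ints" "(cmod (z - w - g))\<^sup>2 \<le> 1 / 2"
    by (rule nearest_gaussian_int)
  have "y = pr (w + g)" using g xy by (simp add: pr_eq_iff gaussian_ints_uminus)
  then have "dist x y \<le> cmod (z - w - g)"
    using dist_pr_le[of z "w + g"] xy by (simp add: dist_norm diff_diff_eq)
  also have "\<dots> \<le> 1" using g(2) abs_square_le_1[of "cmod (z - w - g)"] by simp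
  finally show ?thesis .
qed

lemma infdist_finite_attained:
  assumes "finite A" "A \<noteq> {}"
  obtains a where "a \<in> A" "infdist x A = dist x a"
proof -
  have "infdist x A = Min (dist x ` A)"
    using assms by (simp add: infdist_notempty cInf_eq_Min)
  moreover have "Min (dist x ` A) \<in> dist x ` A" using assms by (intro Min_in) auto
  ultimately show thesis using that by auto
qed

lemma fareyI:
  "p \<in> gaussian_ints \<Longrightarrow> q \<in> gaussian_ints \<Longrightarrow> q \<noteq> 0 \<Longrightarrow> cmod q \<le> T \<Longrightarrow> pr (p / q) \<in> farey T"
  unfolding farey_def by auto

lemma farey_other_nonempty:
  assumes "2 \<le> T" shows "farey T - {r} \<noteq> {}"
proof -
  have "pr (0 / 1) \<in> farey T" "pr (1 / 2) \<in> farey T"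
    using assms by (intro fareyI; simp add: gaussian_ints_def)+
  moreover have "pr (0 / 1) \<noteq> pr (1 / 2)"
  proof
    assume "pr (0 / 1) = pr (1 / 2)"
    then have "- (1 / 2) \<in> gaussian_ints" by (simp add: pr_eq_iff)
    from gaussian_ints_norm_ge_1[OF this] show False by simp
  qed
  ultimately show ?thesis by blast
qed

text \<open>Since \<open>a * p + k * q = 1\<close>, the substitution \<open>D = p * q' - p' * q\<close>,
  \<open>g = k * q' + a * p'\<close> is unimodular, with inverse \<open>q' = D * a + g * q\<close>,
  \<open>p' = p * g - k * D\<close>. It matches the fractions \<open>p' / q' \<noteq> p / q\<close> with the pairs
  \<open>(D, g)\<close>, \<open>D \<noteq> 0\<close>. The hypothesis \<open>2 \<le> T\<close> provides a second point of the torus.\<close>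

lemma scaled_gap_eq_gap_fun:
  assumes T: "2 \<le> T" and ints: "p \<in> gaussian_ints" "q \<in> gaussian_ints" "a \<in> gaussian_ints" "k \<in> gaussian_ints"
    and bez: "a * p + k * q = 1" and q: "q \<noteq> 0" "cmod q \<le> T"
  shows "T\<^sup>2 * infdist (pr (p / q)) (farey T - {pr (p / q)}) = gap_fun ((1 / T) *\<^sub>R (a, q))"
proof (rule antisym)
  let ?r = "pr (p / q)" and ?v = "(1 / T) *\<^sub>R (a, q)"
  let ?F = "farey T - {?r}"
  have good: "disc_denom ?v" using q T by (simp add: disc_denom_def)
  have F: "finite ?F" "?F \<noteq> {}" using finite_farey farey_other_nonempty[OF T] by auto
  have lf: "lform D g ?v = (D * a + g * q) / T" for D g
    by (simp add: lform_def scaleR_conv_of_real add_divide_distrib)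
  have val: "gap_value D g ?v = T\<^sup>2 * cmod (p / q - p' / q')"
    if "D * a + g * q = q'" "p * q' - p' * q = D" "q' \<noteq> 0" for D g p' q'
  proof -
    have "p / q - p' / q' = D / (q * q')" using that q by (simp add: field_simps)
    moreover have "cmod (lform D g ?v) = cmod q' / T"
      unfolding lf that(1) using T by (simp add: norm_divide)
    moreover have "cmod (snd ?v) = cmod q / T" using T by simp
    ultimately show ?thesis unfolding gap_value_def using T that q
      by (simp add: norm_divide norm_mult power2_eq_square)
  qed
  show "gap_fun ?v \<le> T\<^sup>2 * infdist ?r ?F"
  proof -
    obtain s where s: "s \<in> ?F" "infdist ?r ?F = dist ?r s"
      using infdist_finite_attained[OF F] .
    obtain w' where w': "pr w' = s" "dist (pr (p / q)) s = dist (p / q) w'"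
      by (rule dist_pr_attained)
    obtain p0 q' where pq: "s = pr (p0 / q')" "p0 \<in> gaussian_ints" "q' \<in> gaussian_ints"
      "0 < cmod q'" "cmod q' \<le> T"
      using s(1) by (auto simp: farey_def)
    then have g0: "w' - p0 / q' \<in> gaussian_ints" using w' by (simp flip: pr_eq_iff)
    define p' where "p' = p0 + (w' - p0 / q') * q'"
    have p': "p' \<in> gaussian_ints" using g0 pq by (simp add: p'_def gaussian_ints_add gaussian_ints_mult)
    have w'': "w' = p' / q'" using pq by (simp add: p'_def field_simps)
    define D g where "D = p * q' - p' * q" and "g = k * q' + a * p'"
    have Dg: "D \<in> gaussian_ints" "g \<in> gaussian_ints"
      using ints p' pq by (auto simp: D_def g_def intro!: gaussian_ints_diff gaussian_ints_add gaussian_ints_mult)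
    have "D * a + g * q = (a * p + k * q) * q'" by (simp add: D_def g_def algebra_simps)
    then have lfq: "D * a + g * q = q'" using bez by simp
    have "w' \<noteq> p / q" using s w' by auto
    then have "D \<noteq> 0" using q pq unfolding D_def w'' by (auto simp: field_simps)
    moreover have "lform D g ?v \<noteq> 0" "cmod (lform D g ?v) \<le> 1"
      unfolding lf lfq using pq T by (auto simp: norm_divide)
    ultimately have "gap_fun ?v \<le> gap_value D g ?v"
      using Dg by (intro gap_fun_le) auto
    also have "\<dots> = T\<^sup>2 * cmod (p / q - p' / q')"
      by (rule val[OF lfq]) (use pq in \<open>auto simp: D_def\<close>)
    also have "cmod (p / q - p' / q') = infdist ?r ?F"
      using s(2) w' w'' by (simp add: dist_norm)
    finally show ?thesis .
  qed
  show "T\<^sup>2 * infdist ?r ?F \<le> gap_fun ?v"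
  proof -
    obtain D g where Dg: "D \<in> gaussian_ints - {0}" "g \<in> gaussian_ints" "lform D g ?v \<noteq> 0"
      "cmod (lform D g ?v) \<le> 1" "gap_fun ?v = gap_value D g ?v"
      using gap_fun_attained[OF good] .
    define q' p' where "q' = D * a + g * q" and "p' = p * g - k * D"
    have q': "q' \<noteq> 0" "cmod q' \<le> T" "q' \<in> gaussian_ints" "p' \<in> gaussian_ints"
      using Dg(1,2) Dg(3,4)[unfolded lf] T ints by (auto simp: q'_def p'_def norm_divide divide_le_eq
          intro!: gaussian_ints_diff gaussian_ints_add gaussian_ints_mult)
    have "p * q' - p' * q = D * (a * p + k * q)" by (simp add: q'_def p'_def algebra_simps)
    then have D: "p * q' - p' * q = D" using bez by simp
    have ne: "p / q - p' / q' \<noteq> 0" using D Dg(1) q q' by (auto simp: field_simps)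
    have "infdist ?r ?F \<le> cmod (p / q - p' / q')"
    proof (cases "pr (p' / q') = ?r")
      case True
      then have "p / q - p' / q' \<in> gaussian_ints" by (simp flip: pr_eq_iff)
      then have "1 \<le> cmod (p / q - p' / q')" using ne by (rule gaussian_ints_norm_ge_1)
      moreover obtain s where "infdist ?r ?F = dist ?r s" using infdist_finite_attained[OF F] .
      ultimately show ?thesis using dist_gtorus_le_1[of ?r s] by linarith
    next
      case False
      then have "infdist ?r ?F \<le> dist ?r (pr (p' / q'))"
        using q' by (intro infdist_le) (auto intro: fareyI)
      also have "\<dots> \<le> cmod (p / q - p' / q')" using dist_pr_le by (simp add: dist_norm[symmetric])
      finally show ?thesis .
    qed
    then have "T\<^sup>2 * infdist ?r ?F \<le> T\<^sup>2 * cmod (p / q - p' / q')" by (intro mult_left_mono) auto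
    also have "\<dots> = gap_fun ?v" unfolding Dg(5) by (rule val[symmetric]) (use q' D q'_def in auto)
    finally show ?thesis .
  qed
qed

definition farey_pairs :: "real \<Rightarrow> (complex \<times> complex) set" where
  "farey_pairs T = {v \<in> primitive. (1 / T) *\<^sub>R v \<in> farey_cone}"

lemma farey_pairs_iff:
  assumes "T > 0"
  shows "v \<in> farey_pairs T \<longleftrightarrow> v \<in> primitive \<and> snd v \<noteq> 0 \<and> cmod (snd v) \<le> T \<and> fst v / snd v \<in> unit_square"
proof -
  have "((1 / T) *\<^sub>R fst v) / ((1 / T) *\<^sub>R snd v) = fst v / snd v"
    using assms by (simp add: scaleR_conv_of_real)
  then show ?thesis using assms by (auto simp: farey_pairs_def farey_cone_def disc_denom_def)
qed

lemma finite_farey_pairs: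
  assumes "T > 0" shows "finite (farey_pairs T)"
proof (rule finite_subset[OF _ finite_lattice_ball[of "3 * T"]])
  show "farey_pairs T \<subseteq> {v \<in> lattice. norm v \<le> 3 * T}"
  proof
    fix v assume v: "v \<in> farey_pairs T"
    then have "norm ((1 / T) *\<^sub>R v) \<le> 3"
      using farey_cone_bounded[of "(1 / T) *\<^sub>R v"] by (simp only: farey_pairs_def mem_Collect_eq)
    then show "v \<in> {v \<in> lattice. norm v \<le> 3 * T}"
      using v assms primitive_subset by (auto simp: farey_pairs_def field_simps)
  qed
qed

definition inverse_pair :: "complex \<times> complex \<Rightarrow> complex \<times> complex \<Rightarrow> bool" where
  "inverse_pair v v' \<longleftrightarrow> snd v = snd v' \<and> (\<exists>k\<in>gaussian_ints. fst v * fst v' + k * snd v = 1)"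

lemma inverse_pair_sym: "inverse_pair v v' \<Longrightarrow> inverse_pair v' v"
  unfolding inverse_pair_def by (auto simp: mult.commute)

lemma inverse_pair_exists:
  assumes T: "T > 0" and v: "v \<in> farey_pairs T"
  obtains v' where "v' \<in> farey_pairs T" "inverse_pair v v'"
proof -
  have "v \<in> primitive" using v farey_pairs_iff[OF T] by blast
  then obtain p q x y where pq: "v = (p, q)" "p \<in> gaussian_ints" "q \<in> gaussian_ints"
    "x \<in> gaussian_ints" "y \<in> gaussian_ints" "p * x + q * y = 1"
    by (rule primitiveE)
  have q: "q \<noteq> 0" "cmod q \<le> T" using v pq(1) farey_pairs_iff[OF T] by auto
  define a k where "a = x - gfloor (x / q) * q" and "k = y + gfloor (x / q) * p"
  have ak: "a \<in> gaussian_ints" "k \<in> gaussian_ints"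
    using pq by (auto simp: a_def k_def intro!: gaussian_ints_add gaussian_ints_diff gaussian_ints_mult)
  have "a * p + q * k = p * x + q * y" by (simp add: a_def k_def algebra_simps)
  then have bez: "a * p + q * k = 1" using pq by simp
  have "a / q = x / q - gfloor (x / q)" using q by (simp add: a_def field_simps)
  then have "a / q \<in> unit_square" using gfloor_eq_iff[of "x / q" "gfloor (x / q)"] by simp
  moreover have "(a, q) \<in> primitive" by (rule primitiveI[OF ak(1) pq(3) pq(2) ak(2) bez])
  ultimately have "(a, q) \<in> farey_pairs T" using q farey_pairs_iff[OF T] by simp
  moreover have "inverse_pair v (a, q)"
    using ak bez pq(1) by (auto simp: inverse_pair_def mult.commute)
  ultimately show thesis by (rule that)
qed

text \<open>Two inverses modulo \<open>q\<close> are congruent modulo \<open>q\<close>, and the unit square meets each class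
  once.\<close>

lemma inverse_pair_unique:
  assumes T: "T > 0" and v: "v1 \<in> farey_pairs T" "v2 \<in> farey_pairs T" "v \<in> farey_pairs T"
    and inv: "inverse_pair v v1" "inverse_pair v v2"
  shows "v1 = v2"
proof -
  obtain p q where pq: "v = (p, q)" by (cases v)
  obtain a1 k1 where a1: "v1 = (a1, q)" "k1 \<in> gaussian_ints" "p * a1 + k1 * q = 1"
    using inv(1) pq by (cases v1) (auto simp: inverse_pair_def)
  obtain a2 k2 where a2: "v2 = (a2, q)" "k2 \<in> gaussian_ints" "p * a2 + k2 * q = 1"
    using inv(2) pq by (cases v2) (auto simp: inverse_pair_def)
  have ints: "a1 \<in> gaussian_ints" "a2 \<in> gaussian_ints" "q \<noteq> 0" "a1 / q \<in> unit_square" "a2 / q \<in> unit_square"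
    using v a1 a2 primitive_subset by (auto simp: farey_pairs_iff[OF T] lattice_def)
  have "a1 - a2 = a1 * (p * a2 + k2 * q) - a2 * (p * a1 + k1 * q)" using a1 a2 by simp
  also have "\<dots> = (a1 * k2 - a2 * k1) * q" by (simp add: algebra_simps)
  finally have "a1 / q - a2 / q = a1 * k2 - a2 * k1" using ints by (simp add: field_simps)
  moreover have "a1 * k2 - a2 * k1 \<in> gaussian_ints"
    using ints a1 a2 by (intro gaussian_ints_diff gaussian_ints_mult)
  ultimately have g: "a1 / q - a2 / q \<in> gaussian_ints" by simp
  have "a1 / q - (a1 / q - a2 / q) \<in> unit_square" "a1 / q - 0 \<in> unit_square" using ints by simp_all
  then have "a1 / q - a2 / q = 0" using g unit_square_translates[of "a1 / q"] gaussian_ints_0 by blast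
  then show ?thesis using ints a1 a2 by (simp add: field_simps)
qed

text \<open>A fraction in the unit square has one representation in lowest terms up to the four
  units.\<close>

lemma farey_sum_fibres:
  fixes \<phi> :: "gtorus \<Rightarrow> real"
  assumes T: "T > 0"
  shows "(\<Sum>v\<in>farey_pairs T. \<phi> (pr (fst v / snd v))) = 4 * (\<Sum>r\<in>farey T. \<phi> r)"
proof -
  let ?pr = "\<lambda>v :: complex \<times> complex. pr (fst v / snd v)"
  have sub: "?pr ` farey_pairs T \<subseteq> farey T"
  proof (rule image_subsetI)
    fix v assume "v \<in> farey_pairs T"
    then show "?pr v \<in> farey T"
      using primitive_subset by (cases v) (auto simp: farey_pairs_iff[OF T] lattice_def intro!: fareyI)
  qed
  have "(\<Sum>v\<in>farey_pairs T. \<phi> (?pr v)) = (\<Sum>r\<in>farey T. \<Sum>v | v \<in> farey_pairs T \<and> ?pr v = r. \<phi> (?pr v))"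
    by (rule sum.group[symmetric, OF finite_farey_pairs[OF T] finite_farey sub])
  also have "\<dots> = (\<Sum>r\<in>farey T. 4 * \<phi> r)"
  proof (rule sum.cong[OF refl])
    fix r assume "r \<in> farey T"
    then obtain p0 q0 where r: "r = pr (p0 / q0)" "p0 \<in> gaussian_ints" "q0 \<in> gaussian_ints"
      "0 < cmod q0" "cmod q0 \<le> T" by (auto simp: farey_def)
    (* Move the fraction into the unit square, then reduce it to lowest terms. *)
    define g where "g = gfloor (p0 / q0)"
    define p1 where "p1 = p0 - g * q0"
    have usq: "p0 / q0 - g \<in> unit_square" using gfloor_eq_iff[of "p0 / q0" g] by (simp add: g_def)
    have p1: "p1 \<in> gaussian_ints" "p1 / q0 \<in> unit_square" "pr (p1 / q0) = r"
    proof -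
      have e: "p1 / q0 = p0 / q0 - g" using r by (simp add: p1_def field_simps)
      show "p1 \<in> gaussian_ints" using r by (auto simp: p1_def g_def intro!: gaussian_ints_diff gaussian_ints_mult)
      show "p1 / q0 \<in> unit_square" using usq e by simp
      show "pr (p1 / q0) = r" unfolding e r(1) by (simp add: pr_eq_iff gaussian_ints_uminus g_def)
    qed
    have "(p1, q0) \<in> lattice" "(p1, q0) \<noteq> 0" using p1 r by (auto simp: lattice_def zero_prod_def)
    then obtain d v0 where d: "d \<in> gaussian_ints" "d \<noteq> 0" "v0 \<in> primitive" "(p1, q0) = cscale d v0"
      using content_exists by blast
    obtain p q where v0: "v0 = (p, q)" by (cases v0)
    have dq: "p1 = d * p" "q0 = d * q" using d v0 by (auto simp: cscale_def)
    have "1 \<le> cmod d" using d gaussian_ints_norm_ge_1 by blast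
    then have "1 * cmod q \<le> cmod d * cmod q" by (intro mult_right_mono) auto
    then have qT: "q \<noteq> 0" "cmod q \<le> T" using r dq by (auto simp: norm_mult)
    have pq: "p / q = p1 / q0" using dq d by simp
    have v0P: "v0 \<in> farey_pairs T" using d qT pq p1 v0 by (simp add: farey_pairs_iff[OF T])
    let ?X = "{v. v \<in> farey_pairs T \<and> ?pr v = r}"
    have "?X = (\<lambda>u. cscale u v0) ` gaussian_units"
    proof (intro equalityI subsetI)
      fix v assume v: "v \<in> ?X"
      obtain p' q' where v': "v = (p', q')" by (cases v)
      have fv: "q' \<noteq> 0" "p' / q' \<in> unit_square" "v \<in> primitive" "p' \<in> gaussian_ints" "q' \<in> gaussian_ints"
        using v v' primitive_subset by (auto simp: farey_pairs_iff[OF T] lattice_def)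
      have "p' / q' - p / q \<in> gaussian_ints"
        using v v' p1 pq by (simp flip: pr_eq_iff)
      moreover have "p' / q' - (p' / q' - p / q) \<in> unit_square" "p' / q' - 0 \<in> unit_square"
        using fv p1 pq by simp_all
      ultimately have "p' / q' - p / q = 0"
        using unit_square_translates[of "p' / q'"] gaussian_ints_0 by blast
      then have "cscale q' v0 = cscale q v" using fv qT v0 v' by (simp add: cscale_def field_simps)
      moreover have "q \<in> gaussian_ints" using d(3) v0 primitive_subset by (auto simp: lattice_def)
      ultimately obtain u where "u \<in> gaussian_units" "v = cscale u v0"
        using content_unique[OF fv(3) d(3) _ fv(5) qT(1), of] by metis
      then show "v \<in> (\<lambda>u. cscale u v0) ` gaussian_units" by blast
    next
      fix v assume "v \<in> (\<lambda>u. cscale u v0) ` gaussian_units"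
      then obtain u where u: "u \<in> gaussian_units" "v = cscale u v0" by blast
      then have "cmod u = 1" "u \<noteq> 0" by (auto simp: gaussian_units_def)
      then show "v \<in> ?X"
        using u gaussian_units_primitive[OF u(1) d(3)] v0P p1 pq v0
        by (simp add: farey_pairs_iff[OF T] cscale_def norm_mult)
    qed
    moreover have "inj_on (\<lambda>u. cscale u v0) gaussian_units"
      using qT by (auto simp: inj_on_def cscale_def v0)
    ultimately have "card ?X = 4" by (simp add: card_image card_gaussian_units)
    then show "(\<Sum>v\<in>?X. \<phi> (?pr v)) = 4 * \<phi> r" by simp
  qed
  finally show ?thesis by (simp add: sum_distrib_left)
qed

text \<open>Reindexing along the involution that inverts the numerator modulo the denominator turns
  the gap of a fraction into the value of \<open>gap_fun\<close> at a primitive point.\<close>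

lemma farey_gap_sum:
  fixes f :: "real \<Rightarrow> real"
  assumes T: "2 \<le> T"
  shows "4 * (\<Sum>r\<in>farey T. f (T\<^sup>2 * infdist r (farey T - {r})))
    = lattice_sum (\<lambda>x. if x \<in> farey_cone then f (gap_fun x) else 0) primitive T"
proof -
  have T0: "T > 0" using T by simp
  let ?gap = "\<lambda>r. f (T\<^sup>2 * infdist r (farey T - {r}))"
  define \<iota> where "\<iota> v = (SOME v'. v' \<in> farey_pairs T \<and> inverse_pair v v')" for v
  have \<iota>: "\<iota> v \<in> farey_pairs T" "inverse_pair v (\<iota> v)" if "v \<in> farey_pairs T" for v
    using inverse_pair_exists[OF T0 that] someI_ex[of "\<lambda>v'. v' \<in> farey_pairs T \<and> inverse_pair v v'"]
    unfolding \<iota>_def by blast+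
  have \<iota>\<iota>: "\<iota> (\<iota> v) = v" if v: "v \<in> farey_pairs T" for v
    using inverse_pair_unique[OF T0 \<iota>(1)[OF \<iota>(1)[OF v]] v \<iota>(1)[OF v] \<iota>(2)[OF \<iota>(1)[OF v]]
        inverse_pair_sym[OF \<iota>(2)[OF v]]] .
  have gap: "?gap (pr (fst (\<iota> v) / snd (\<iota> v))) = f (gap_fun ((1 / T) *\<^sub>R v))" if v: "v \<in> farey_pairs T" for v
  proof -
    obtain a q where aq: "v = (a, q)" by (cases v)
    obtain p where p: "\<iota> v = (p, q)" using \<iota>(2)[OF v] aq by (cases "\<iota> v") (auto simp: inverse_pair_def)
    obtain k where k: "k \<in> gaussian_ints" "a * p + k * q = 1"
      using \<iota>(2)[OF v] aq p by (auto simp: inverse_pair_def)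
    have "a \<in> gaussian_ints" "q \<in> gaussian_ints" "p \<in> gaussian_ints" "q \<noteq> 0" "cmod q \<le> T"
      using v \<iota>(1)[OF v] aq p primitive_subset by (auto simp: farey_pairs_iff[OF T0] lattice_def)
    then show ?thesis
      using scaled_gap_eq_gap_fun[OF T _ _ _ k(1,2)] aq p by simp
  qed
  have "4 * (\<Sum>r\<in>farey T. ?gap r) = (\<Sum>v\<in>farey_pairs T. ?gap (pr (fst v / snd v)))"
    by (rule farey_sum_fibres[OF T0, symmetric])
  also have "\<dots> = (\<Sum>v\<in>farey_pairs T. f (gap_fun ((1 / T) *\<^sub>R v)))"
    by (rule sum.reindex_bij_witness[of _ \<iota> \<iota>, symmetric]) (use \<iota> \<iota>\<iota> gap in auto)
  also have "\<dots> = lattice_sum (\<lambda>x. if x \<in> farey_cone then f (gap_fun x) else 0) primitive T"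
    unfolding lattice_sum_def
    using finite_farey_pairs[OF T0]
    by (intro sum.mono_neutral_cong_right) (auto simp: farey_pairs_def split: if_splits)
  finally show ?thesis .
qed

section \<open>The limit law and vague convergence\<close>

lemma emeasure_lborel_pos_open:
  fixes U :: "'a :: euclidean_space set"
  assumes "open U" "U \<noteq> {}" "U \<subseteq> A" "A \<in> sets borel"
  shows "0 < emeasure lborel A"
proof (rule ccontr)
  assume "\<not> 0 < emeasure lborel A"
  then have "emeasure lborel A = 0" by simp
  then have "negligible A"
    using assms(4) by (simp add: negligible_iff_null_sets null_sets_completion_iff null_sets_def)
  then have "negligible U" using assms(3) by (rule negligible_subset)
  then show False using open_not_negligible assms by blast
qed

lemma open_ratio_vimage:
  assumes "open U" shows "open {v :: complex \<times> complex. snd v \<noteq> 0 \<and> fst v / snd v \<in> U}"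
proof -
  have o: "open {v :: complex \<times> complex. snd v \<noteq> 0}"
    by (intro open_Collect_neq continuous_intros)
  have "continuous_on {v :: complex \<times> complex. snd v \<noteq> 0} (\<lambda>v. fst v / snd v)"
    by (intro continuous_intros) auto
  from continuous_open_preimage[OF this o assms] show ?thesis
    by (simp add: Int_def vimage_def)
qed

lemma open_box_square: "open {z. 0 < Re z \<and> Re z < 1 \<and> 0 < Im z \<and> Im z < 1}"
  by (intro open_Collect_conj open_Collect_less continuous_intros)

definition farey_cone_interior :: "(complex \<times> complex) set" where
  "farey_cone_interior = {v. snd v \<noteq> 0 \<and> fst v / snd v \<in> {z. 0 < Re z \<and> Re z < 1 \<and> 0 < Im z \<and> Im z < 1}}
     \<inter> {v. cmod (snd v) < 1}"

lemma open_farey_cone_interior: "open farey_cone_interior"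
  unfolding farey_cone_interior_def
  by (intro open_Int open_ratio_vimage open_box_square open_Collect_less continuous_intros)

lemma farey_cone_interior_subset: "farey_cone_interior \<subseteq> farey_cone"
  by (auto simp: farey_cone_interior_def farey_cone_def disc_denom_def unit_square_def)

lemma emeasure_farey_cone: "emeasure lborel farey_cone \<noteq> 0" "emeasure lborel farey_cone \<noteq> \<infinity>"
proof -
  have "(Complex (1/4) (1/4), 1 / 2) \<in> farey_cone_interior"
    by (simp add: farey_cone_interior_def)
  then have "0 < emeasure lborel farey_cone"
    using emeasure_lborel_pos_open[OF open_farey_cone_interior _ farey_cone_interior_subset farey_cone_borel] by blast
  then show "emeasure lborel farey_cone \<noteq> 0" by simp
  have "bounded farey_cone" using farey_cone_bounded unfolding bounded_iff by blast
  from emeasure_bounded_finite[OF this] show "emeasure lborel farey_cone \<noteq> \<infinity>" by simp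
qed

lemma measure_farey_cone_pos: "measure lborel farey_cone > 0"
  using emeasure_farey_cone by (simp add: measure_def enn2real_positive_iff top.not_eq_extremum zero_less_iff_neq_zero)

definition gap_law :: "real measure" where
  "gap_law = distr (uniform_measure lborel farey_cone) (restrict_space borel {0..}) cone_gap"

lemma cone_gap_nonneg: "0 \<le> cone_gap v"
  using gap_fun_ge_1[OF farey_cone_denom, of v] by (auto simp: cone_gap_def)

lemma measurable_uniform_cone: "measurable (uniform_measure lborel farey_cone) N = measurable lborel N"
  by (rule measurable_cong_sets) simp_all

lemma cone_gap_measurable_restrict:
  "cone_gap \<in> measurable (uniform_measure lborel farey_cone) (restrict_space borel {0..})"
  by (rule measurable_restrict_space2) (auto simp: cone_gap_nonneg measurable_uniform_cone)

lemma prob_space_gap_law: "prob_space gap_law"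
  unfolding gap_law_def
  by (intro prob_space.prob_space_distr prob_space_uniform_measure cone_gap_measurable_restrict
      emeasure_farey_cone)

lemma sets_gap_law: "sets gap_law = sets (restrict_space borel {0..})"
  by (simp add: gap_law_def)

lemma emeasure_gap_law:
  assumes A: "A \<in> sets (restrict_space borel {0..})"
  shows "emeasure gap_law A = emeasure lborel {v \<in> farey_cone. gap_fun v \<in> A} / emeasure lborel farey_cone"
proof -
  have "A \<in> sets borel" using A by (auto simp: sets_restrict_space)
  then have m: "cone_gap -` A \<in> sets borel" using measurable_sets_borel[OF cone_gap_measurable] by blast
  have "emeasure gap_law A = emeasure (uniform_measure lborel farey_cone) (cone_gap -` A)"
    unfolding gap_law_def using A by (subst emeasure_distr[OF cone_gap_measurable_restrict]) auto
  also have "\<dots> = emeasure lborel (farey_cone \<inter> cone_gap -` A) / emeasure lborel farey_cone"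
    using m by (intro emeasure_uniform_measure) auto
  also have "farey_cone \<inter> cone_gap -` A = {v \<in> farey_cone. gap_fun v \<in> A}"
    by (auto simp: cone_gap_def)
  finally show ?thesis .
qed

lemma gap_fun_cone_borel:
  assumes "A \<in> sets borel" shows "{v \<in> farey_cone. gap_fun v \<in> A} \<in> sets borel"
proof -
  have "{v \<in> farey_cone. gap_fun v \<in> A} = farey_cone \<inter> cone_gap -` A"
    by (auto simp: cone_gap_def)
  also have "\<dots> \<in> sets borel"
    using assms by (intro sets.Int farey_cone_borel measurable_sets_borel[OF cone_gap_measurable]) auto
  finally show ?thesis .
qed

lemma gap_law_absolutely_continuous: "absolutely_continuous (restrict_space lborel {0..}) gap_law"
  unfolding absolutely_continuous_def
proof
  fix N :: "real set" assume N: "N \<in> null_sets (restrict_space lborel {0..})"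
  then have N': "N \<in> null_sets lborel" "N \<subseteq> {0..}"
    by (auto simp: null_sets_restrict_space)
  have A: "N \<in> sets (restrict_space borel {0..})"
    using N' by (auto simp: sets_restrict_space_iff)
  have m: "{v \<in> farey_cone. gap_fun v \<in> N} \<in> sets lborel"
    using N' gap_fun_cone_borel[of N] by auto
  have "AE v in lborel. v \<notin> {v \<in> farey_cone. gap_fun v \<in> N}"
    using cone_gap_null[OF N'(1)] by eventually_elim (simp add: cone_gap_def)
  then have "emeasure lborel {v \<in> farey_cone. gap_fun v \<in> N} = 0"
    using AE_iff_null_sets[OF m] by blast
  then show "N \<in> null_sets gap_law"
    using A by (simp add: null_sets_def sets_gap_law emeasure_gap_law)
qed

lemma integral_uniform_cone:
  fixes g :: "complex \<times> complex \<Rightarrow> real"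
  assumes [measurable]: "g \<in> borel_measurable lborel"
  shows "(\<integral>v. g v \<partial>uniform_measure lborel farey_cone)
    = (\<integral>v\<in>farey_cone. g v \<partial>lborel) / measure lborel farey_cone"
proof -
  let ?V = "measure lborel farey_cone"
  have V: "emeasure lborel farey_cone = ennreal ?V"
    using emeasure_farey_cone by (simp add: emeasure_eq_ennreal_measure)
  have "indicator farey_cone v / emeasure lborel farey_cone = ennreal (indicator farey_cone v / ?V)" for v
    unfolding V using measure_farey_cone_pos
    by (subst divide_ennreal[symmetric]) (auto simp: indicator_def)
  then have "uniform_measure lborel farey_cone = density lborel (\<lambda>v. ennreal (indicator farey_cone v / ?V))"
    by (simp add: uniform_measure_def)
  then have "(\<integral>v. g v \<partial>uniform_measure lborel farey_cone) = (\<integral>v. (indicator farey_cone v / ?V) *\<^sub>R g v \<partial>lborel)"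
    by (simp only:) (rule integral_density, auto intro!: AE_I2)
  also have "\<dots> = (\<integral>v. (indicator farey_cone v *\<^sub>R g v) / ?V \<partial>lborel)" by simp
  also have "\<dots> = (\<integral>v\<in>farey_cone. g v \<partial>lborel) / ?V"
    unfolding set_lebesgue_integral_def by (rule integral_divide_zero)
  finally show ?thesis .
qed

text \<open>Integrals against \<open>gap_measure T\<close> are quotients of two sums over primitive points, for
  the test function and for the constant \<open>1\<close>; the constant \<open>primitive_constant\<close> cancels in the
  limit.\<close>

lemma gap_law_vague_conv: "vague_conv_on {0..} gap_measure gap_law at_top"
  unfolding vague_conv_on_def
proof (intro allI impI, elim conjE exE)
  fix f :: "real \<Rightarrow> real" and K
  assume f: "continuous_on {0..} f" and K: "compact K" "K \<subseteq> {0..}" "\<forall>x\<in>{0..} - K. f x = 0"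
  have "compact (f ` K)" using K f by (intro compact_continuous_image) (auto intro: continuous_on_subset)
  then obtain C0 where C0: "\<And>x. x \<in> K \<Longrightarrow> \<bar>f x\<bar> \<le> C0"
    using compact_imp_bounded by (fastforce simp: bounded_iff)
  define C where "C = max C0 0"
  have C: "\<bar>f x\<bar> \<le> C" if "0 \<le> x" for x
    using C0[of x] K(3) that by (cases "x \<in> K") (auto simp: C_def)
  have fm: "f \<in> borel_measurable (restrict_space borel {0..})"
    by (rule borel_measurable_continuous_on_restrict[OF f])
  define h where "h g x = (if x \<in> farey_cone then g (gap_fun x) else 0)" for g :: "real \<Rightarrow> real" and x
  have lim: "((\<lambda>T. lattice_sum (h g) primitive T / T ^ 4) \<longlongrightarrow> integral\<^sup>L lborel (h g) / primitive_constant) at_top"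
    if g: "continuous_on {0..} g" "\<And>x. 0 \<le> x \<Longrightarrow> \<bar>g x\<bar> \<le> B" "0 \<le> B" for g B
  proof (rule primitive_lattice_riemann_sum)
    have gm: "(\<lambda>x. indicator {0..} x *\<^sub>R g x) \<in> borel_measurable borel"
      using borel_measurable_continuous_on_restrict[OF g(1)]
      by (subst (asm) borel_measurable_restrict_space_iff) auto
    have "h g = (\<lambda>x. indicator farey_cone x * (indicator {0..} (cone_gap x) *\<^sub>R g (cone_gap x)))"
      using cone_gap_nonneg by (auto simp: h_def cone_gap_def indicator_def fun_eq_iff)
    also have "\<dots> \<in> borel_measurable borel"
      using measurable_compose[OF cone_gap_measurable gm] by measurable
    finally show "h g \<in> borel_measurable borel" .
    have pos: "0 \<le> gap_fun x" if "x \<in> farey_cone" for x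
      using gap_fun_ge_1[OF farey_cone_denom[OF that]] by simp
    show "\<bar>h g x\<bar> \<le> B" for x using g pos by (simp add: h_def)
    show "h g x = 0" if "3 < norm x" for x using that farey_cone_bounded[of x] by (auto simp: h_def)
    show "AE x in lborel. isCont (h g) x"
      using AE_regular by eventually_elim (unfold h_def, rule isCont_cone_gap[OF _ g(1)])
    show "h g 0 = 0" by (simp add: h_def farey_cone_def disc_denom_def)
    show "h g (cscale u x) = h g x" if "cmod u = 1" for u x
      using that by (simp add: h_def farey_cone_circle gap_fun_circle)
  qed
  have I1: "integral\<^sup>L lborel (h (\<lambda>_. 1)) = measure lborel farey_cone"
  proof -
    have "h (\<lambda>_. 1) = indicator farey_cone" by (auto simp: h_def indicator_def fun_eq_iff)
    then show ?thesis by simp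
  qed
  have If: "integral\<^sup>L gap_law f = integral\<^sup>L lborel (h f) / measure lborel farey_cone"
  proof -
    have "integral\<^sup>L gap_law f = (\<integral>v. f (cone_gap v) \<partial>uniform_measure lborel farey_cone)"
      unfolding gap_law_def by (rule integral_distr[OF cone_gap_measurable_restrict fm])
    also have "\<dots> = (\<integral>v\<in>farey_cone. f (cone_gap v) \<partial>lborel) / measure lborel farey_cone"
    proof -
      have "(\<lambda>v. f (cone_gap v)) \<in> borel_measurable lborel"
        using measurable_compose[OF cone_gap_measurable_restrict fm]
        by (simp add: measurable_uniform_cone)
      then show ?thesis
        by (rule integral_uniform_cone)
    qed
    also have "(\<integral>v\<in>farey_cone. f (cone_gap v) \<partial>lborel) = integral\<^sup>L lborel (h f)"
      unfolding set_lebesgue_integral_def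
      by (intro Bochner_Integration.integral_cong) (auto simp: h_def cone_gap_def indicator_def)
    finally show ?thesis .
  qed
  have "((\<lambda>T. (lattice_sum (h f) primitive T / T ^ 4) / (lattice_sum (h (\<lambda>_. 1)) primitive T / T ^ 4))
      \<longlongrightarrow> (integral\<^sup>L lborel (h f) / primitive_constant) / (integral\<^sup>L lborel (h (\<lambda>_. 1)) / primitive_constant)) at_top"
    using primitive_constant_pos measure_farey_cone_pos
    by (intro tendsto_divide lim[of _ C] lim[of _ 1] f C) (auto simp: I1 C_def)
  also have "(integral\<^sup>L lborel (h f) / primitive_constant) / (integral\<^sup>L lborel (h (\<lambda>_. 1)) / primitive_constant)
      = integral\<^sup>L gap_law f"
    using primitive_constant_pos by (simp add: If I1)
  finally show "((\<lambda>T. integral\<^sup>L (gap_measure T) f) \<longlongrightarrow> integral\<^sup>L gap_law f) at_top"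
  proof (rule Lim_transform_eventually)
    show "\<forall>\<^sub>F T in at_top. (lattice_sum (h f) primitive T / T ^ 4) / (lattice_sum (h (\<lambda>_. 1)) primitive T / T ^ 4)
        = integral\<^sup>L (gap_measure T) f"
      using eventually_ge_at_top[of 2]
    proof eventually_elim
      case (elim T)
      let ?gap = "\<lambda>r. T\<^sup>2 * infdist r (farey T - {r})"
      have "integral\<^sup>L (gap_measure T) f = (\<integral>r. f (?gap r) \<partial>uniform_count_measure (farey T))"
        unfolding gap_measure_def
        by (rule integral_distr[OF _ fm])
           (auto simp: measurable_def space_uniform_count_measure sets_uniform_count_measure
             space_restrict_space infdist_nonneg)
      also have "\<dots> = (\<Sum>r\<in>farey T. f (?gap r)) / card (farey T)"
        using finite_farey by (rule integral_uniform_count_measure)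
      also have "\<dots> = (4 * (\<Sum>r\<in>farey T. f (?gap r))) / (4 * (\<Sum>r\<in>farey T. 1))" by simp
      also have "\<dots> = lattice_sum (h f) primitive T / lattice_sum (h (\<lambda>_. 1)) primitive T"
        unfolding farey_gap_sum[OF elim, of f] farey_gap_sum[OF elim, of "\<lambda>_. 1"] h_def[abs_def] ..
      finally show ?case using elim by simp
    qed
  qed
qed

section \<open>Support of the limit law\<close>

text \<open>If \<open>w\<close> has modulus slightly below \<open>1 / x\<close> and some translate \<open>z + g * w\<close> has
  modulus slightly below \<open>1\<close>, then \<open>gap_fun (z, w)\<close> lies between \<open>1 / \<bar>w\<bar>\<close> and
  \<open>1 / (\<bar>w\<bar> * \<bar>z + g * w\<bar>)\<close>, hence just above \<open>x\<close>. These are open conditions on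
  \<open>(z, w)\<close>; the shear by \<open>g\<close> serves to bring a point that satisfies them into the cone.\<close>

lemma gap_law_open_interval_pos:
  assumes x: "1 \<le> x" and e: "e > 0"
  shows "0 < emeasure lborel {v \<in> farey_cone. gap_fun v \<in> {x<..<x + e}}"
proof -
  define W where "W u = {v :: complex \<times> complex. x * cmod (snd v) < 1
      \<and> 1 < (x + e) * (cmod (snd v) * cmod (u v)) \<and> cmod (u v) < 1}" for u :: "complex \<times> complex \<Rightarrow> complex"
  have openW: "open (W u)" if "continuous_on UNIV u" for u
    unfolding W_def by (intro open_Collect_conj open_Collect_less continuous_intros that)
  (* Real z = c and w = b witness that the open set W fst is not empty. *)
  obtain b where b: "1 / (x + e) < b" "b < 1 / x"
    using dense[of "1 / (x + e)" "1 / x"] x e by (auto simp: frac_less2)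
  have b0: "0 < b" using b x e by (smt (verit) divide_pos_pos)
  have xb: "x * b < 1" "1 < (x + e) * b" using b x e by (simp_all add: field_simps)
  then have "1 / ((x + e) * b) < 1" using b0 x e by simp
  then obtain c where c: "1 / ((x + e) * b) < c" "c < 1" using dense by blast
  have c0: "0 < c" using c b0 x e by (smt (verit) divide_pos_pos mult_pos_pos)
  have "0 < (x + e) * b" using b0 x e by simp
  then have "1 < (x + e) * b * c" using c(1) by (simp only: pos_divide_less_eq mult.commute)
  then have "(of_real c, of_real b) \<in> W fst" using xb b0 c0 c by (simp add: W_def mult_ac)
  moreover have oW: "open (W fst)" by (rule openW) (intro continuous_intros)
  ultimately have "0 < emeasure lborel (W fst)"
    by (intro emeasure_lborel_pos_open[of "W fst"]) auto
  moreover have "W fst \<in> sets lborel" using oW by simp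
  ultimately have "\<not> (AE v in lborel. v \<notin> W fst)"
    using AE_iff_null_sets[of "W fst" lborel] by auto
  (* At a regular point the ratio z / w avoids the grid, so its reduction is interior to the square. *)
  then obtain v where v: "v \<in> W fst" "v \<in> regular_points"
    using AE_regular by (metis (mono_tags, lifting) eventually_mono)
  define g where "g = gfloor (fst v / snd v)"
  define v' where "v' = (fst v - g * snd v, snd v)"
  have g: "g \<in> gaussian_ints" by (simp add: g_def)
  have w0: "snd v \<noteq> 0" using v by (simp add: regular_points_def)
  have "fst v' / snd v' = fst v / snd v - g" using w0 by (simp add: v'_def diff_divide_distrib)
  moreover have "fst v / snd v - g \<in> unit_square" using gfloor_eq_iff[of "fst v / snd v" g] by (simp add: g_def)
  moreover have "Re (fst v / snd v) \<noteq> Re g" "Im (fst v / snd v) \<noteq> Im g"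
    using v(2) g by (auto simp: regular_points_def gaussian_ints_def)
  ultimately have ratio: "0 < Re (fst v' / snd v')" "Re (fst v' / snd v') < 1"
      "0 < Im (fst v' / snd v')" "Im (fst v' / snd v') < 1"
    by (auto simp: unit_square_def less_le)
  have vW: "x * cmod (snd v) < 1" using v by (simp add: W_def)
  moreover have "1 * cmod (snd v) \<le> x * cmod (snd v)" using x by (intro mult_right_mono) auto
  ultimately have "cmod (snd v) < 1" by simp
  then have "v' \<in> farey_cone_interior" using ratio w0 by (simp add: farey_cone_interior_def v'_def)
  moreover have "lform 1 g v' = fst v" by (simp add: lform_def v'_def)
  then have "v' \<in> W (lform 1 g)" using v by (simp add: W_def v'_def)
  ultimately have ne: "farey_cone_interior \<inter> W (lform 1 g) \<noteq> {}" by blast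
  show ?thesis
  proof (rule emeasure_lborel_pos_open[OF _ ne _ gap_fun_cone_borel])
    show "open (farey_cone_interior \<inter> W (lform 1 g))"
      by (intro open_Int open_farey_cone_interior openW) (auto simp: lform_def intro!: continuous_intros)
    show "farey_cone_interior \<inter> W (lform 1 g) \<subseteq> {v \<in> farey_cone. gap_fun v \<in> {x<..<x + e}}"
    proof
      fix y assume y: "y \<in> farey_cone_interior \<inter> W (lform 1 g)"
      then have yc: "y \<in> farey_cone" using farey_cone_interior_subset by blast
      then have good: "disc_denom y" by (rule farey_cone_denom)
      then have w: "0 < cmod (snd y)" by (simp add: disc_denom_def)
      have yW: "x * cmod (snd y) < 1" "1 < (x + e) * (cmod (snd y) * cmod (lform 1 g y))"
        "cmod (lform 1 g y) < 1" using y by (auto simp: W_def)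
      have L: "lform 1 g y \<noteq> 0" using yW(2) by auto
      have "x < 1 / cmod (snd y)" using yW(1) w by (simp add: field_simps)
      also have "\<dots> \<le> gap_fun y" by (rule gap_fun_lower[OF good])
      finally have 1: "x < gap_fun y" .
      have "gap_fun y \<le> gap_value 1 g y" using g L yW by (intro gap_fun_le) auto
      also have "\<dots> < x + e" unfolding gap_value_def using w L yW(2) by (simp add: divide_less_eq)
      finally show "y \<in> {v \<in> farey_cone. gap_fun v \<in> {x<..<x + e}}" using 1 yc by simp
    qed
  qed simp
qed

lemma gap_law_support: "measure_support gap_law = {1..}"
proof (intro equalityI subsetI)
  have space: "space gap_law = {0..}"
    using sets_eq_imp_space_eq[OF sets_gap_law] by (simp add: space_restrict_space)
  fix x assume x: "x \<in> measure_support gap_law"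
  show "x \<in> {1..}"
  proof (rule ccontr)
    assume "x \<notin> {1..}"
    then have "0 < emeasure gap_law ({..<1} \<inter> space gap_law)"
      using x by (auto simp: measure_support_def)
    moreover have "{..<1} \<inter> space gap_law \<in> sets (restrict_space borel {0..})"
      by (auto simp: space sets_restrict_space_iff)
    then have "emeasure gap_law ({..<1} \<inter> space gap_law)
        = emeasure lborel {v \<in> farey_cone. gap_fun v \<in> {..<1} \<inter> space gap_law} / emeasure lborel farey_cone"
      by (rule emeasure_gap_law)
    moreover have "{v \<in> farey_cone. gap_fun v \<in> {..<1} \<inter> space gap_law} = {}"
      using gap_fun_ge_1[OF farey_cone_denom] by fastforce
    ultimately show False by (simp only: emeasure_empty) simp
  qed
next
  have space: "space gap_law = {0..}"
    using sets_eq_imp_space_eq[OF sets_gap_law] by (simp add: space_restrict_space)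
  fix x :: real assume "x \<in> {1..}"
  then have x: "1 \<le> x" by simp
  have "0 < emeasure gap_law (U \<inter> space gap_law)" if U: "open U" "x \<in> U" for U
  proof -
    obtain e where e: "e > 0" "\<And>y. \<bar>y - x\<bar> < e \<Longrightarrow> y \<in> U"
      using U by (auto simp: open_dist dist_real_def)
    have meas: "U \<inter> space gap_law \<in> sets (restrict_space borel {0..})"
      using U by (auto simp: space sets_restrict_space_iff)
    have "0 < emeasure lborel {v \<in> farey_cone. gap_fun v \<in> {x<..<x + e}}"
      by (rule gap_law_open_interval_pos[OF x e(1)])
    also have "\<dots> \<le> emeasure lborel {v \<in> farey_cone. gap_fun v \<in> U \<inter> space gap_law}"
    proof (rule emeasure_mono)
      show "{v \<in> farey_cone. gap_fun v \<in> {x<..<x + e}} \<subseteq> {v \<in> farey_cone. gap_fun v \<in> U \<inter> space gap_law}"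
        using x e(2) by (auto simp: space)
      show "{v \<in> farey_cone. gap_fun v \<in> U \<inter> space gap_law} \<in> sets lborel"
        using U gap_fun_cone_borel[of "U \<inter> space gap_law"] by (simp add: space)
    qed
    finally have "0 < emeasure lborel {v \<in> farey_cone. gap_fun v \<in> U \<inter> space gap_law}" .
    then show ?thesis
      unfolding emeasure_gap_law[OF meas] using emeasure_farey_cone
      by (simp add: ennreal_zero_less_divide top.not_eq_extremum)
  qed
  then show "x \<in> measure_support gap_law"
    using x by (auto simp: measure_support_def space)
qed

section \<open>Distribution of the denominator\<close>

text \<open>Over \<open>w\<close> the cone is the unit square multiplied by \<open>w\<close>, which scales areas by \<open>\<bar>w\<bar>\<^sup>2\<close>.\<close>

lemma emeasure_cone_slices:
  fixes S :: "(complex \<times> complex) set"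
  assumes S: "S \<in> sets borel" and E: "\<And>w. E w \<in> sets borel"
    and slice: "\<And>z w. (z, w) \<in> farey_cone \<Longrightarrow> (z, w) \<in> S \<longleftrightarrow> z / w \<in> E w"
  shows "emeasure lborel (farey_cone \<inter> S) = (\<integral>\<^sup>+w. emeasure lborel (E w \<inter> unit_square)
     * (ennreal ((cmod w)\<^sup>2) * indicator {w. w \<noteq> 0 \<and> cmod w \<le> 1} w) \<partial>lborel)"
proof -
  have m: "farey_cone \<inter> S \<in> sets (lborel \<Otimes>\<^sub>M lborel)"
    unfolding lborel_prod using S farey_cone_borel by auto
  have "emeasure lborel (farey_cone \<inter> S) = emeasure (lborel \<Otimes>\<^sub>M lborel) (farey_cone \<inter> S)"
    by (simp add: lborel_prod)
  also have "\<dots> = (\<integral>\<^sup>+w. emeasure lborel ((\<lambda>z. (z, w)) -` (farey_cone \<inter> S)) \<partial>lborel)"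
    by (rule lborel_pair.emeasure_pair_measure_alt2[OF m])
  also have "\<dots> = (\<integral>\<^sup>+w. emeasure lborel (E w \<inter> unit_square)
     * (ennreal ((cmod w)\<^sup>2) * indicator {w. w \<noteq> 0 \<and> cmod w \<le> 1} w) \<partial>lborel)"
  proof (rule nn_integral_cong)
    fix w
    show "emeasure lborel ((\<lambda>z. (z, w)) -` (farey_cone \<inter> S)) = emeasure lborel (E w \<inter> unit_square)
     * (ennreal ((cmod w)\<^sup>2) * indicator {w. w \<noteq> 0 \<and> cmod w \<le> 1} w)"
    proof (cases "w \<noteq> 0 \<and> cmod w \<le> 1")
      case True
      then have "(\<lambda>z. (z, w)) -` (farey_cone \<inter> S) = {z. z / w \<in> E w \<inter> unit_square}"
        using slice by (auto simp: farey_cone_def disc_denom_def)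
      then show ?thesis
        using True emeasure_lborel_complex_mult[of "E w \<inter> unit_square" w] E
        by (simp add: sets.Int mult.commute)
    next
      case False
      then have "(\<lambda>z. (z, w)) -` (farey_cone \<inter> S) = {}"
        by (auto simp: farey_cone_def disc_denom_def)
      then show ?thesis using False by simp
    qed
  qed
  finally show ?thesis .
qed

lemma cone_snd_less_borel: "{v \<in> farey_cone. cmod (snd v) < s} \<in> sets borel"
  by measurable

text \<open>Dilation by \<open>r\<close> maps the part with \<open>\<bar>w\<bar> < 1\<close> onto the part with \<open>\<bar>w\<bar> < r\<close>, and the
  part with \<open>\<bar>w\<bar> = 1\<close> is null.\<close>

lemma emeasure_cone_snd_less:
  assumes r: "0 < r" "r \<le> 1"
  shows "emeasure lborel {v \<in> farey_cone. cmod (snd v) < r} = ennreal (r ^ 4) * emeasure lborel farey_cone"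
proof -
  note b = cone_snd_less_borel
  have "emeasure lborel {v \<in> farey_cone. cmod (snd v) < 1} = emeasure lborel farey_cone"
  proof (rule emeasure_eq_AE)
    show "AE v in lborel. v \<in> {v \<in> farey_cone. cmod (snd v) < 1} \<longleftrightarrow> v \<in> farey_cone"
      using AE_regular by eventually_elim (auto simp: regular_points_def farey_cone_def disc_denom_def)
  qed (use b[of 1] farey_cone_borel in auto)
  moreover have "(\<lambda>v. r *\<^sub>R v) -` {v \<in> farey_cone. cmod (snd v) < r} = {v \<in> farey_cone. cmod (snd v) < 1}"
  proof -
    have "(r *\<^sub>R z) / (r *\<^sub>R w) = z / w" for z w :: complex
      using r by (simp add: scaleR_conv_of_real)
    moreover have "r * cmod w \<le> 1" if "cmod w < 1" for w
      using that r mult_mono[of r 1 "cmod w" 1] by simp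
    ultimately show ?thesis using r by (auto simp: farey_cone_def disc_denom_def)
  qed
  ultimately show ?thesis using lborel_scale_vimage[OF b r(1), of r] by simp
qed

text \<open>The variable \<open>s\<close> of the annuli: \<open>exp (s / 2) = 1 / \<bar>w\<bar>\<close>.\<close>

definition log_size :: "complex \<times> complex \<Rightarrow> real" where
  "log_size v = - 2 * ln (cmod (snd v))"

lemma log_size_exponential:
  "distributed (uniform_measure lborel farey_cone) lborel log_size (exponential_density 2)"
proof -
  let ?U = "uniform_measure lborel farey_cone"
  interpret U: prob_space ?U
    by (rule prob_space_uniform_measure) (rule emeasure_farey_cone)+
  have [measurable]: "log_size \<in> borel_measurable borel" unfolding log_size_def by measurable
  show ?thesis
  proof (rule exponential_distributedI)
    show "log_size \<in> borel_measurable ?U" by (simp add: measurable_uniform_cone)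
    fix a :: real assume a: "0 \<le> a"
    define r where "r = exp (- a / 2)"
    have r: "0 < r" "r \<le> 1" using a by (auto simp: r_def)
    have r4: "r ^ 4 = exp (- a * 2)" unfolding r_def by (simp flip: exp_of_nat_mult)
    have "emeasure ?U {v. cmod (snd v) < r} = emeasure lborel (farey_cone \<inter> {v. cmod (snd v) < r}) / emeasure lborel farey_cone"
      by (rule emeasure_uniform_measure) auto
    also have "farey_cone \<inter> {v. cmod (snd v) < r} = {v \<in> farey_cone. cmod (snd v) < r}" by auto
    also have "emeasure lborel {v \<in> farey_cone. cmod (snd v) < r} / emeasure lborel farey_cone = ennreal (r ^ 4)"
      unfolding emeasure_cone_snd_less[OF r] using emeasure_farey_cone
      by (simp add: ennreal_mult_divide_eq)
    finally have P: "U.prob {v. cmod (snd v) < r} = r ^ 4"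
      using r by (simp add: measure_def)
    have "emeasure ?U {v \<in> space ?U. log_size v \<le> a} = emeasure ?U (space ?U - {v. cmod (snd v) < r})"
    proof (rule emeasure_eq_AE)
      have "AE v in ?U. snd v \<noteq> 0"
        using emeasure_farey_cone AE_snd_nonzero
        by (subst AE_uniform_measure) (auto elim: eventually_mono simp: less_top[symmetric])
      then show "AE v in ?U. v \<in> {v \<in> space ?U. log_size v \<le> a} \<longleftrightarrow> v \<in> space ?U - {v. cmod (snd v) < r}"
      proof eventually_elim
        case (elim v)
        have "log_size v \<le> a \<longleftrightarrow> - a / 2 \<le> ln (cmod (snd v))" by (auto simp: log_size_def)
        also have "\<dots> \<longleftrightarrow> r \<le> cmod (snd v)"
          using elim by (simp add: r_def ln_ge_iff)
        finally show ?case by auto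
      qed
    qed auto
    also have "\<dots> = ennreal (1 - r ^ 4)"
      using U.prob_compl[of "{v. cmod (snd v) < r}"] P by (simp add: U.emeasure_eq_measure)
    finally show "emeasure ?U {v \<in> space ?U. log_size v \<le> a} = 1 - ennreal (exp (- a * 2))"
      unfolding r4 by (simp add: ennreal_minus ennreal_1[symmetric] del: ennreal_1)
  qed simp
qed

section \<open>Distribution function and annuli\<close>

definition annuli :: "real \<Rightarrow> real \<Rightarrow> complex set" where
  "annuli \<delta> s = (\<Union>p\<in>gaussian_ints - {0}. \<Union>q\<in>gaussian_ints.
     annulus (q / p) (exp s / \<delta>) (exp (s / 2) / cmod p))"

lemma compact_annulus: "compact (annulus z r R)"
proof -
  have "annulus z r R = {w. r \<le> cmod (w - z)} \<inter> cball z R"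
    by (auto simp: annulus_def dist_norm norm_minus_commute)
  moreover have "closed {w. r \<le> cmod (w - z)}"
    by (intro closed_Collect_le continuous_intros)
  ultimately show ?thesis by (metis closed_Int_compact compact_cball)
qed

lemma annuli_borel: "annuli \<delta> s \<in> sets borel"
  unfolding annuli_def
  using countable_gaussian_ints
  by (intro sets.countable_UN' countable_Diff image_subsetI)
     (auto intro!: borel_compact compact_annulus)

lemma pr_annuli_borel: "pr ` annuli \<delta> s \<in> sets borel"
proof -
  have "compact (pr ` annulus z r R)" for z r R
    by (intro compact_continuous_image continuous_on_pr compact_annulus)
  moreover have "pr ` annuli \<delta> s = (\<Union>p\<in>gaussian_ints - {0}. \<Union>q\<in>gaussian_ints.
     pr ` annulus (q / p) (exp s / \<delta>) (exp (s / 2) / cmod p))"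
    by (auto simp: annuli_def)
  ultimately show ?thesis
    using countable_gaussian_ints
    by (simp only:) (intro sets.countable_UN' countable_Diff image_subsetI, auto intro: borel_compact)
qed

text \<open>The union of annuli is invariant under translation by Gaussian integers:
  \<open>q / p + g = (q + g * p) / p\<close>.\<close>

lemma pr_vimage_annuli: "pr -` (pr ` annuli \<delta> s) = annuli \<delta> s"
proof (intro equalityI subsetI)
  fix t assume "t \<in> pr -` (pr ` annuli \<delta> s)"
  then obtain t' where t': "pr t = pr t'" "t' \<in> annuli \<delta> s" by auto
  then have g: "t - t' \<in> gaussian_ints" by (simp add: pr_eq_iff)
  obtain p q where pq: "p \<in> gaussian_ints - {0}" "q \<in> gaussian_ints"
    "t' \<in> annulus (q / p) (exp s / \<delta>) (exp (s / 2) / cmod p)"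
    using t'(2) by (auto simp: annuli_def)
  define q' where "q' = q + (t - t') * p"
  have q': "q' \<in> gaussian_ints" using pq g by (auto simp: q'_def intro!: gaussian_ints_add gaussian_ints_mult)
  have "t - q' / p = t' - q / p" using pq by (simp add: q'_def field_simps)
  then have "t \<in> annulus (q' / p) (exp s / \<delta>) (exp (s / 2) / cmod p)"
    using pq(3) by (simp add: annulus_def)
  then show "t \<in> annuli \<delta> s" using pq q' unfolding annuli_def by blast
qed auto

lemma haar_annuli:
  "emeasure haar_prob (pr ` annuli \<delta> s) = emeasure lborel (annuli \<delta> s \<inter> unit_square)"
  unfolding haar_prob_gtorus_eq emeasure_square_measure[OF pr_annuli_borel] pr_vimage_annuli ..

text \<open>The radii depend measurably on \<open>s\<close>, so this is the measurability of section measures of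
  a Borel set in \<open>\<real> \<times> \<complex>\<close>.\<close>

lemma haar_annuli_measurable:
  "(\<lambda>s. emeasure haar_prob (pr ` annuli \<delta> s)) \<in> borel_measurable borel"
proof -
  define S where "S = {x :: real \<times> complex. snd x \<in> unit_square \<and> (\<exists>p\<in>gaussian_ints - {0}. \<exists>q\<in>gaussian_ints.
     exp (fst x) / \<delta> \<le> cmod (snd x - q / p) \<and> cmod (snd x - q / p) \<le> exp (fst x / 2) / cmod p)}"
  have "S = (\<Union>p\<in>gaussian_ints - {0}. \<Union>q\<in>gaussian_ints. {x :: real \<times> complex. snd x \<in> unit_square \<and>
     exp (fst x) / \<delta> \<le> cmod (snd x - q / p) \<and> cmod (snd x - q / p) \<le> exp (fst x / 2) / cmod p})"
    by (auto simp: S_def)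
  also have "\<dots> \<in> sets (borel \<Otimes>\<^sub>M borel)"
  proof (intro sets.countable_UN' countable_Diff image_subsetI countable_gaussian_ints)
    fix p q :: complex
    have "{x \<in> space (borel \<Otimes>\<^sub>M borel). snd x \<in> unit_square \<and>
      exp (fst x) / \<delta> \<le> cmod (snd x - q / p) \<and> cmod (snd x - q / p) \<le> exp (fst x / 2) / cmod p}
      \<in> sets ((borel :: real measure) \<Otimes>\<^sub>M (borel :: complex measure))"
      by measurable
    then show "{x :: real \<times> complex. snd x \<in> unit_square \<and>
      exp (fst x) / \<delta> \<le> cmod (snd x - q / p) \<and> cmod (snd x - q / p) \<le> exp (fst x / 2) / cmod p}
      \<in> sets (borel \<Otimes>\<^sub>M borel)"
      by (simp add: space_pair_measure)
  qed
  finally have "S \<in> sets (borel \<Otimes>\<^sub>M lborel)" by (simp cong: sets_pair_measure_cong)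
  from lborel.measurable_emeasure_Pair[OF this]
  have "(\<lambda>s. emeasure lborel (Pair s -` S)) \<in> borel_measurable borel" by simp
  moreover have "Pair s -` S = annuli \<delta> s \<inter> unit_square" for s
    by (auto simp: S_def annuli_def annulus_def)
  ultimately show ?thesis by (simp add: haar_annuli)
qed

text \<open>Divide \<open>\<bar>p * z - q * w\<bar>\<close> by \<open>\<bar>p * w\<bar>\<close> in the two inequalities that define
  \<open>gap_reach\<close>, with \<open>D = p\<close> and \<open>g = - q\<close>, and use \<open>\<bar>w\<bar> = exp (- s / 2)\<close>.\<close>

lemma gap_reach_iff_annuli:
  assumes w: "w \<noteq> 0" and \<delta>: "\<delta> > 0"
  shows "gap_reach \<delta> (z, w) \<longleftrightarrow> z / w \<in> annuli \<delta> (log_size (z, w))"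
proof -
  define s where "s = log_size (z, w)"
  have e1: "exp (s / 2) = 1 / cmod w"
    using w by (simp add: s_def log_size_def exp_minus field_simps)
  have "exp s = exp (s / 2) * exp (s / 2)" by (simp flip: exp_add)
  then have e2: "exp s = 1 / (cmod w)\<^sup>2" unfolding e1 by (simp add: power2_eq_square)
  note es = e1 e2
  have key: "z / w \<in> annulus (q / p) (exp s / \<delta>) (exp (s / 2) / cmod p) \<longleftrightarrow>
     cmod (lform p (- q) (z, w)) \<le> 1 \<and> cmod p \<le> \<delta> * (cmod (snd (z, w)) * cmod (lform p (- q) (z, w)))"
    if p: "p \<noteq> 0" for p q
  proof -
    have "lform p (- q) (z, w) = (z / w - q / p) * (p * w)"
      using p w by (simp add: lform_def field_simps)
    then have n: "cmod (lform p (- q) (z, w)) = cmod (z / w - q / p) * (cmod p * cmod w)"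
      by (simp add: norm_mult)
    have p0: "0 < cmod p" "0 < cmod w" using p w by auto
    have "cmod (z / w - q / p) \<le> exp (s / 2) / cmod p \<longleftrightarrow> cmod (lform p (- q) (z, w)) \<le> 1"
      unfolding n es using p0 by (simp add: pos_le_divide_eq mult_ac)
    moreover have "exp s / \<delta> \<le> cmod (z / w - q / p) \<longleftrightarrow>
        1 \<le> \<delta> * (cmod w)\<^sup>2 * cmod (z / w - q / p)"
      unfolding es using p0 \<delta> by (simp add: pos_divide_le_eq mult_ac)
    moreover have "cmod p \<le> \<delta> * (cmod w * cmod (lform p (- q) (z, w))) \<longleftrightarrow>
        cmod p * 1 \<le> cmod p * (\<delta> * (cmod w)\<^sup>2 * cmod (z / w - q / p))"
      unfolding n by (simp add: power2_eq_square mult_ac)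
    then have "cmod p \<le> \<delta> * (cmod w * cmod (lform p (- q) (z, w))) \<longleftrightarrow>
        1 \<le> \<delta> * (cmod w)\<^sup>2 * cmod (z / w - q / p)"
      using p0 by (simp only: mult_le_cancel_left_pos)
    ultimately show ?thesis unfolding annulus_def by auto
  qed
  have "z / w \<in> annuli \<delta> s \<longleftrightarrow> (\<exists>p\<in>gaussian_ints - {0}. \<exists>q\<in>gaussian_ints.
     cmod (lform p (- q) (z, w)) \<le> 1 \<and> cmod p \<le> \<delta> * (cmod (snd (z, w)) * cmod (lform p (- q) (z, w))))"
    unfolding annuli_def using key by auto
  also have "\<dots> \<longleftrightarrow> gap_reach \<delta> (z, w)"
    unfolding gap_reach_def using gaussian_ints_uminus by (metis minus_minus)
  finally show ?thesis by (simp add: s_def)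
qed

lemma gap_law_distribution:
  assumes \<delta>: "\<delta> > 0"
  shows "emeasure gap_law {0..\<delta>} =
      2 * (\<integral>\<^sup>+s\<in>{0..}. emeasure haar_prob (pr ` annuli \<delta> s) * ennreal (exp (- 2 * s)) \<partial>lborel)"
proof -
  let ?V = "emeasure lborel farey_cone"
  let ?\<Phi> = "\<lambda>s. emeasure haar_prob (pr ` annuli \<delta> s)"
  let ?wt = "\<lambda>w :: complex. ennreal ((cmod w)\<^sup>2) * indicator {w. w \<noteq> 0 \<and> cmod w \<le> 1} w"
  let ?L = "\<lambda>w :: complex. log_size (0, w)"
  have L: "log_size (z, w) = ?L w" for z w by (simp add: log_size_def)
  have Lm [measurable]: "log_size \<in> borel_measurable borel" unfolding log_size_def by measurable
  have Lm' [measurable]: "?L \<in> borel_measurable borel" unfolding log_size_def by simp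
  note haar_annuli_measurable[measurable]
  have A: "{0..\<delta>} \<in> sets (restrict_space borel {0..})" by (simp add: sets_restrict_space_iff)
  have "{v \<in> farey_cone. gap_fun v \<in> {0..\<delta>}} = farey_cone \<inter> {v. gap_reach \<delta> v}"
    using gap_fun_le_iff[OF farey_cone_denom] gap_fun_ge_1[OF farey_cone_denom] by (fastforce intro: order_trans[of 0 1])
  then have 1: "emeasure gap_law {0..\<delta>} = emeasure lborel (farey_cone \<inter> {v. gap_reach \<delta> v}) / ?V"
    by (simp add: emeasure_gap_law[OF A])
  have "emeasure lborel (farey_cone \<inter> {v. gap_reach \<delta> v})
      = (\<integral>\<^sup>+w. emeasure lborel (annuli \<delta> (?L w) \<inter> unit_square) * ?wt w \<partial>lborel)"
  proof (rule emeasure_cone_slices[OF gap_reach_borel annuli_borel])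
    fix z w assume "(z, w) \<in> farey_cone"
    then have "w \<noteq> 0" using farey_cone_denom by (force simp: disc_denom_def)
    then show "(z, w) \<in> {v. gap_reach \<delta> v} \<longleftrightarrow> z / w \<in> annuli \<delta> (?L w)"
      using gap_reach_iff_annuli[OF _ \<delta>, of w z] L[of z w] by simp
  qed
  also have "\<dots> = (\<integral>\<^sup>+w. ?\<Phi> (?L w) * ?wt w \<partial>lborel)" by (simp add: haar_annuli)
  also have "\<dots> = (\<integral>\<^sup>+v. ?\<Phi> (log_size v) * indicator farey_cone v \<partial>lborel)"
  proof -
    have m: "(\<lambda>v. ?\<Phi> (log_size v) * indicator farey_cone v) \<in> borel_measurable (lborel \<Otimes>\<^sub>M lborel)"
      unfolding lborel_prod by measurable
    have "(\<integral>\<^sup>+v. ?\<Phi> (log_size v) * indicator farey_cone v \<partial>lborel)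
        = (\<integral>\<^sup>+w. (\<integral>\<^sup>+z. ?\<Phi> (log_size (z, w)) * indicator farey_cone (z, w) \<partial>lborel) \<partial>lborel)"
      unfolding lborel_prod[symmetric] by (rule lborel_pair.nn_integral_snd[OF m, symmetric])
    also have "\<dots> = (\<integral>\<^sup>+w. ?\<Phi> (?L w) * ?wt w \<partial>lborel)"
    proof (rule nn_integral_cong)
      fix w
      let ?i = "indicator {w. w \<noteq> 0 \<and> cmod w \<le> 1} w :: ennreal"
      have usq: "{z. z / w \<in> unit_square} \<in> sets lborel" by measurable
      have "(\<integral>\<^sup>+z. ?\<Phi> (log_size (z, w)) * indicator farey_cone (z, w) \<partial>lborel)
          = (\<integral>\<^sup>+z. (?\<Phi> (?L w) * ?i) * indicator {z. z / w \<in> unit_square} z \<partial>lborel)"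
      proof (rule nn_integral_cong)
        fix z
        show "?\<Phi> (log_size (z, w)) * indicator farey_cone (z, w)
            = (?\<Phi> (?L w) * ?i) * indicator {z. z / w \<in> unit_square} z"
          by (simp add: L[of z w] farey_cone_def disc_denom_def indicator_def)
      qed
      also have "\<dots> = (?\<Phi> (?L w) * ?i) * emeasure lborel {z. z / w \<in> unit_square}"
        by (rule nn_integral_cmult_indicator[OF usq])
      also have "\<dots> = ?\<Phi> (?L w) * ?wt w"
      proof (cases "w = 0")
        case False
        then have "emeasure lborel {z. z / w \<in> unit_square} = ennreal ((cmod w)\<^sup>2)"
          using emeasure_lborel_complex_mult[OF unit_square_borel, of w] by (simp add: emeasure_unit_square)
        then show ?thesis by (simp only: mult_ac)
      qed simp
      finally show "(\<integral>\<^sup>+z. ?\<Phi> (log_size (z, w)) * indicator farey_cone (z, w) \<partial>lborel) = ?\<Phi> (?L w) * ?wt w" .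
    qed
    finally show ?thesis ..
  qed
  finally have "emeasure gap_law {0..\<delta>} = (\<integral>\<^sup>+v. ?\<Phi> (log_size v) * indicator farey_cone v \<partial>lborel) / ?V"
    using 1 by simp
  also have "\<dots> = (\<integral>\<^sup>+v. ?\<Phi> (log_size v) \<partial>uniform_measure lborel farey_cone)"
    by (rule nn_integral_uniform_measure[symmetric]) auto
  also have "\<dots> = (\<integral>\<^sup>+s. ennreal (exponential_density 2 s) * ?\<Phi> s \<partial>lborel)"
    by (rule distributed_nn_integral[OF log_size_exponential, symmetric]) simp
  also have "\<dots> = (\<integral>\<^sup>+s. 2 * (?\<Phi> s * ennreal (exp (- 2 * s)) * indicator {0..} s) \<partial>lborel)"
    by (intro nn_integral_cong) (auto simp: exponential_density_def indicator_def ennreal_mult mult_ac)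
  also have "\<dots> = 2 * (\<integral>\<^sup>+s\<in>{0..}. ?\<Phi> s * ennreal (exp (- 2 * s)) \<partial>lborel)"
    by (rule nn_integral_cmult) measurable
  finally show ?thesis .
qed

section \<open>Tail asymptotics\<close>

lemma measure_cone_snd_less:
  assumes "0 < r" "r \<le> 1"
  shows "measure lborel {v \<in> farey_cone. cmod (snd v) < r} = r ^ 4 * measure lborel farey_cone"
  using emeasure_cone_snd_less[OF assms] assms by (simp add: measure_def enn2real_mult)

text \<open>The event contains \<open>\<bar>w\<bar> < 1 / \<delta>\<close> by the lower bound on \<open>gap_fun\<close>. For the converse,
  the crude upper bound forces \<open>\<bar>w\<bar> < 1 / 4\<close> as soon as \<open>\<delta> \<ge> 32\<close>; the refined one then
  gives \<open>\<bar>w\<bar> < 2 / \<delta>\<close> and, inserted again, \<open>\<bar>w\<bar> < 1 / \<delta> + 8 / \<delta>\<^sup>2\<close>.\<close>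

lemma gap_law_tail_bounds:
  assumes \<delta>: "\<delta> \<ge> 32"
  shows "1 / \<delta> ^ 4 \<le> measure gap_law {\<delta><..}" "measure gap_law {\<delta><..} \<le> (1 / \<delta> + 8 / \<delta>\<^sup>2) ^ 4"
proof -
  let ?V = "measure lborel farey_cone"
  let ?B = "{v \<in> farey_cone. gap_fun v \<in> {\<delta><..}}"
  let ?C = "\<lambda>r. {v \<in> farey_cone. cmod (snd v) < r}"
  have A: "{\<delta><..} \<in> sets (restrict_space borel {0..})"
    using \<delta> by (auto simp: sets_restrict_space_iff)
  have fin: "X \<in> fmeasurable lborel" if "X \<in> sets borel" "X \<subseteq> farey_cone" for X
    using that emeasure_mono[of X farey_cone lborel] emeasure_farey_cone(2)
    by (auto simp: fmeasurable_def top.not_eq_extremum less_top)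
  have B: "?B \<in> fmeasurable lborel" by (intro fin gap_fun_cone_borel) auto
  have C: "?C r \<in> fmeasurable lborel" for r by (intro fin cone_snd_less_borel) auto
  have m: "measure gap_law {\<delta><..} = measure lborel ?B / ?V"
  proof -
    have "emeasure lborel ?B = ennreal (measure lborel ?B)"
      using B by (simp add: emeasure_eq_measure2)
    moreover have "emeasure lborel farey_cone = ennreal ?V"
      using emeasure_farey_cone by (simp add: emeasure_eq_ennreal_measure)
    ultimately have "emeasure gap_law {\<delta><..} = ennreal (measure lborel ?B / ?V)"
      unfolding emeasure_gap_law[OF A] using measure_farey_cone_pos by (simp add: divide_ennreal)
    then show ?thesis by (simp add: measure_def)
  qed
  have "?C (1 / \<delta>) \<subseteq> ?B"
  proof
    fix v assume v: "v \<in> ?C (1 / \<delta>)"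
    then have good: "disc_denom v" using farey_cone_denom by blast
    then have "\<delta> < 1 / cmod (snd v)" using v \<delta> by (auto simp: disc_denom_def field_simps)
    then show "v \<in> ?B" using v gap_fun_lower[OF good] by auto
  qed
  then have "measure lborel (?C (1 / \<delta>)) \<le> measure lborel ?B"
    using B C by (intro measure_mono_fmeasurable) auto
  then show "1 / \<delta> ^ 4 \<le> measure gap_law {\<delta><..}"
    using \<delta> measure_farey_cone_pos
    by (simp add: m measure_cone_snd_less power_divide pos_le_divide_eq)
  define r where "r = 1 / \<delta> + 8 / \<delta>\<^sup>2"
  have r: "0 < r" "r \<le> 1"
  proof -
    show "0 < r" using \<delta> by (simp add: r_def add_pos_pos)
    have "1 / \<delta> \<le> 1 / 32" using \<delta> by (intro divide_left_mono) auto
    moreover have "8 / \<delta>\<^sup>2 \<le> 8 / 32\<^sup>2" using \<delta> by (intro divide_left_mono power_mono) auto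
    ultimately show "r \<le> 1" by (simp add: r_def)
  qed
  have "?B \<subseteq> ?C r"
  proof
    fix v assume v: "v \<in> ?B"
    then have good: "disc_denom v" using farey_cone_denom by blast
    define x where "x = cmod (snd v)"
    have x: "0 < x" using good by (simp add: x_def disc_denom_def)
    have "\<delta> < 2 / x\<^sup>2" using v gap_fun_upper[OF good] by (auto simp: x_def)
    then have "\<delta> * x\<^sup>2 < 2" using x by (simp add: field_simps)
    moreover have "32 * x\<^sup>2 \<le> \<delta> * x\<^sup>2" using \<delta> by (intro mult_right_mono) auto
    ultimately have "x\<^sup>2 < (1 / 4)\<^sup>2" by (simp add: power2_eq_square)
    then have x4: "x < 1 / 4" by (rule power_less_imp_less_base) simp
    then have "\<delta> < 1 / (x * (1 - 2 * x))"
      using v gap_fun_upper_small[OF good] by (auto simp: x_def)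
    then have d: "\<delta> * (x * (1 - 2 * x)) < 1" using x x4 by (simp add: pos_less_divide_eq)
    have "x * (1 / 2) \<le> x * (1 - 2 * x)" using x x4 by (intro mult_left_mono) auto
    from mult_left_mono[OF this, of \<delta>]
    have "\<delta> * (x * (1 / 2)) \<le> \<delta> * (x * (1 - 2 * x))" using \<delta> by simp
    then have "\<delta> * x < 2" using d by simp
    then have x2: "x < 2 / \<delta>" using \<delta> by (simp add: field_simps)
    then have "x\<^sup>2 < (2 / \<delta>)\<^sup>2" using x by (intro power_strict_mono) auto
    moreover have "x - 2 * x\<^sup>2 < 1 / \<delta>" using d \<delta> by (simp add: field_simps power2_eq_square)
    ultimately have "x < r" by (simp add: r_def power_divide)
    then show "v \<in> ?C r" using v by (simp add: x_def)
  qed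
  then have "measure lborel ?B \<le> measure lborel (?C r)"
    using B C by (intro measure_mono_fmeasurable) auto
  then show "measure gap_law {\<delta><..} \<le> (1 / \<delta> + 8 / \<delta>\<^sup>2) ^ 4"
    using measure_farey_cone_pos r
    by (simp add: m measure_cone_snd_less pos_divide_le_eq flip: r_def)
qed

lemma gap_law_tail: "(\<lambda>\<delta>. measure gap_law {\<delta><..} - 1 / \<delta> ^ 4) \<in> O(\<lambda>\<delta>. 1 / \<delta> ^ 5)"
proof (rule bigoI)
  show "\<forall>\<^sub>F \<delta> in at_top. norm (measure gap_law {\<delta><..} - 1 / \<delta> ^ 4) \<le> 120 * norm (1 / \<delta> ^ 5)"
    using eventually_ge_at_top[of 32]
  proof eventually_elim
    case (elim \<delta>)
    define x where "x = 8 / \<delta>"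
    have x: "0 \<le> x" "x \<le> 1" using elim by (auto simp: x_def)
    have "x\<^sup>2 \<le> x" "x ^ 3 \<le> x" "x ^ 4 \<le> x"
      using x power_decreasing[of 1 2 x] power_decreasing[of 1 3 x] power_decreasing[of 1 4 x] by simp_all
    (* For 0 <= x <= 1 every higher power of x is at most x; 15 * 8 = 120 is the final constant. *)
    moreover have "(1 + x) ^ 4 = 1 + 4 * x + 6 * x\<^sup>2 + 4 * x ^ 3 + x ^ 4"
      by (simp add: power4_eq_xxxx power2_eq_square power3_eq_cube algebra_simps)
    ultimately have "(1 + x) ^ 4 \<le> 1 + 15 * x" by linarith
    moreover have "1 / \<delta> + 8 / \<delta>\<^sup>2 = (1 / \<delta>) * (1 + x)"
      using elim by (simp add: x_def power2_eq_square field_simps)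
    then have "(1 / \<delta> + 8 / \<delta>\<^sup>2) ^ 4 = (1 / \<delta> ^ 4) * (1 + x) ^ 4"
      by (simp add: power_mult_distrib power_divide)
    ultimately have "(1 / \<delta> + 8 / \<delta>\<^sup>2) ^ 4 \<le> (1 / \<delta> ^ 4) * (1 + 15 * x)"
      using elim by (simp add: divide_right_mono)
    also have "\<dots> = 1 / \<delta> ^ 4 + 120 / \<delta> ^ 5"
      using elim by (simp add: x_def field_simps eval_nat_numeral)
    finally show ?case using gap_law_tail_bounds[OF elim] elim by simp
  qed
qed

theorem theorem1p1:
  shows "\<exists>\<mu> :: real measure.
    prob_space \<mu> \<and>
    sets \<mu> = sets (restrict_space borel {0..}) \<and>
    absolutely_continuous (restrict_space lborel {0..}) \<mu> \<and>
    vague_conv_on {0..} gap_measure \<mu> at_top \<and>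
    measure_support \<mu> = {1..} \<and>
    (\<forall>\<delta>>0. emeasure \<mu> {0..\<delta>} =
      2 * (\<integral>\<^sup>+s\<in>{0..}.
        emeasure haar_prob
          (pr ` (\<Union>p\<in>gaussian_ints - {0}. \<Union>q\<in>gaussian_ints.
            annulus (q / p) (exp s / \<delta>) (exp (s / 2) / cmod p)))
        * ennreal (exp (- 2 * s)) \<partial>lborel)) \<and>
    (\<lambda>\<delta>. measure \<mu> {\<delta><..} - 1 / \<delta> ^ 4) \<in> O(\<lambda>\<delta>. 1 / \<delta> ^ 5)"
  using prob_space_gap_law sets_gap_law gap_law_absolutely_continuous gap_law_vague_conv
    gap_law_support gap_law_distribution[unfolded annuli_def] gap_law_tail
  by (intro exI[of _ gap_law] conjI allI impI)

end
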